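(* Assume that the ground field $\mathbb F$ has characteristic zero. For a triality of dimension $n\in\{1,2,4,8\}$ over $\mathbb F$, with summands $\mathbb V_1,\mathbb V_2,\mathbb V_3$, the triality algebra $\mathfrak T\subset\mathfrak{so}(\mathbb V_1)\oplus\mathfrak{so}(\mathbb V_2)\oplus\mathfrak{so}(\mathbb V_3)$ is as follows. 1. If $n=1$, then $\mathfrak T=0$. 2. If $n=2$, then each algebra $\mathfrak{so}(\mathbb V_r)$ is one-dimensional. After identifying these three lines with $\mathbb F$ (by a suitable choice of generator of each), the triality algebra is $\mathfrak T\cong\{(a,b,c)\in\mathbb F^3: a+b+c=0\}$. In particular $\mathfrak T$ is abelian of dimension $2$. 3. If $n=4$, then each algebra $\mathfrak{so}(\mathbb V_r)$ splits into two simple three-dimensional summands, $\mathfrak{so}(4)\cong\mathfrak{so}(3)_+\oplus\mathfrak{so}(3)_-$. The triality constraint annihilates one chirality (one of the two summands) and leaves the other free; equivalently, the triality algebra $\mathfrak T$ is the direct sum of one three-dimensional summand from each of the three factors $\mathfrak{so}(\mathbb V_r)$. In particular $\dim\mathfrak T=9$. 4. If $n=8$, then projection onto any one factor gives an isomorphism $\mathfrak T\to\mathfrak{so}(\mathbb V_r)$, so that $\mathfrak T\cong\mathfrak{so}(8)$ and therefore $\dim\mathfrak T=28$.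
   Context: **Triality.** Over a field $\mathbb F$ of characteristic zero, a triality of dimension $n$ consists of an $\mathbb F$-vector space $\mathbb V$ with a non-degenerate symmetric bilinear form $g$, a direct sum decomposition $\mathbb V=\mathbb V_1\oplus\mathbb V_2\oplus\mathbb V_3$ into pairwise $g$-orthogonal subspaces each of dimension $n$, and a symmetric trilinear form $\tau$ on $\mathbb V$ such that, for $x\in\mathbb V_i$, $y\in\mathbb V_j$, $z\in\mathbb V_k$, $\tau(x,y,z)=0$ unless $i,j,k$ are pairwise distinct. The commutative bilinear product $xy$ on $\mathbb V$ is defined by $\tau(x,y,z)=g(xy,z)$ for all $z$. It is required that for all distinct $i,j,k$, all $y\in\mathbb V_j$ and all $x\in\mathbb V_i+\mathbb V_k$, one has $x(xy)=g(x,x)y$. $\mathfrak{so}(\mathbb V_r)$ is the Lie algebra of endomorphisms of $\mathbb V_r$ skew with respect to $g|_{\mathbb V_r}$; $\mathfrak{so}(m)$ denotes the orthogonal Lie algebra of an $m$-dimensional space with its given form. **Triality algebra.** $\mathfrak T$ is the Lie algebra (under componentwise commutator) of triples $(p,q,r)\in\mathfrak{so}(\mathbb V_1)\oplus\mathfrak{so}(\mathbb V_2)\oplus\mathfrak{so}(\mathbb V_3)$ satisfying the triality constraint $\tau(px,y,z)+\tau(x,qy,z)+\tau(x,y,rz)=0$ for all $x\in\mathbb V_1$, $y\in\mathbb V_2$, $z\in\mathbb V_3$.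
   Formalization: For n=4, T is not literally an internal sum of one summand per factor, nor is a chirality annihilated ((p,0,0) in T forces p=0). Proved instead: projecting T to one chirality of each so(V_r) is a Lie isomorphism onto their direct sum, and T meets the sum of the other chiralities only in 0. *)

theory Defs
  imports Complex_Main "HOL-Library.Function_Algebras" "HOL-Library.Product_Plus"
begin

text \<open>
  A Lie algebra is presented as a subspace \<open>lcarrier\<close> of an ambient vector space (a whole type,
  whose addition is the one of the type class), together with scalar multiplication and bracket.
\<close>

record ('f, 'a) lie =
  lcarrier :: "'a set"
  lsmult :: "'f \<Rightarrow> 'a \<Rightarrow> 'a"
  lbracket :: "'a \<Rightarrow> 'a \<Rightarrow> 'a"

locale lie_algebra =
  fixes L :: "('f::field, 'a::ab_group_add) lie"
  assumes vector_space: "vector_space (lsmult L)"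
    and subspace: "module.subspace (lsmult L) (lcarrier L)"
    and closed: "\<lbrakk>x \<in> lcarrier L; y \<in> lcarrier L\<rbrakk> \<Longrightarrow> lbracket L x y \<in> lcarrier L"
    and add_left: "\<lbrakk>x \<in> lcarrier L; y \<in> lcarrier L; z \<in> lcarrier L\<rbrakk> \<Longrightarrow>
      lbracket L (x + y) z = lbracket L x z + lbracket L y z"
    and smult_left: "\<lbrakk>x \<in> lcarrier L; y \<in> lcarrier L\<rbrakk> \<Longrightarrow>
      lbracket L (lsmult L c x) y = lsmult L c (lbracket L x y)"
    and add_right: "\<lbrakk>x \<in> lcarrier L; y \<in> lcarrier L; z \<in> lcarrier L\<rbrakk> \<Longrightarrow>
      lbracket L x (y + z) = lbracket L x y + lbracket L x z"
    and smult_right: "\<lbrakk>x \<in> lcarrier L; y \<in> lcarrier L\<rbrakk> \<Longrightarrow>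
      lbracket L x (lsmult L c y) = lsmult L c (lbracket L x y)"
    and alternating: "x \<in> lcarrier L \<Longrightarrow> lbracket L x x = 0"
    and jacobi: "\<lbrakk>x \<in> lcarrier L; y \<in> lcarrier L; z \<in> lcarrier L\<rbrakk> \<Longrightarrow>
      lbracket L x (lbracket L y z) + lbracket L y (lbracket L z x)
        + lbracket L z (lbracket L x y) = 0"

definition lie_dim :: "('f::field, 'a::ab_group_add) lie \<Rightarrow> nat" where
  "lie_dim L = vector_space.dim (lsmult L) (lcarrier L)"

definition lie_abelian :: "('f::field, 'a::ab_group_add) lie \<Rightarrow> bool" where
  "lie_abelian L \<longleftrightarrow> (\<forall>x\<in>lcarrier L. \<forall>y\<in>lcarrier L. lbracket L x y = 0)"

definition lie_ideal :: "'a set \<Rightarrow> ('f::field, 'a::ab_group_add) lie \<Rightarrow> bool" where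
  "lie_ideal I L \<longleftrightarrow> module.subspace (lsmult L) I \<and> I \<subseteq> lcarrier L \<and>
     (\<forall>x\<in>lcarrier L. \<forall>y\<in>I. lbracket L x y \<in> I)"

definition lie_simple :: "('f::field, 'a::ab_group_add) lie \<Rightarrow> bool" where
  "lie_simple L \<longleftrightarrow> \<not> lie_abelian L \<and> (\<forall>I. lie_ideal I L \<longrightarrow> I = {0} \<or> I = lcarrier L)"

definition lie_iso ::
  "('a \<Rightarrow> 'b) \<Rightarrow> ('f::field, 'a::ab_group_add) lie \<Rightarrow> ('f, 'b::ab_group_add) lie \<Rightarrow> bool" where
  "lie_iso \<phi> L M \<longleftrightarrow> bij_betw \<phi> (lcarrier L) (lcarrier M) \<and>
     (\<forall>x\<in>lcarrier L. \<forall>y\<in>lcarrier L. \<phi> (x + y) = \<phi> x + \<phi> y) \<and>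
     (\<forall>c. \<forall>x\<in>lcarrier L. \<phi> (lsmult L c x) = lsmult M c (\<phi> x)) \<and>
     (\<forall>x\<in>lcarrier L. \<forall>y\<in>lcarrier L. \<phi> (lbracket L x y) = lbracket M (\<phi> x) (\<phi> y))"

definition lie_sum3 ::
  "('f, 'a) lie \<Rightarrow> ('f, 'b) lie \<Rightarrow> ('f, 'c) lie \<Rightarrow> ('f, 'a \<times> 'b \<times> 'c) lie" where
  "lie_sum3 A B C = \<lparr>
     lcarrier = lcarrier A \<times> lcarrier B \<times> lcarrier C,
     lsmult = (\<lambda>t (x, y, z). (lsmult A t x, lsmult B t y, lsmult C t z)),
     lbracket = (\<lambda>(x, y, z) (x', y', z').
       (lbracket A x x', lbracket B y y', lbracket C z z'))\<rparr>"

definition lie_line :: "('f::field, 'f) lie" where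
  "lie_line = \<lparr>lcarrier = UNIV, lsmult = (*), lbracket = (\<lambda>_ _. 0)\<rparr>"

definition lie_plane :: "('f::field, 'f \<times> 'f \<times> 'f) lie" where
  "lie_plane = (lie_sum3 lie_line lie_line lie_line)\<lparr>lcarrier := {(a, b, c). a + b + c = 0}\<rparr>"

text \<open>
  The component in \<open>P\<close> of an element of the internal direct sum of \<open>P\<close> and \<open>M\<close>.
\<close>

definition component :: "'a::ab_group_add set \<Rightarrow> 'a set \<Rightarrow> 'a \<Rightarrow> 'a" where
  "component P M x = (THE p. p \<in> P \<and> x - p \<in> M)"

definition direct_sum2 :: "'a::ab_group_add set \<Rightarrow> 'a set \<Rightarrow> 'a set \<Rightarrow> bool" where
  "direct_sum2 P M S \<longleftrightarrow> {p + m |p m. p \<in> P \<and> m \<in> M} = S \<and> P \<inter> M = {0}"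


text \<open>
  Endomorphisms of a subspace \<open>W\<close> are represented by functions on the whole type that vanish
  outside \<open>W\<close>, so that equality of functions is equality of endomorphisms of \<open>W\<close>.
\<close>

definition endos :: "('f::field \<Rightarrow> 'v::ab_group_add \<Rightarrow> 'v) \<Rightarrow> 'v set \<Rightarrow> ('v \<Rightarrow> 'v) set" where
  "endos scale W = {f. (\<forall>x\<in>W. f x \<in> W) \<and>
     (\<forall>x\<in>W. \<forall>y\<in>W. f (x + y) = f x + f y) \<and>
     (\<forall>c. \<forall>x\<in>W. f (scale c x) = scale c (f x)) \<and>
     (\<forall>x. x \<notin> W \<longrightarrow> f x = 0)}"

definition so_lie ::
  "('f::field \<Rightarrow> 'v::ab_group_add \<Rightarrow> 'v) \<Rightarrow> ('v \<Rightarrow> 'v \<Rightarrow> 'f) \<Rightarrow> 'v set \<Rightarrow> ('f, 'v \<Rightarrow> 'v) lie" where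
  "so_lie scale g W = \<lparr>
     lcarrier = {f \<in> endos scale W. \<forall>x\<in>W. \<forall>y\<in>W. g (f x) y = - g x (f y)},
     lsmult = (\<lambda>c f x. scale c (f x)),
     lbracket = (\<lambda>f h. (f \<circ> h) - (h \<circ> f))\<rparr>"

definition nondegenerate_on :: "('v::ab_group_add \<Rightarrow> 'v \<Rightarrow> 'f::field) \<Rightarrow> 'v set \<Rightarrow> bool" where
  "nondegenerate_on g W \<longleftrightarrow> (\<forall>x\<in>W. (\<forall>y\<in>W. g x y = 0) \<longrightarrow> x = 0)"

definition tri_prod ::
  "('v \<Rightarrow> 'v \<Rightarrow> 'f) \<Rightarrow> ('v \<Rightarrow> 'v \<Rightarrow> 'v \<Rightarrow> 'f) \<Rightarrow> 'v \<Rightarrow> 'v \<Rightarrow> 'v" where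
  "tri_prod g \<tau> x y = (THE w. \<forall>z. \<tau> x y z = g w z)"

text \<open>
  The summands are \<open>V 1\<close>, \<open>V 2\<close>, \<open>V 3\<close>; other values of \<open>V\<close> are irrelevant.
  Linearity in one argument gives multilinearity by symmetry.  As \<open>dim\<close> is \<open>0\<close> on
  infinite-dimensional subspaces, finite dimension is required separately.
\<close>

locale triality = vector_space scale
  for scale :: "'f::field_char_0 \<Rightarrow> 'v::ab_group_add \<Rightarrow> 'v" +
  fixes g :: "'v \<Rightarrow> 'v \<Rightarrow> 'f"
    and V :: "nat \<Rightarrow> 'v set"
    and \<tau> :: "'v \<Rightarrow> 'v \<Rightarrow> 'v \<Rightarrow> 'f"
    and n :: nat
  assumes g_linear: "\<And>x. Vector_Spaces.linear scale (*) (g x)"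
    and g_sym: "\<And>x y. g x y = g y x"
    and g_nondeg: "nondegenerate_on g UNIV"
    and V_subspace: "\<And>i. i \<in> {1, 2, 3} \<Longrightarrow> subspace (V i)"
    and V_direct: "\<And>v. \<exists>!(x, y, z). x \<in> V 1 \<and> y \<in> V 2 \<and> z \<in> V 3 \<and> v = x + y + z"
    and V_finite: "\<And>i. i \<in> {1, 2, 3} \<Longrightarrow> \<exists>B. finite B \<and> span B = V i"
    and V_dim: "\<And>i. i \<in> {1, 2, 3} \<Longrightarrow> dim (V i) = n"
    and V_orth: "\<And>i j x y. \<lbrakk>i \<in> {1, 2, 3}; j \<in> {1, 2, 3}; i \<noteq> j; x \<in> V i; y \<in> V j\<rbrakk> \<Longrightarrow> g x y = 0"
    and \<tau>_linear: "\<And>x y. Vector_Spaces.linear scale (*) (\<tau> x y)"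
    and \<tau>_sym12: "\<And>x y z. \<tau> x y z = \<tau> y x z"
    and \<tau>_sym23: "\<And>x y z. \<tau> x y z = \<tau> x z y"
    and \<tau>_vanish: "\<And>i j k x y z. \<lbrakk>i \<in> {1, 2, 3}; j \<in> {1, 2, 3}; k \<in> {1, 2, 3};
        \<not> (i \<noteq> j \<and> j \<noteq> k \<and> i \<noteq> k); x \<in> V i; y \<in> V j; z \<in> V k\<rbrakk> \<Longrightarrow> \<tau> x y z = 0"
    and prod_prod: "\<And>i j k x y. \<lbrakk>i \<in> {1, 2, 3}; j \<in> {1, 2, 3}; k \<in> {1, 2, 3};
        i \<noteq> j; j \<noteq> k; i \<noteq> k; y \<in> V j; x \<in> {u + w |u w. u \<in> V i \<and> w \<in> V k}\<rbrakk> \<Longrightarrow>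
        tri_prod g \<tau> x (tri_prod g \<tau> x y) = scale (g x x) y"

definition triality_lie ::
  "('f::field \<Rightarrow> 'v::ab_group_add \<Rightarrow> 'v) \<Rightarrow> ('v \<Rightarrow> 'v \<Rightarrow> 'f) \<Rightarrow> (nat \<Rightarrow> 'v set) \<Rightarrow>
   ('v \<Rightarrow> 'v \<Rightarrow> 'v \<Rightarrow> 'f) \<Rightarrow> ('f, ('v \<Rightarrow> 'v) \<times> ('v \<Rightarrow> 'v) \<times> ('v \<Rightarrow> 'v)) lie" where
  "triality_lie scale g V \<tau> =
    (lie_sum3 (so_lie scale g (V 1)) (so_lie scale g (V 2)) (so_lie scale g (V 3)))
      \<lparr>lcarrier := {(p, q, r). p \<in> lcarrier (so_lie scale g (V 1)) \<and>
         q \<in> lcarrier (so_lie scale g (V 2)) \<and> r \<in> lcarrier (so_lie scale g (V 3)) \<and>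
         (\<forall>x\<in>V 1. \<forall>y\<in>V 2. \<forall>z\<in>V 3. \<tau> (p x) y z + \<tau> x (q y) z + \<tau> x y (r z) = 0)}\<rparr>"



lemma lbracket_so_lie: "lbracket (so_lie scale g W) f h x = f (h x) - h (f x)"
  by (simp add: so_lie_def)

lemma vector_space_fun:
  assumes "vector_space scale"
  shows "vector_space (\<lambda>c (f :: 'a \<Rightarrow> 'v::ab_group_add) x. scale (c :: 'f::field) (f x))"
proof -
  interpret vector_space scale by fact
  show ?thesis
    by unfold_locales (auto simp: fun_eq_iff scale_right_distrib scale_left_distrib)
qed

lemma lie_algebra_so_lie:
  fixes scale :: "'f::field \<Rightarrow> 'v::ab_group_add \<Rightarrow> 'v"
  assumes vs: "vector_space scale" and W: "module.subspace scale W"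
    and lin: "\<And>x. Vector_Spaces.linear scale (*) (g x)" and sym: "\<And>x y. g x y = g y x"
  shows "lie_algebra (so_lie scale g W)"
proof -
  interpret vector_space scale by fact
  interpret F: vector_space "\<lambda>c (f :: 'v \<Rightarrow> 'v) x. scale c (f x)"
    by (rule vector_space_fun) fact
  interpret G: Vector_Spaces.linear scale "(*)" "g z" for z by (rule lin)
  have L: "g (x + y) z = g x z + g y z" "g (x - y) z = g x z - g y z" "g 0 z = 0"
    "g (scale c x) z = c * g x z" for x y z c
    using G.add[of z x y] G.diff[of z x y] G.zero[of z] G.scale[of z c x]
    by (simp_all add: sym[of _ z])
  note R = G.add G.diff G.zero G.scale
  note W0 = subspace_0[OF W] and Wadd = subspace_add[OF W] and Wsc = subspace_scale[OF W]
    and Wdiff = subspace_diff[OF W]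
  define S where "S = {f \<in> endos scale W. \<forall>x\<in>W. \<forall>y\<in>W. g (f x) y = - g x (f y)}"
  have eval: "f x \<in> W" and e_add: "y \<in> W \<Longrightarrow> z \<in> W \<Longrightarrow> f (y + z) = f y + f z"
    and e_scale: "y \<in> W \<Longrightarrow> f (scale c y) = scale c (f y)"
    and e_out: "y \<notin> W \<Longrightarrow> f y = 0" and e_skew: "y \<in> W \<Longrightarrow> z \<in> W \<Longrightarrow> g (f y) z = - g y (f z)"
    if "f \<in> S" for f x y z c
    using that W0 by (cases "x \<in> W"; auto simp: S_def endos_def)+
  have e_diff: "f (y - z) = f y - f z" if "f \<in> S" "y \<in> W" "z \<in> W" for f y z
    using e_add[OF that(1), of "y - z" z] Wdiff that by simp
  have e_zero: "f 0 = 0" if "f \<in> S" for f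
    using e_diff[OF that W0 W0] by simp
  show ?thesis
    unfolding so_lie_def S_def[symmetric]
  proof (rule lie_algebra.intro, unfold lie.simps)
    show "vector_space (\<lambda>c (f :: 'v \<Rightarrow> 'v) x. scale c (f x))" by (rule F.vector_space_axioms)
    show "F.subspace S"
      unfolding F.subspace_def S_def endos_def
      by (auto simp: Wadd Wsc W0 L R scale_right_distrib mult.commute)
  next
    fix f h assume f: "f \<in> S" and h: "h \<in> S"
    have "(f \<circ> h) - (h \<circ> f) \<in> endos scale W"
      unfolding endos_def
      by (auto simp: scale_right_diff_distrib e_add[OF f] e_add[OF h] e_scale[OF f] e_scale[OF h]
          eval[OF f] eval[OF h] e_out[OF f] e_out[OF h] e_zero[OF f] e_zero[OF h] Wdiff W0)
    moreover have "g (((f \<circ> h) - (h \<circ> f)) x) y = - g x (((f \<circ> h) - (h \<circ> f)) y)"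
      if "x \<in> W" "y \<in> W" for x y
      using that by (simp add: L R e_skew[OF f] e_skew[OF h] eval[OF f] eval[OF h])
    ultimately show "(f \<circ> h) - (h \<circ> f) \<in> S"
      by (simp add: S_def)
  qed (auto simp: fun_eq_iff e_add e_scale e_diff eval scale_right_diff_distrib)
qed

lemma lie_algebra_sum3:
  assumes "lie_algebra A" "lie_algebra B" "lie_algebra C"
  shows "lie_algebra (lie_sum3 A B C)"
proof -
  interpret A: lie_algebra A by fact
  interpret B: lie_algebra B by fact
  interpret C: lie_algebra C by fact
  interpret VA: vector_space "lsmult A" by (rule A.vector_space)
  interpret VB: vector_space "lsmult B" by (rule B.vector_space)
  interpret VC: vector_space "lsmult C" by (rule C.vector_space)
  have vs: "vector_space (\<lambda>t (x, y, z). (lsmult A t x, lsmult B t y, lsmult C t z))"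
    by unfold_locales (auto simp: VA.scale_right_distrib VB.scale_right_distrib
        VC.scale_right_distrib VA.scale_left_distrib VB.scale_left_distrib VC.scale_left_distrib)
  interpret V: vector_space "\<lambda>t (x, y, z). (lsmult A t x, lsmult B t y, lsmult C t z)"
    by (rule vs)
  show ?thesis
    unfolding lie_sum3_def
  proof (rule lie_algebra.intro, unfold lie.simps)
    show "V.subspace (lcarrier A \<times> lcarrier B \<times> lcarrier C)"
      using A.subspace B.subspace C.subspace
      unfolding V.subspace_def VA.subspace_def VB.subspace_def VC.subspace_def
      by (auto simp: zero_prod_def)
  qed (auto simp: vs zero_prod_def A.closed B.closed C.closed A.add_left B.add_left C.add_left
      A.add_right B.add_right C.add_right A.smult_left B.smult_left C.smult_left
      A.smult_right B.smult_right C.smult_right A.alternating B.alternating C.alternating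
      A.jacobi B.jacobi C.jacobi)
qed

lemma lie_algebra_restrict:
  assumes "lie_algebra L" "module.subspace (lsmult L) S" "S \<subseteq> lcarrier L"
    and "\<And>x y. \<lbrakk>x \<in> S; y \<in> S\<rbrakk> \<Longrightarrow> lbracket L x y \<in> S"
  shows "lie_algebra (L\<lparr>lcarrier := S\<rparr>)"
proof -
  interpret lie_algebra L by fact
  have *: "x \<in> lcarrier L" if "x \<in> S" for x using assms(3) that by blast
  show ?thesis
    by (rule lie_algebra.intro)
      (simp_all add: vector_space assms(2,4) * add_left add_right smult_left smult_right
        alternating jacobi)
qed

context triality
begin

lemma lie_algebra_so: "i \<in> {1, 2, 3} \<Longrightarrow> lie_algebra (so_lie scale g (V i))"
  by (rule lie_algebra_so_lie[OF vector_space_axioms V_subspace g_linear g_sym])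

lemma lie_algebra_triality: "lie_algebra (triality_lie scale g V \<tau>)"
proof -
  let ?T = "lcarrier (triality_lie scale g V \<tau>)"
  let ?L = "lie_sum3 (so_lie scale g (V 1)) (so_lie scale g (V 2)) (so_lie scale g (V 3))"
  interpret t: Vector_Spaces.linear scale "(*)" "\<tau> x y" for x y by (rule \<tau>_linear)
  note t3 = t.add t.diff t.zero t.scale
  have t2: "\<tau> x (y + y') z = \<tau> x y z + \<tau> x y' z" "\<tau> x (y - y') z = \<tau> x y z - \<tau> x y' z"
    "\<tau> x 0 z = 0" "\<tau> x (scale c y) z = c * \<tau> x y z" for x y y' z c
    using t3 by (simp_all add: \<tau>_sym23[of x _ z])
  have t1: "\<tau> (y + y') x z = \<tau> y x z + \<tau> y' x z" "\<tau> (y - y') x z = \<tau> y x z - \<tau> y' x z"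
    "\<tau> 0 x z = 0" "\<tau> (scale c y) x z = c * \<tau> y x z" for x y y' z c
    using t2 by (simp_all add: \<tau>_sym12[of _ x z])
  have L: "lie_algebra ?L"
    by (intro lie_algebra_sum3 lie_algebra_so) auto
  interpret L: lie_algebra ?L by (rule L)
  interpret VL: vector_space "lsmult ?L" by (rule L.vector_space)
  have sub: "?T \<subseteq> lcarrier ?L"
    by (auto simp: triality_lie_def lie_sum3_def)
  have T_iff: "(p, q, r) \<in> ?T \<longleftrightarrow> (p, q, r) \<in> lcarrier ?L \<and>
      (\<forall>x\<in>V 1. \<forall>y\<in>V 2. \<forall>z\<in>V 3. \<tau> (p x) y z + \<tau> x (q y) z + \<tau> x y (r z) = 0)" for p q r
    by (auto simp: triality_lie_def lie_sum3_def)
  have val: "f x \<in> V i" if "f \<in> lcarrier (so_lie scale g (V i))" "x \<in> V i" for f x i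
    using that by (auto simp: so_lie_def endos_def)
  have "VL.subspace ?T"
  proof (rule VL.subspaceI)
    show "0 \<in> ?T"
      using VL.subspace_0[OF L.subspace] by (simp add: zero_prod_def T_iff t1 t2 t3)
  next
    fix a b assume ab: "a \<in> ?T" "b \<in> ?T"
    obtain p q r p' q' r' where [simp]: "a = (p, q, r)" "b = (p', q', r')"
      by (metis prod_cases3)
    have "a + b \<in> lcarrier ?L"
      using VL.subspace_add[OF L.subspace, of a b] ab sub by blast
    moreover have "\<tau> (p x + p' x) y z + \<tau> x (q y + q' y) z + \<tau> x y (r z + r' z) = 0"
      if "x \<in> V 1" "y \<in> V 2" "z \<in> V 3" for x y z
    proof -
      have "\<tau> (p x) y z + \<tau> x (q y) z + \<tau> x y (r z) = 0"
        "\<tau> (p' x) y z + \<tau> x (q' y) z + \<tau> x y (r' z) = 0"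
        using ab that by (auto simp: T_iff)
      then show ?thesis
        by (simp add: t1 t2 t3) (metis (no_types, opaque_lifting) add.assoc add.left_commute add_0)
    qed
    ultimately show "a + b \<in> ?T"
      by (simp add: T_iff)
  next
    fix c a assume a: "a \<in> ?T"
    obtain p q r where [simp]: "a = (p, q, r)" by (metis prod_cases3)
    have *: "lsmult ?L c a = (\<lambda>x. scale c (p x), \<lambda>x. scale c (q x), \<lambda>x. scale c (r x))"
      by (simp add: lie_sum3_def so_lie_def)
    have "lsmult ?L c a \<in> lcarrier ?L"
      using VL.subspace_scale[OF L.subspace, of a c] a sub by blast
    then show "lsmult ?L c a \<in> ?T"
      using a by (simp only: *) (auto simp: T_iff t1 t2 t3 distrib_left[symmetric])
  qed
  moreover have "lbracket ?L a b \<in> ?T" if ab: "a \<in> ?T" "b \<in> ?T" for a b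
  proof -
    obtain p q r p' q' r' where [simp]: "a = (p, q, r)" "b = (p', q', r')"
      by (metis prod_cases3)
    have *: "lbracket ?L a b = ((p \<circ> p') - (p' \<circ> p), (q \<circ> q') - (q' \<circ> q), (r \<circ> r') - (r' \<circ> r))"
      by (simp add: lie_sum3_def so_lie_def)
    have in_L: "lbracket ?L a b \<in> lcarrier ?L"
      using L.closed ab sub by blast
    have mem: "p x \<in> V 1" "p' x \<in> V 1" "q y \<in> V 2" "q' y \<in> V 2" "r z \<in> V 3" "r' z \<in> V 3"
      if "x \<in> V 1" "y \<in> V 2" "z \<in> V 3" for x y z
      using ab that val by (auto simp: triality_lie_def)
    have T: "\<tau> (p x) y z = - \<tau> x (q y) z - \<tau> x y (r z)"
      "\<tau> (p' x) y z = - \<tau> x (q' y) z - \<tau> x y (r' z)"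
      if "x \<in> V 1" "y \<in> V 2" "z \<in> V 3" for x y z
      using ab that by (auto simp: T_iff eq_neg_iff_add_eq_0 algebra_simps)
    have "\<tau> (p (p' x) - p' (p x)) y z + \<tau> x (q (q' y) - q' (q y)) z
        + \<tau> x y (r (r' z) - r' (r z)) = 0" if "x \<in> V 1" "y \<in> V 2" "z \<in> V 3" for x y z
      using that by (simp add: t1 t2 t3 T mem del: One_nat_def)
    then show ?thesis
      using in_L by (simp only: *) (auto simp: T_iff)
  qed
  ultimately have "lie_algebra (?L\<lparr>lcarrier := ?T\<rparr>)"
    using lie_algebra_restrict[OF L _ sub] by blast
  then show ?thesis
    by (simp add: triality_lie_def)
qed

end

end

theory Submission
  imports Defs
begin

text \<open>
  The product makes each summand act on the sum of the other two by a Clifford representation.  For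
  orthogonal \<open>u, v\<close> in the first summand, the rotation \<open>x \<mapsto> 2 (g v x u - g u x v)\<close> and the
  operators \<open>y \<mapsto> u (v y)\<close> on the other two satisfy the triality constraint; since such rotations
  span \<open>so\<close>, each projection of the triality algebra is onto.  A triple \<open>(0, q, r)\<close> in its kernel
  has \<open>q\<close> commuting with the even Clifford algebra.  For \<open>n = 8\<close> this forces \<open>q = 0\<close>.  For
  \<open>n = 4\<close> a product of four orthogonal vectors acts on the other two summands by opposite scalars,
  so a rotation in a plane, plus or minus a multiple of the one in the orthogonal plane, extends
  to a triple with a zero in one slot.  These combinations span the two chiral ideals.
\<close>

section \<open>Lie algebras: dimension, simplicity, sums\<close>

text \<open>The field need not contain square roots and isotropic vectors may exist, so vectors are
  never normalised and no model of the quaternions or octonions is chosen. Everything rests on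
  orthogonal sets of vectors with nonzero square. A triple \<open>(0, q, r)\<close> is determined by
  \<open>q f\<close> for a single anisotropic \<open>f\<close>, because the products
  \<open>e (x f)\<close> fill \<open>B\<close>. For \<open>n = 8\<close>, \<open>q f\<close> is
  orthogonal to every product of four orthogonal vectors applied to \<open>f\<close>, and the
  dimension leaves room to rewrite \<open>e (v f)\<close>, with \<open>v\<close> orthogonal to
  \<open>e\<close>, as a multiple of such a product. For \<open>n = 4\<close> the triality algebra
  does not lie inside the sum of the three chosen summands: a triple \<open>(p, 0, s)\<close> with
  \<open>p\<close> nonzero has a nonzero \<open>s\<close> of the other chirality. The direct sum is
  therefore realised by the componentwise projection along the summands \<open>M r\<close>, which is
  injective because the algebra meets their product only in zero. Each chiral ideal is compared with
  \<open>so\<close> of a hyperplane orthogonal to an anisotropic \<open>e\<close>: evaluation at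
  \<open>e\<close> identifies either ideal with that hyperplane, so the stabiliser of
  \<open>e\<close> projects isomorphically to both.\<close>

lemma (in vector_space) dim_span_family:
  assumes "finite I"
    and indep: "\<And>c. (\<Sum>i\<in>I. scale (c i) (e i)) = 0 \<Longrightarrow> \<forall>i\<in>I. c i = 0"
  shows "dim (span (e ` I)) = card I"
proof -
  have inj: "inj_on e I"
  proof (rule inj_onI, rule ccontr)
    fix i j assume ij: "i \<in> I" "j \<in> I" "e i = e j" "i \<noteq> j"
    let ?c = "\<lambda>k. if k = i then 1 else if k = j then - 1 else 0"
    have "(\<Sum>k\<in>I. scale (?c k) (e k)) = (\<Sum>k\<in>{i, j}. scale (?c k) (e k))"
      using ij assms(1) by (intro sum.mono_neutral_right) auto
    also have "\<dots> = 0"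
      using ij by simp
    finally show False
      using indep[of ?c] ij by auto
  qed
  have "independent (e ` I)"
    using assms indep[of "\<lambda>i. u (e i)" for u] inj
    by (auto simp: dependent_finite sum.reindex)
  then show ?thesis
    using inj dim_span_eq_card_independent[of "e ` I"] card_image[of e I] by argo
qed

text \<open>\<open>\<phi>\<close> is linear only on the carrier. \<open>construct\<close> replaces
  it by a linear map on the whole ambient space that agrees with it on a basis, hence on the
  carrier, so that the basis is carried to a basis.\<close>

lemma lie_iso_dim:
  assumes "lie_algebra L" "lie_algebra M" "lie_iso \<phi> L M"
  shows "lie_dim L = lie_dim M"
proof -
  interpret L: lie_algebra L by fact
  interpret M: lie_algebra M by fact
  interpret vector_space_pair "lsmult L" "lsmult M"
    by (intro vector_space_pair.intro L.vector_space M.vector_space)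
  have \<phi>: "bij_betw \<phi> (lcarrier L) (lcarrier M)"
    "\<And>x y. x \<in> lcarrier L \<Longrightarrow> y \<in> lcarrier L \<Longrightarrow> \<phi> (x + y) = \<phi> x + \<phi> y"
    "\<And>c x. x \<in> lcarrier L \<Longrightarrow> \<phi> (lsmult L c x) = lsmult M c (\<phi> x)"
    using assms(3) by (auto simp: lie_iso_def)
  obtain B where B: "B \<subseteq> lcarrier L" "vs1.independent B" "lcarrier L \<subseteq> vs1.span B"
    "card B = vs1.dim (lcarrier L)"
    by (rule vs1.basis_exists)
  have span: "vs1.span B = lcarrier L"
    using B vs1.span_minimal[OF B(1) L.subspace] by auto
  let ?f = "construct B \<phi>"
  have lin: "Vector_Spaces.linear (lsmult L) (lsmult M) ?f"
    by (rule linear_construct[OF B(2)])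
  have zero: "\<phi> 0 = 0"
    using \<phi>(2)[of 0 0] vs1.subspace_0[OF L.subspace] by simp
  have eq: "?f x = \<phi> x \<and> x \<in> lcarrier L" if "x \<in> vs1.span B" for x
    using that
  proof (induction rule: vs1.span_induct_alt)
    case base
    then show ?case
      using linear_0[OF lin] zero vs1.subspace_0[OF L.subspace] by simp
  next
    case (step c x y)
    then show ?case
      using B(1) \<phi>(2,3) construct_basis[OF B(2)] linear_add[OF lin] linear_scale[OF lin]
      by (auto simp: vs1.subspace_add[OF L.subspace] vs1.subspace_scale[OF L.subspace])
  qed
  have inj: "inj_on ?f (vs1.span B)"
    using \<phi>(1) eq by (auto simp: bij_betw_def inj_on_def)
  have "vs2.independent (?f ` B)"
    by (rule linear_independent_injective_image[OF lin B(2) inj])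
  moreover have "vs2.span (?f ` B) = lcarrier M"
  proof -
    have "vs2.span (?f ` B) = ?f ` vs1.span B"
      by (rule linear_span_image[OF lin])
    also have "\<dots> = \<phi> ` lcarrier L"
      using eq span by (intro image_cong) auto
    finally show ?thesis
      using \<phi>(1) by (simp add: bij_betw_def)
  qed
  ultimately have "vs2.dim (lcarrier M) = card (?f ` B)"
    using vs2.dim_span_eq_card_independent by metis
  also have "\<dots> = card B"
    using inj vs1.span_superset[of B] by (intro card_image) (auto intro: inj_on_subset)
  finally show ?thesis
    using B(4) by (simp add: lie_dim_def)
qed

text \<open>Ideals pull back along \<open>\<phi>\<close>: the preimage of an ideal is an ideal of
  \<open>L\<close>, hence trivial, and \<open>\<phi>\<close> maps it back onto the given
  one.\<close>

lemma lie_iso_simple: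
  assumes L: "lie_algebra L" and M: "lie_algebra M" and iso: "lie_iso \<phi> L M" and simple: "lie_simple L"
  shows "lie_simple M"
proof -
  interpret L: lie_algebra L by fact
  interpret M: lie_algebra M by fact
  interpret VL: vector_space "lsmult L" by (rule L.vector_space)
  interpret VM: vector_space "lsmult M" by (rule M.vector_space)
  have bij: "bij_betw \<phi> (lcarrier L) (lcarrier M)"
    and add: "\<And>x y. x \<in> lcarrier L \<Longrightarrow> y \<in> lcarrier L \<Longrightarrow> \<phi> (x + y) = \<phi> x + \<phi> y"
    and smult: "\<And>c x. x \<in> lcarrier L \<Longrightarrow> \<phi> (lsmult L c x) = lsmult M c (\<phi> x)"
    and bracket: "\<And>x y. x \<in> lcarrier L \<Longrightarrow> y \<in> lcarrier L \<Longrightarrow>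
      \<phi> (lbracket L x y) = lbracket M (\<phi> x) (\<phi> y)"
    using iso by (auto simp: lie_iso_def)
  note L0 = VL.subspace_0[OF L.subspace]
  have zero: "\<phi> 0 = 0"
    using add[OF L0 L0] by simp
  have zero_iff: "\<phi> x = 0 \<longleftrightarrow> x = 0" if "x \<in> lcarrier L" for x
    using bij L0 zero that by (metis bij_betw_def inj_on_def)
  have nonab: "\<not> lie_abelian M"
  proof -
    obtain x y where "x \<in> lcarrier L" "y \<in> lcarrier L" "lbracket L x y \<noteq> 0"
      using simple by (auto simp: lie_simple_def lie_abelian_def)
    moreover from this have "lbracket M (\<phi> x) (\<phi> y) \<noteq> 0"
      using bracket zero_iff L.closed by metis
    moreover have "\<phi> x \<in> lcarrier M" if "x \<in> lcarrier L" for x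
      using bij that by (auto simp: bij_betw_def)
    ultimately show ?thesis
      by (auto simp: lie_abelian_def)
  qed
  have "I = {0} \<or> I = lcarrier M" if I: "lie_ideal I M" for I
  proof -
    let ?I = "{x \<in> lcarrier L. \<phi> x \<in> I}"
    have sub: "VM.subspace I" "I \<subseteq> lcarrier M"
      and br: "\<And>x y. x \<in> lcarrier M \<Longrightarrow> y \<in> I \<Longrightarrow> lbracket M x y \<in> I"
      using I by (auto simp: lie_ideal_def)
    have img: "\<phi> x \<in> lcarrier M" if "x \<in> lcarrier L" for x
      using bij that by (auto simp: bij_betw_def)
    have "lie_ideal ?I L"
      unfolding lie_ideal_def VL.subspace_def
      using L0 zero VM.subspace_0[OF sub(1)]
      by (auto simp: VM.subspace_add[OF sub(1)] VM.subspace_scale[OF sub(1)] br img L.closed bracket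
          add smult VL.subspace_add[OF L.subspace] VL.subspace_scale[OF L.subspace])
    then have "?I = {0} \<or> ?I = lcarrier L"
      using simple by (auto simp: lie_simple_def)
    moreover have "\<phi> ` ?I = I"
      using bij sub(2) by (force simp: bij_betw_def)
    ultimately show ?thesis
      using bij zero by (auto simp: bij_betw_def)
  qed
  then show ?thesis
    using nonab by (auto simp: lie_simple_def)
qed

text \<open>Positive dimension makes the three bases finite, since \<open>dim\<close> is also 0 in
  the infinite-dimensional case. A sum type gathers bases of three different types into one index
  set.\<close>

lemma lie_sum3_dim:
  assumes "lie_algebra L1" "lie_algebra L2" "lie_algebra L3"
    and pos: "lie_dim L1 > 0" "lie_dim L2 > 0" "lie_dim L3 > 0"
  shows "lie_dim (lie_sum3 L1 L2 L3) = lie_dim L1 + lie_dim L2 + lie_dim L3"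
proof -
  interpret L1: lie_algebra L1 by fact
  interpret L2: lie_algebra L2 by fact
  interpret L3: lie_algebra L3 by fact
  interpret V1: vector_space "lsmult L1" by (rule L1.vector_space)
  interpret V2: vector_space "lsmult L2" by (rule L2.vector_space)
  interpret V3: vector_space "lsmult L3" by (rule L3.vector_space)
  interpret S: lie_algebra "lie_sum3 L1 L2 L3"
    by (intro lie_algebra_sum3 assms)
  interpret VS: vector_space "lsmult (lie_sum3 L1 L2 L3)" by (rule S.vector_space)
  obtain B1 where B1: "B1 \<subseteq> lcarrier L1" "V1.independent B1" "lcarrier L1 \<subseteq> V1.span B1"
    "card B1 = lie_dim L1"
    unfolding lie_dim_def by (rule V1.basis_exists)
  obtain B2 where B2: "B2 \<subseteq> lcarrier L2" "V2.independent B2" "lcarrier L2 \<subseteq> V2.span B2"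
    "card B2 = lie_dim L2"
    unfolding lie_dim_def by (rule V2.basis_exists)
  obtain B3 where B3: "B3 \<subseteq> lcarrier L3" "V3.independent B3" "lcarrier L3 \<subseteq> V3.span B3"
    "card B3 = lie_dim L3"
    unfolding lie_dim_def by (rule V3.basis_exists)
  have fin: "finite B1" "finite B2" "finite B3"
    using pos B1(4) B2(4) B3(4) card.infinite by force+
  let ?I = "Inl ` B1 \<union> Inr ` Inl ` B2 \<union> Inr ` Inr ` B3"
  let ?e = "\<lambda>i. case i of Inl b \<Rightarrow> (b, 0, 0) | Inr (Inl b) \<Rightarrow> (0, b, 0) | Inr (Inr b) \<Rightarrow> (0, 0, b)"
  have sm: "lsmult (lie_sum3 L1 L2 L3) c (x, y, z) = (lsmult L1 c x, lsmult L2 c y, lsmult L3 c z)"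
    for c x y z by (simp add: lie_sum3_def)
  have split: "(\<Sum>i\<in>?I. lsmult (lie_sum3 L1 L2 L3) (c i) (?e i)) =
    (\<Sum>b\<in>B1. lsmult L1 (c (Inl b)) b, \<Sum>b\<in>B2. lsmult L2 (c (Inr (Inl b))) b,
      \<Sum>b\<in>B3. lsmult L3 (c (Inr (Inr b))) b)" for c
  proof -
    have "(\<Sum>i\<in>?I. lsmult (lie_sum3 L1 L2 L3) (c i) (?e i)) =
      (\<Sum>b\<in>B1. (lsmult L1 (c (Inl b)) b, 0, 0)) + (\<Sum>b\<in>B2. (0, lsmult L2 (c (Inr (Inl b))) b, 0))
        + (\<Sum>b\<in>B3. (0, 0, lsmult L3 (c (Inr (Inr b))) b))"
      using fin
      by (subst sum.union_disjoint; (subst sum.union_disjoint)?)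
        (auto simp: sum.reindex inj_on_def image_iff sm add.assoc)
    also have "\<dots> = (\<Sum>b\<in>B1. lsmult L1 (c (Inl b)) b, \<Sum>b\<in>B2. lsmult L2 (c (Inr (Inl b))) b,
      \<Sum>b\<in>B3. lsmult L3 (c (Inr (Inr b))) b)"
      by (simp add: prod_eq_iff fst_sum snd_sum)
    finally show ?thesis .
  qed
  have "VS.dim (VS.span (?e ` ?I)) = card ?I"
  proof (rule VS.dim_span_family)
    fix c assume "(\<Sum>i\<in>?I. lsmult (lie_sum3 L1 L2 L3) (c i) (?e i)) = 0"
    then have "(\<Sum>b\<in>B1. lsmult L1 (c (Inl b)) b) = 0" "(\<Sum>b\<in>B2. lsmult L2 (c (Inr (Inl b))) b) = 0"
      "(\<Sum>b\<in>B3. lsmult L3 (c (Inr (Inr b))) b) = 0"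
      unfolding split by (simp_all add: zero_prod_def)
    then show "\<forall>i\<in>?I. c i = 0"
      using V1.dependent_finite[OF fin(1)] V2.dependent_finite[OF fin(2)]
        V3.dependent_finite[OF fin(3)] B1(2) B2(2) B3(2) by fastforce
  qed (use fin in auto)
  moreover have "VS.span (?e ` ?I) = lcarrier (lie_sum3 L1 L2 L3)"
  proof (rule antisym)
    show "VS.span (?e ` ?I) \<subseteq> lcarrier (lie_sum3 L1 L2 L3)"
      using B1(1) B2(1) B3(1) V1.subspace_0[OF L1.subspace] V2.subspace_0[OF L2.subspace]
        V3.subspace_0[OF L3.subspace]
      by (intro VS.span_minimal S.subspace) (auto simp: lie_sum3_def)
    show "lcarrier (lie_sum3 L1 L2 L3) \<subseteq> VS.span (?e ` ?I)"
    proof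
      fix v assume "v \<in> lcarrier (lie_sum3 L1 L2 L3)"
      then obtain x y z where v: "v = (x, y, z)" "x \<in> lcarrier L1" "y \<in> lcarrier L2" "z \<in> lcarrier L3"
        by (auto simp: lie_sum3_def)
      obtain c1 c2 c3 where "x = (\<Sum>b\<in>B1. lsmult L1 (c1 b) b)" "y = (\<Sum>b\<in>B2. lsmult L2 (c2 b) b)"
        "z = (\<Sum>b\<in>B3. lsmult L3 (c3 b) b)"
        using v B1(3) B2(3) B3(3) V1.span_finite[OF fin(1)] V2.span_finite[OF fin(2)]
          V3.span_finite[OF fin(3)] by (metis (no_types, lifting) imageE subsetD)
      then have "v = (\<Sum>i\<in>?I. lsmult (lie_sum3 L1 L2 L3) (case_sum c1 (case_sum c2 c3) i) (?e i))"
        unfolding split v by simp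
      also have "\<dots> \<in> VS.span (?e ` ?I)"
      proof (rule VS.span_sum, rule VS.span_scale)
        fix i assume "i \<in> ?I"
        then show "?e i \<in> VS.span (?e ` ?I)"
          using VS.span_base[OF imageI[of i ?I ?e]] by simp
      qed
      finally show "v \<in> VS.span (?e ` ?I)" .
    qed
  qed
  moreover have "card ?I = card B1 + card B2 + card B3"
    using fin by (subst card_Un_disjoint; (subst card_Un_disjoint)?)
      (auto simp: card_image image_image inj_on_def)
  ultimately show ?thesis
    using B1(4) B2(4) B3(4) by (simp add: lie_dim_def)
qed

lemma lie_algebra_line: "lie_algebra (lie_line :: ('f::field, 'f) lie)"
proof -
  interpret vector_space "(*) :: 'f \<Rightarrow> 'f \<Rightarrow> 'f"
    by unfold_locales (auto simp: algebra_simps)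
  show ?thesis
    by (rule lie_algebra.intro) (auto simp: lie_line_def vector_space_axioms)
qed

lemma lie_algebra_plane: "lie_algebra (lie_plane :: ('f::field, 'f \<times> 'f \<times> 'f) lie)"
  unfolding lie_plane_def
proof (rule lie_algebra_restrict)
  show L: "lie_algebra (lie_sum3 lie_line lie_line lie_line :: ('f, 'f \<times> 'f \<times> 'f) lie)"
    by (intro lie_algebra_sum3 lie_algebra_line)
  interpret lie_algebra "lie_sum3 lie_line lie_line lie_line :: ('f, 'f \<times> 'f \<times> 'f) lie" by (rule L)
  interpret vector_space "lsmult (lie_sum3 lie_line lie_line lie_line :: ('f, 'f \<times> 'f \<times> 'f) lie)"
    by (rule vector_space)
  have "a + b + c = 0 \<Longrightarrow> a' + b' + c' = 0 \<Longrightarrow> a + a' + (b + b') + (c + c') = 0" for a b c a' b' c' :: 'f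
    by (metis (no_types, opaque_lifting) add.assoc add.left_commute add.right_neutral)
  then show "subspace {(a, b, c). a + b + c = 0}"
    unfolding subspace_def
    by (auto simp: lie_sum3_def lie_line_def zero_prod_def distrib_left[symmetric])
qed (auto simp: lie_sum3_def lie_line_def)

lemma lie_dim_plane: "lie_dim (lie_plane :: ('f::field, 'f \<times> 'f \<times> 'f) lie) = 2"
proof -
  interpret P: lie_algebra "lie_plane :: ('f, 'f \<times> 'f \<times> 'f) lie" by (rule lie_algebra_plane)
  interpret vector_space "lsmult (lie_plane :: ('f, 'f \<times> 'f \<times> 'f) lie)"
    by (rule P.vector_space)
  let ?e = "\<lambda>i. if i then (1 :: 'f, 0 :: 'f, - 1 :: 'f) else (0, 1, - 1)"
  have sm: "lsmult lie_plane c (x, y, z) = (c * x, c * y, c * z)" for c x y z :: 'f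
    by (simp add: lie_plane_def lie_sum3_def lie_line_def)
  have "dim (span (?e ` {True, False})) = card {True, False}"
    by (rule dim_span_family) (auto simp: sm zero_prod_def)
  moreover have "span (?e ` {True, False}) = lcarrier lie_plane"
  proof (rule antisym)
    show "span (?e ` {True, False}) \<subseteq> lcarrier lie_plane"
      by (intro span_minimal P.subspace) (auto simp: lie_plane_def)
    show "lcarrier lie_plane \<subseteq> span (?e ` {True, False})"
    proof
      fix v :: "'f \<times> 'f \<times> 'f" assume "v \<in> lcarrier lie_plane"
      then obtain a b c where v: "v = (a, b, c)" and "a + b + c = 0"
        by (auto simp: lie_plane_def)
      then have "c = - a - b"
        by (metis add.commute add_diff_cancel_right' diff_0 diff_diff_eq)
      then have "v = lsmult lie_plane a (?e True) + lsmult lie_plane b (?e False)"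
        by (simp add: v sm)
      moreover have "?e i \<in> span (?e ` {True, False})" for i
        using span_base[OF imageI[of i "{True, False}" ?e]] by (cases i) auto
      ultimately show "v \<in> span (?e ` {True, False})"
        by (metis span_add span_scale)
    qed
  qed
  ultimately have "dim (lcarrier lie_plane) = card {True, False}"
    by (simp only:)
  then show ?thesis
    by (simp add: lie_dim_def)
qed

section \<open>Orthogonal Lie algebras of nondegenerate spaces\<close>

lemma sum_fun_apply: "(\<Sum>i\<in>I. f i) x = (\<Sum>i\<in>I. f i x)"
  for f :: "'i \<Rightarrow> 'a \<Rightarrow> 'b::comm_monoid_add"
  by (induction I rule: infinite_finite_induct) auto

locale sym_form = vector_space scale
  for scale :: "'f::field_char_0 \<Rightarrow> 'v::ab_group_add \<Rightarrow> 'v" (infixr "*s" 75) +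
  fixes g :: "'v \<Rightarrow> 'v \<Rightarrow> 'f"
  assumes g_linear: "\<And>x. Vector_Spaces.linear scale (*) (g x)"
    and g_sym: "\<And>x y. g x y = g y x"
begin

sublocale fn: vector_space "\<lambda>c (f :: 'v \<Rightarrow> 'v) x. c *s f x"
  by (rule vector_space_fun[OF vector_space_axioms])

lemma g_right: "g x (y + z) = g x y + g x z" "g x (y - z) = g x y - g x z" "g x 0 = 0"
  "g x (- y) = - g x y" "g x (c *s y) = c * g x y" "g x (sum h I) = (\<Sum>i\<in>I. g x (h i))"
proof -
  interpret l: Vector_Spaces.linear scale "(*)" "g x" by (rule g_linear)
  show "g x (y + z) = g x y + g x z" "g x (y - z) = g x y - g x z" "g x 0 = 0"
    "g x (- y) = - g x y" "g x (c *s y) = c * g x y" "g x (sum h I) = (\<Sum>i\<in>I. g x (h i))"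
    by (simp_all add: l.add l.diff l.zero l.neg l.scale l.sum)
qed

lemma g_left: "g (y + z) x = g y x + g z x" "g (y - z) x = g y x - g z x" "g 0 x = 0"
  "g (- y) x = - g y x" "g (c *s y) x = c * g y x" "g (sum h I) x = (\<Sum>i\<in>I. g (h i) x)"
  by (simp_all add: g_sym[of _ x] g_right)

lemmas g_simps = g_left g_right

lemma nondegenerate_eqI:
  assumes "nondegenerate_on g W" "subspace W" "x \<in> W" "y \<in> W" "\<And>z. z \<in> W \<Longrightarrow> g x z = g y z"
  shows "x = y"
proof -
  have "x - y \<in> W" "\<forall>z\<in>W. g (x - y) z = 0"
    using assms by (auto simp: subspace_diff g_simps)
  then have "x - y = 0"
    using assms(1) unfolding nondegenerate_on_def by blast
  then show ?thesis by simp
qed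

text \<open>Squares are only required to be nonzero: normalising to length one would need square
  roots in the field.\<close>

definition ortho :: "'v set \<Rightarrow> bool" where
  "ortho B \<longleftrightarrow> finite B \<and> (\<forall>b\<in>B. g b b \<noteq> 0) \<and> (\<forall>b\<in>B. \<forall>c\<in>B. b \<noteq> c \<longrightarrow> g b c = 0)"

lemma ortho_subset: "ortho B \<Longrightarrow> C \<subseteq> B \<Longrightarrow> ortho C"
  by (auto simp: ortho_def intro: finite_subset)

lemma ortho_coeff:
  assumes "ortho B" "b \<in> B"
  shows "g b (\<Sum>c\<in>B. u c *s c) = u b * g b b"
proof -
  have "g b (\<Sum>c\<in>B. u c *s c) = (\<Sum>c\<in>B. if c = b then u b * g b b else 0)"
    unfolding g_simps using assms by (intro sum.cong) (auto simp: ortho_def)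
  then show ?thesis
    using assms by (simp add: ortho_def)
qed

lemma ortho_independent:
  assumes "ortho B"
  shows "independent B"
proof (rule independent_if_scalars_zero)
  fix u b assume "(\<Sum>c\<in>B. u c *s c) = 0" "b \<in> B"
  then show "u b = 0"
    using ortho_coeff[OF assms, of b u] assms by (simp add: g_simps ortho_def)
qed (use assms in \<open>simp add: ortho_def\<close>)

lemma ortho_expand:
  assumes "ortho B" "x \<in> span B"
  shows "(\<Sum>b\<in>B. (g b x / g b b) *s b) = x"
proof -
  have "finite B" using assms(1) by (simp add: ortho_def)
  then obtain u where u: "x = (\<Sum>b\<in>B. u b *s b)"
    using assms(2) by (auto simp: span_finite)
  have "g b x / g b b = u b" if "b \<in> B" for b
    using ortho_coeff[OF assms(1) that] assms(1) that by (simp add: u ortho_def)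
  then show ?thesis
    unfolding u by (intro sum.cong) auto
qed

lemma ortho_eq_0:
  assumes "ortho B" "x \<in> span B" "\<And>b. b \<in> B \<Longrightarrow> g b x = 0"
  shows "x = 0"
  using ortho_expand[OF assms(1,2)] assms(3) by simp

lemma ortho_nondegenerate: "ortho B \<Longrightarrow> nondegenerate_on g (span B)"
  unfolding nondegenerate_on_def using ortho_eq_0 span_base by (metis g_sym)

lemma ortho_card: "ortho B \<Longrightarrow> card B = dim (span B)"
  using ortho_independent dim_span_eq_card_independent by metis

text \<open>An orthogonal set of greatest cardinality must span: otherwise nondegeneracy supplies an
  anisotropic vector of \<open>W\<close> orthogonal to it.\<close>

lemma ortho_extend:
  assumes W: "subspace W" "finite S" "span S = W" and nondeg: "nondegenerate_on g W"
    and B0: "ortho B0" "B0 \<subseteq> W"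
  obtains B where "B0 \<subseteq> B" "ortho B" "span B = W"
proof -
  let ?P = "\<lambda>B. B0 \<subseteq> B \<and> B \<subseteq> W \<and> ortho B"
  have "card B \<le> card S" if "?P B" for B
    using independent_span_bound[OF W(2) ortho_independent] W(3) that by blast
  then obtain B where B: "?P B" and max: "\<And>C. ?P C \<Longrightarrow> card C \<le> card B"
    using ex_has_greatest_nat[of ?P B0 card "Suc (card S)"] B0 by (auto simp: less_Suc_eq_le)
  have sub: "span B \<subseteq> W"
    using B W(1) by (intro span_minimal) auto
  let ?r = "\<lambda>x. x - (\<Sum>b\<in>B. (g b x / g b b) *s b)"
  have r: "?r x \<in> W" "b \<in> B \<Longrightarrow> g b (?r x) = 0" if "x \<in> W" for x b
  proof -
    show "?r x \<in> W"
      using B that W(1) by (intro subspace_diff subspace_sum subspace_scale) auto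
    show "g b (?r x) = 0" if "b \<in> B"
      using ortho_coeff[of B b "\<lambda>b. g b x / g b b"] B that by (simp add: g_right(2) ortho_def)
  qed
  have "W \<subseteq> span B"
  proof (rule ccontr)
    assume "\<not> W \<subseteq> span B"
    then obtain w where w: "w \<in> W" "w \<notin> span B" by blast
    have "?r w \<noteq> 0"
    proof
      assume "?r w = 0"
      then have "w = (\<Sum>b\<in>B. (g b w / g b b) *s b)" by simp
      then show False
        using w(2) by (metis (no_types, lifting) span_base span_scale span_sum)
    qed
    then obtain y where y: "y \<in> W" "g (?r w) y \<noteq> 0"
      using nondeg r(1)[OF w(1)] unfolding nondegenerate_on_def by blast
    \<comment> \<open>Replacing \<open>y\<close> by its residual does not change the pairing with
      \<open>?r w\<close>, which is already orthogonal to \<open>B\<close>.\<close>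
    have "g u (?r y) = g u y - (\<Sum>b\<in>B. (g b y / g b b) * g b u)" for u
      by (simp add: g_right g_sym[of u])
    from this[of "?r w"] have ne: "g (?r w) (?r y) \<noteq> 0"
      using y(2) r(2)[OF w(1)] by simp
    define z1 z2 where "z1 = ?r w" and "z2 = ?r y"
    have z: "z1 \<in> W" "z2 \<in> W" "\<And>b. b \<in> B \<Longrightarrow> g b z1 = 0" "\<And>b. b \<in> B \<Longrightarrow> g b z2 = 0"
      "g z1 z2 \<noteq> 0"
      using r[OF w(1)] r[OF y(1)] ne by (auto simp: z1_def z2_def)
    \<comment> \<open>Polarisation: if \<open>z1\<close>, \<open>z2\<close> and
      \<open>z1 + z2\<close> were all isotropic, then \<open>2 * g z1 z2\<close> would vanish,
      against characteristic zero.\<close>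
    have "g (z1 + z2) (z1 + z2) = g z1 z1 + g z2 z2 + 2 * g z1 z2"
      by (simp add: g_simps g_sym[of z2 z1])
    then have "\<exists>z\<in>{z1, z2, z1 + z2}. g z z \<noteq> 0"
      using z(5) by auto
    then obtain z where z': "z \<in> {z1, z2, z1 + z2}" "g z z \<noteq> 0" by blast
    have "z \<in> W"
      using z'(1) z(1,2) subspace_add[OF W(1) z(1,2)] by blast
    moreover have "g b z = 0" if "b \<in> B" for b
      using z'(1) z(3,4)[OF that] by (auto simp only: g_right insert_iff empty_iff add_0)
    ultimately have z': "z \<in> W" "\<And>b. b \<in> B \<Longrightarrow> g b z = 0" "g z z \<noteq> 0"
      using z'(2) by simp_all
    then have "g z b = 0" if "b \<in> B" for b
      using that by (simp add: g_sym[of z b])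
    then have "?P (insert z B)"
      using B z' unfolding ortho_def by blast
    moreover have "z \<notin> B"
      using z' by auto
    ultimately show False
      using max[of "insert z B"] B by (auto simp: ortho_def)
  qed
  then show thesis
    using that B sub by blast
qed

section \<open>Skew endomorphisms and their rotation generators\<close>

abbreviation so :: "'v set \<Rightarrow> ('v \<Rightarrow> 'v) set" where
  "so W \<equiv> lcarrier (so_lie scale g W)"

lemma so_iff: "f \<in> so W \<longleftrightarrow> (\<forall>x\<in>W. f x \<in> W) \<and> (\<forall>x\<in>W. \<forall>y\<in>W. f (x + y) = f x + f y) \<and>
    (\<forall>c. \<forall>x\<in>W. f (c *s x) = c *s f x) \<and> (\<forall>x. x \<notin> W \<longrightarrow> f x = 0) \<and>
    (\<forall>x\<in>W. \<forall>y\<in>W. g (f x) y = - g x (f y))"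
  by (auto simp: so_lie_def endos_def)

lemma lsmult_so: "lsmult (so_lie scale g W) = (\<lambda>c f x. c *s f x)"
  by (simp add: so_lie_def)

lemma so_lie_algebra: "subspace W \<Longrightarrow> lie_algebra (so_lie scale g W)"
  by (rule lie_algebra_so_lie[OF vector_space_axioms _ g_linear g_sym])

lemma so_subspace: "subspace W \<Longrightarrow> fn.subspace (so W)"
  using lie_algebra.subspace[OF so_lie_algebra] by (simp add: lsmult_so)

lemma so_bracket: "subspace W \<Longrightarrow> f \<in> so W \<Longrightarrow> h \<in> so W \<Longrightarrow> lbracket (so_lie scale g W) f h \<in> so W"
  using lie_algebra.closed[OF so_lie_algebra] .

lemma so_mem: "f \<in> so W \<Longrightarrow> x \<in> W \<Longrightarrow> f x \<in> W"
  and so_add: "f \<in> so W \<Longrightarrow> x \<in> W \<Longrightarrow> y \<in> W \<Longrightarrow> f (x + y) = f x + f y"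
  and so_scale: "f \<in> so W \<Longrightarrow> x \<in> W \<Longrightarrow> f (c *s x) = c *s f x"
  and so_outside: "f \<in> so W \<Longrightarrow> x \<notin> W \<Longrightarrow> f x = 0"
  and so_skew: "f \<in> so W \<Longrightarrow> x \<in> W \<Longrightarrow> y \<in> W \<Longrightarrow> g (f x) y = - g x (f y)"
  by (auto simp: so_iff)

lemma so_diff: "f \<in> so W \<Longrightarrow> subspace W \<Longrightarrow> x \<in> W \<Longrightarrow> y \<in> W \<Longrightarrow> f (x - y) = f x - f y"
  using so_add[of f W "x - y" y] by (simp add: subspace_diff)

lemma so_zero: "f \<in> so W \<Longrightarrow> f 0 = 0"
  using so_scale[of f W 0 0] so_outside[of f W 0] by (cases "0 \<in> W") auto

lemma so_self:
  assumes "f \<in> so W" "x \<in> W"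
  shows "g x (f x) = 0"
proof -
  have "g x (f x) = - g x (f x)"
    using so_skew[OF assms(1,2,2)] by (simp add: g_sym)
  then have "2 * g x (f x) = 0" by (metis mult_2 eq_neg_iff_add_eq_0)
  then show ?thesis by simp
qed

lemma so_eqI:
  assumes f: "f \<in> so (span B)" and h: "h \<in> so (span B)" and "\<And>x. x \<in> B \<Longrightarrow> f x = h x"
  shows "f = h"
proof
  fix x
  show "f x = h x"
  proof (cases "x \<in> span B")
    case True
    then have "f x = h x \<and> x \<in> span B"
    proof (induction rule: span_induct_alt)
      case base
      show ?case using so_zero f h span_zero by metis
    next
      case (step c x y)
      then have "x \<in> span B" by (simp add: span_base)
      moreover from this have "c *s x \<in> span B" by (rule span_scale)
      ultimately show ?case
        using step assms(3)
        by (simp add: so_add[OF f] so_add[OF h] so_scale[OF f] so_scale[OF h] span_add)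
    qed
    then show ?thesis ..
  next
    case False
    then show ?thesis
      using so_outside f h by metis
  qed
qed

text \<open>The image of the bivector of \<open>u\<close> and \<open>v\<close> under the isomorphism
  of the second exterior power with \<open>so W\<close>: an infinitesimal rotation in the plane of
  \<open>u\<close> and \<open>v\<close>.\<close>

definition wedge :: "'v set \<Rightarrow> 'v \<Rightarrow> 'v \<Rightarrow> 'v \<Rightarrow> 'v" where
  "wedge W u v = (\<lambda>x. if x \<in> W then g v x *s u - g u x *s v else 0)"

lemma wedge_so: "subspace W \<Longrightarrow> u \<in> W \<Longrightarrow> v \<in> W \<Longrightarrow> wedge W u v \<in> so W"
  by (auto simp: so_iff wedge_def subspace_add subspace_diff subspace_scale g_simps g_sym
      scale_left_distrib scale_right_diff_distrib mult.commute)

lemma wedge_simps: "wedge W v v = 0" "wedge W 0 v = 0" "wedge W u 0 = 0"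
  "wedge W (- u) v = (\<lambda>x. - wedge W u v x)" "wedge W u (- v) = (\<lambda>x. - wedge W u v x)"
  "wedge W (c *s u) v = (\<lambda>x. c *s wedge W u v x)"
  "wedge W u (c *s v) = (\<lambda>x. c *s wedge W u v x)" "wedge W (u + u') v = wedge W u v + wedge W u' v"
  "wedge W u (v + v') = wedge W u v + wedge W u v'"
  by (auto simp: wedge_def fun_eq_iff g_simps scale_left_distrib scale_right_distrib
      scale_right_diff_distrib mult.commute)

lemma wedge_swap: "wedge W v u = (\<lambda>x. (- 1) *s wedge W u v x)"
  by (auto simp: wedge_def fun_eq_iff)

text \<open>\<open>f\<close> acts on bivectors as a derivation. Its skewness moves it from the
  argument \<open>x\<close> onto the vectors inside the coefficients of
  \<open>wedge\<close>.\<close>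

lemma wedge_bracket:
  assumes "subspace W" "f \<in> so W" "u \<in> W" "v \<in> W"
  shows "lbracket (so_lie scale g W) f (wedge W u v) = wedge W (f u) v + wedge W u (f v)"
proof
  fix x
  show "lbracket (so_lie scale g W) f (wedge W u v) x = (wedge W (f u) v + wedge W u (f v)) x"
  proof (cases "x \<in> W")
    case True
    then show ?thesis
      using assms so_mem[OF assms(2)]
      by (simp add: lbracket_so_lie wedge_def so_diff[OF assms(2)] so_scale[OF assms(2)] subspace_scale
          so_skew[OF assms(2)])
  next
    case False
    then show ?thesis
      using so_zero[OF assms(2)] so_outside[OF assms(2)] subspace_0[OF assms(1)]
      by (simp add: lbracket_so_lie wedge_def g_simps)
  qed
qed

lemma so_span_wedge:
  assumes B: "ortho B"
  shows "so (span B) = fn.span {wedge (span B) b c |b c. b \<in> B \<and> c \<in> B \<and> b \<noteq> c}"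
proof (rule antisym)
  have fin: "finite B" using B by (simp add: ortho_def)
  have sub: "subspace (span B)" by simp
  show "fn.span {wedge (span B) b c |b c. b \<in> B \<and> c \<in> B \<and> b \<noteq> c} \<subseteq> so (span B)"
    by (rule fn.span_minimal) (auto intro!: so_subspace wedge_so span_base)
  show "so (span B) \<subseteq> fn.span {wedge (span B) b c |b c. b \<in> B \<and> c \<in> B \<and> b \<noteq> c}"
  proof
    fix f assume f: "f \<in> so (span B)"
    \<comment> \<open>Each unordered pair occurs twice in the double sum, as \<open>(b, c)\<close>
      and as \<open>(c, b)\<close>, which accounts for the 2 in the denominator.\<close>
    define k where "k b c = g (f c) b / (2 * g b b * g c c)" for b c
    let ?h = "\<Sum>b\<in>B. \<Sum>c\<in>B. (\<lambda>x. k b c *s wedge (span B) b c x)"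
    have k: "k c b = - k b c" if "b \<in> B" "c \<in> B" for b c
      using so_skew[OF f, of b c] that by (simp add: k_def span_base g_sym[of b "f c"] mult.commute mult.left_commute)
    have h: "?h \<in> so (span B)"
      by (intro fn.subspace_sum so_subspace fn.subspace_scale wedge_so span_base) auto
    have "f = ?h"
    proof (rule so_eqI[OF f h])
      fix x assume x: "x \<in> B"
      have "?h x = (\<Sum>b\<in>B. \<Sum>c\<in>B. (k b c * g c x) *s b) - (\<Sum>b\<in>B. \<Sum>c\<in>B. (k b c * g b x) *s c)"
        using x by (simp add: sum_fun_apply wedge_def span_base scale_right_diff_distrib sum_subtractf)
      also have "(\<Sum>b\<in>B. \<Sum>c\<in>B. (k b c * g b x) *s c) = (\<Sum>b\<in>B. \<Sum>c\<in>B. (k c b * g c x) *s b)"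
        by (rule sum.swap)
      also have "\<dots> = - (\<Sum>b\<in>B. \<Sum>c\<in>B. (k b c * g c x) *s b)"
        unfolding sum_negf[symmetric] scale_minus_left[symmetric] mult_minus_left[symmetric]
        by (intro sum.cong refl) (metis k)
      also have "(\<Sum>b\<in>B. \<Sum>c\<in>B. (k b c * g c x) *s b) - - (\<Sum>b\<in>B. \<Sum>c\<in>B. (k b c * g c x) *s b)
          = (\<Sum>b\<in>B. \<Sum>c\<in>B. (2 * k b c * g c x) *s b)"
        by (simp only: diff_minus_eq_add sum.distrib[symmetric] scale_left_distrib[symmetric]
            mult_2 distrib_right)
      also have "\<dots> = (\<Sum>b\<in>B. \<Sum>c\<in>B. if c = x then (2 * k b x * g x x) *s b else 0)"
      proof (intro sum.cong refl)
        fix b c assume "b \<in> B" "c \<in> B"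
        then show "(2 * k b c * g c x) *s b = (if c = x then (2 * k b x * g x x) *s b else 0)"
          using B x unfolding ortho_def by (cases "c = x") simp_all
      qed
      also have "\<dots> = (\<Sum>b\<in>B. (g b (f x) / g b b) *s b)"
        using B x fin by (intro sum.cong refl) (simp add: ortho_def k_def g_sym[of "f x"])
      also have "\<dots> = f x"
        by (rule ortho_expand[OF B so_mem[OF f span_base[OF x]]])
      finally show "f x = ?h x" ..
    qed
    also have "?h \<in> fn.span {wedge (span B) b c |b c. b \<in> B \<and> c \<in> B \<and> b \<noteq> c}"
    proof (intro fn.span_sum fn.span_scale)
      fix b c assume "b \<in> B" "c \<in> B"
      then show "wedge (span B) b c \<in> fn.span {wedge (span B) b c |b c. b \<in> B \<and> c \<in> B \<and> b \<noteq> c}"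
        by (cases "b = c") (auto simp: wedge_simps fn.span_zero intro!: fn.span_base)
    qed
    finally show "f \<in> fn.span {wedge (span B) b c |b c. b \<in> B \<and> c \<in> B \<and> b \<noteq> c}" .
  qed
qed

text \<open>The rotations in coordinate planes form a basis. Evaluating a relation at
  \<open>e m\<close> and pairing with \<open>e l\<close> isolates the coefficient at
  \<open>(m, l)\<close>.\<close>

lemma so_dim:
  assumes B: "ortho B"
  shows "lie_dim (so_lie scale g (span B)) = card B * (card B - 1) div 2"
proof -
  define k where "k = card B"
  have fin: "finite B" using B by (simp add: ortho_def)
  then obtain e where e: "bij_betw e {..<k} B"
    using ex_bij_betw_nat_finite[OF fin] by (auto simp: k_def atLeast0LessThan)
  have eB: "e i \<in> B" if "i < k" for i
    using e that by (auto simp: bij_betw_def)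
  have inj: "e i = e j \<longleftrightarrow> i = j" if "i < k" "j < k" for i j
    using e that by (auto simp: bij_betw_def inj_on_def)
  have ge: "g (e i) (e j) = 0" if "i < k" "j < k" "i \<noteq> j" for i j
    using B eB inj that by (auto simp: ortho_def)
  have nz: "g (e i) (e i) \<noteq> 0" if "i < k" for i
    using B eB that by (auto simp: ortho_def)
  let ?I = "Sigma {..<k} (\<lambda>j. {..<j})"
  let ?w = "\<lambda>(j, i). wedge (span B) (e i) (e j)"
  have "fn.dim (fn.span (?w ` ?I)) = card ?I"
  proof (rule fn.dim_span_family)
    fix c assume c: "(\<Sum>p\<in>?I. (\<lambda>x. c p *s ?w p x)) = 0"
    show "\<forall>p\<in>?I. c p = 0"
    proof
      fix p assume "p \<in> ?I"
      then obtain m l where p: "p = (m, l)" "l < m" "m < k" by auto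
      have "0 = g ((\<Sum>p\<in>?I. (\<lambda>x. c p *s ?w p x)) (e m)) (e l)"
        unfolding c by (simp add: g_simps)
      also have "\<dots> = (\<Sum>p\<in>?I. c p * g (?w p (e m)) (e l))"
        by (simp add: sum_fun_apply g_simps)
      also have "\<dots> = (\<Sum>q\<in>?I. if q = p then c p * (g (e m) (e m) * g (e l) (e l)) else 0)"
      proof (rule sum.cong[OF refl])
        fix q assume "q \<in> ?I"
        then obtain j i where q: "q = (j, i)" "i < j" "j < k" by auto
        have "g (?w q (e m)) (e l) = g (e j) (e m) * g (e i) (e l) - g (e i) (e m) * g (e j) (e l)"
          using p eB by (simp add: q wedge_def span_base g_simps)
        also have "\<dots> = (if q = p then g (e m) (e m) * g (e l) (e l) else 0)"
          using ge[of j m] ge[of i l] ge[of i m] ge[of j l] p q by (cases "i = m") auto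
        finally show "c q * g (?w q (e m)) (e l) =
            (if q = p then c p * (g (e m) (e m) * g (e l) (e l)) else 0)" by simp
      qed
      also have "\<dots> = c p * (g (e m) (e m) * g (e l) (e l))"
        using \<open>p \<in> ?I\<close> by simp
      finally show "c p = 0"
        using nz p by simp
    qed
  qed auto
  moreover have "fn.span (?w ` ?I) = so (span B)"
  proof (rule antisym)
    show "fn.span (?w ` ?I) \<subseteq> so (span B)"
      by (rule fn.span_minimal) (auto intro!: so_subspace wedge_so span_base eB)
    have "wedge (span B) b c \<in> fn.span (?w ` ?I)" if bc: "b \<in> B" "c \<in> B" "b \<noteq> c" for b c
    proof -
      obtain i j where ij: "b = e i" "c = e j" "i < k" "j < k"
        using bc e by (auto simp: bij_betw_def)
      have *: "wedge (span B) (e i) (e j) \<in> fn.span (?w ` ?I)" if "i < j" "j < k" for i j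
        using that fn.span_base[OF imageI[of "(j, i)" ?I ?w]] by auto
      show ?thesis
      proof (cases "i < j")
        case True
        then show ?thesis using * ij by simp
      next
        case False
        then have "wedge (span B) c b \<in> fn.span (?w ` ?I)"
          using * ij bc by (auto simp: not_less le_less)
        then show ?thesis
          unfolding wedge_swap[of "span B" b c] by (rule fn.span_scale)
      qed
    qed
    then show "so (span B) \<subseteq> fn.span (?w ` ?I)"
      unfolding so_span_wedge[OF B] by (intro fn.span_minimal) auto
  qed
  ultimately have "lie_dim (so_lie scale g (span B)) = card ?I"
    by (simp only: lie_dim_def lsmult_so)
  also have "\<dots> = (\<Sum>j<k. j)"
    by simp
  also have "\<dots> = k * (k - 1) div 2"
  proof -
    have "2 * (\<Sum>j<k. j) = k * (k - 1)"
    proof (induction k)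
      case (Suc k)
      then show ?case by (cases k) auto
    qed simp
    then show ?thesis by simp
  qed
  finally show ?thesis by (simp add: k_def)
qed

text \<open>Bracketing with \<open>wedge y z\<close> turns \<open>wedge x y\<close> into a nonzero
  multiple of \<open>wedge x z\<close>, so an ideal with one coordinate rotation contains all of
  them. One such rotation is extracted from an arbitrary nonzero member by brackets that remove its
  other coordinates.\<close>

lemma so3_simple:
  assumes B: "ortho B" "card B = 3"
  shows "lie_simple (so_lie scale g (span B))"
proof -
  let ?L = "so_lie scale g (span B)"
  let ?w = "wedge (span B)"
  have sub: "subspace (span B)" by simp
  interpret L: lie_algebra ?L by (rule so_lie_algebra[OF sub])
  have wedge_val: "?w x y x = (- g x x) *s y" "?w x y y = g y y *s x" "?w x y z = 0"
    if "B = {x, y, z}" "card {x, y, z} = 3" for x y z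
  proof -
    have "x \<noteq> y" "y \<noteq> z" "x \<noteq> z"
      using that by (auto simp: card_insert_if split: if_splits)
    moreover have "x \<in> span B" "y \<in> span B" "z \<in> span B"
      using that span_base by auto
    ultimately show "?w x y x = (- g x x) *s y" "?w x y y = g y y *s x" "?w x y z = 0"
      using B that by (auto simp: wedge_def ortho_def)
  qed
  have nz: "g x x \<noteq> 0" if "x \<in> B" for x
    using B that by (simp add: ortho_def)
  have wedge_so': "?w x y \<in> so (span B)" if "x \<in> B" "y \<in> B" for x y
    using that by (intro wedge_so span_base) auto
  have bracket: "lbracket ?L (?w x y) (?w u v) = ?w (?w x y u) v + ?w u (?w x y v)"
    if "x \<in> B" "y \<in> B" "u \<in> B" "v \<in> B" for x y u v
    using that by (intro wedge_bracket wedge_so span_base) auto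
  have nonab: "\<not> lie_abelian ?L"
  proof -
    obtain a b c where abc: "B = {a, b, c}" "card {a, b, c} = 3"
      using B(2) card_3_iff[of B] by metis
    then have mem: "a \<in> B" "b \<in> B" "c \<in> B" by auto
    have "lbracket ?L (?w a b) (?w b c) = (\<lambda>x. g b b *s ?w a c x)"
      unfolding bracket[OF mem(1,2,2,3)] wedge_val[OF abc] by (simp add: wedge_simps)
    moreover have "?w a c c = g c c *s a"
      using wedge_val[of a c b] abc by (simp add: insert_commute)
    ultimately have "lbracket ?L (?w a b) (?w b c) c = (g b b * g c c) *s a"
      by simp
    moreover have "(g b b * g c c) *s a \<noteq> 0"
      using nz[of a] nz[of b] nz[of c] abc by (auto simp: g_simps)
    ultimately have "lbracket ?L (?w a b) (?w b c) \<noteq> 0"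
      by (metis zero_fun_apply)
    then show ?thesis
      using wedge_so'[of a b] wedge_so'[of b c] abc by (auto simp: lie_abelian_def)
  qed
  have "I = so (span B)" if I: "lie_ideal I ?L" and ne: "I \<noteq> {0}" for I
  proof -
    have I_sub: "fn.subspace I" "I \<subseteq> so (span B)"
      and I_br: "\<And>f h. f \<in> so (span B) \<Longrightarrow> h \<in> I \<Longrightarrow> lbracket ?L f h \<in> I"
      using I by (auto simp: lie_ideal_def lsmult_so)
    have unscale: "h \<in> I" if "(\<lambda>x. c *s h x) \<in> I" "c \<noteq> 0" for c h
      using fn.subspace_scale[OF I_sub(1) that(1), of "inverse c"] that(2) by simp
    have swap: "?w y x \<in> I" if "?w x y \<in> I" for x y
      unfolding wedge_swap[of "span B" y x] by (rule fn.subspace_scale[OF I_sub(1) that])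
    have step: "?w x z \<in> I" if xyz: "B = {x, y, z}" "card {x, y, z} = 3" and "?w x y \<in> I" for x y z
    proof -
      have mem: "x \<in> B" "y \<in> B" "z \<in> B" using xyz by auto
      have "?w y z x = 0" "?w y z y = (- g y y) *s z"
        using wedge_val[of y z x] xyz by (simp_all add: insert_commute)
      then have "lbracket ?L (?w y z) (?w x y) = (\<lambda>t. (- g y y) *s ?w x z t)"
        using mem by (simp add: bracket wedge_simps)
      moreover have "lbracket ?L (?w y z) (?w x y) \<in> I"
        using xyz that(3) by (intro I_br wedge_so') auto
      ultimately show ?thesis
        using unscale[of "- g y y" "?w x z"] nz[of y] xyz by simp
    qed
    have all: "so (span B) \<subseteq> I" if xyz: "B = {x, y, z}" "card {x, y, z} = 3" and xy: "?w x y \<in> I"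
      for x y z
    proof -
      have xz: "?w x z \<in> I" by (rule step[OF xyz xy])
      have yz: "?w y z \<in> I"
        using step[of y x z] swap[OF xy] xyz by (simp add: insert_commute)
      show ?thesis
        unfolding so_span_wedge[OF B(1)]
        by (rule fn.span_minimal[OF _ I_sub(1)]) (use xyz(1) xy xz yz swap in auto)
    qed
    obtain f where f: "f \<in> I" "f \<noteq> 0"
      using ne fn.subspace_0[OF I_sub(1)] by blast
    then have fso: "f \<in> so (span B)" using I_sub by blast
    obtain x where x: "x \<in> B" "f x \<noteq> 0"
      using f(2) so_eqI[OF fso fn.subspace_0[OF so_subspace[OF sub]]] by auto
    obtain y where y: "y \<in> B" "g y (f x) \<noteq> 0"
      using ortho_eq_0[OF B(1) so_mem[OF fso span_base[OF x(1)]]] x(2) by blast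
    have "x \<noteq> y"
      using y so_self[OF fso span_base[OF x(1)]] by auto
    then obtain z where z: "B = {x, y, z}" "z \<noteq> x" "z \<noteq> y"
    proof -
      have "card (B - {x, y}) = 1"
        using x y B(2) \<open>x \<noteq> y\<close> by (simp add: card_Diff_subset)
      then obtain z where "B - {x, y} = {z}" by (auto simp: card_1_singleton_iff)
      then show thesis using that x y by blast
    qed
    have card: "card {x, y, z} = 3"
      using B(2) z by simp
    have zB: "z \<in> B" using z by blast
    note inB = span_base[of x B] span_base[of y B] span_base[of z B]
    define \<alpha> \<gamma> where "\<alpha> = g x (f y) / g x x" and "\<gamma> = g x (f z) / g x x"
    have \<alpha>: "\<alpha> \<noteq> 0"
      using y(2) so_skew[OF fso inB(2,1)] nz[of x] z(1) by (auto simp: \<alpha>_def g_sym)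
    have fy: "f y = \<alpha> *s x + (g z (f y) / g z z) *s z"
      using ortho_expand[OF B(1) so_mem[OF fso inB(2)]] so_self[OF fso inB(2)] z \<open>x \<noteq> y\<close>
      by (simp add: \<alpha>_def)
    have fz: "f z = \<gamma> *s x + (g y (f z) / g y y) *s y"
      using ortho_expand[OF B(1) so_mem[OF fso inB(3)]] so_self[OF fso inB(3)] z \<open>x \<noteq> y\<close>
      by (simp add: \<gamma>_def)
    \<comment> \<open>By the derivation rule the components of \<open>f y\<close> along
      \<open>z\<close> and of \<open>f z\<close> along \<open>y\<close> drop out, leaving two
      coordinate rotations, the first with nonzero coefficient \<open>\<alpha>\<close>.\<close>
    let ?h = "lbracket ?L f (?w y z)"
    have "?h = ?w (f y) z + ?w y (f z)"
      using z by (intro wedge_bracket fso inB) auto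
    also have "\<dots> = (\<lambda>t. \<alpha> *s ?w x z t) + (\<lambda>t. \<gamma> *s ?w y x t)"
      by (subst fy, subst fz) (simp only: wedge_simps, simp add: fun_eq_iff)
    finally have h: "?h = (\<lambda>t. \<alpha> *s ?w x z t) + (\<lambda>t. \<gamma> *s ?w y x t)" .
    \<comment> \<open>\<open>lie_ideal\<close> gives closure only with the member of the ideal as
      second argument, so the bracket is reversed.\<close>
    have "?h = (\<lambda>t. (- 1) *s lbracket ?L (?w y z) f t)"
      by (auto simp: fun_eq_iff lbracket_so_lie)
    also have "\<dots> \<in> I"
      using z f by (intro fn.subspace_scale I_sub I_br wedge_so') auto
    finally have hI: "?h \<in> I" .
    have "so (span B) \<subseteq> I"
    proof (cases "\<gamma> = 0")
      case True
      then have "?w x z \<in> I"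
        using hI \<alpha> unscale[of \<alpha> "?w x z"] by (simp add: h plus_fun_def)
      then show ?thesis
        using all[of x z y] z card by (simp add: insert_commute)
    next
      case False
      have val: "?w x z y = 0" "?w x z x = (- g x x) *s z"
        using wedge_val[of x z y] z card by (simp_all add: insert_commute)
      have so: "?w x z \<in> so (span B)" "?w y x \<in> so (span B)"
        by (rule wedge_so'[OF x(1) zB], rule wedge_so'[OF y(1) x(1)])
      \<comment> \<open>This bracket kills the \<open>\<alpha>\<close> term and rotates the
        \<open>\<gamma>\<close> term into a multiple of \<open>wedge y z\<close>.\<close>
      have "lbracket ?L (?w x z) ?h = (\<lambda>t. \<gamma> *s lbracket ?L (?w x z) (?w y x) t)"
      proof -
        have "lbracket ?L (?w x z) ?h = lbracket ?L (?w x z) (\<lambda>t. \<alpha> *s ?w x z t)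
            + lbracket ?L (?w x z) (\<lambda>t. \<gamma> *s ?w y x t)"
          unfolding h by (intro L.add_right so fn.subspace_scale so_subspace sub)
        also have "lbracket ?L (?w x z) (\<lambda>t. \<alpha> *s ?w x z t) = 0"
          using L.smult_right[OF so(1,1), of \<alpha>] L.alternating[OF so(1)]
          by (simp add: lsmult_so fun_eq_iff)
        also have "lbracket ?L (?w x z) (\<lambda>t. \<gamma> *s ?w y x t) = (\<lambda>t. \<gamma> *s lbracket ?L (?w x z) (?w y x) t)"
          using L.smult_right[OF so, of \<gamma>] by (simp add: lsmult_so)
        finally show ?thesis by simp
      qed
      also have "\<dots> = (\<lambda>t. (- \<gamma> * g x x) *s ?w y z t)"
        using x(1) y(1) zB by (simp add: bracket val wedge_simps)
      finally have "(\<lambda>t. (- \<gamma> * g x x) *s ?w y z t) \<in> I"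
        using I_br[OF so(1) hI] by simp
      then have "?w y z \<in> I"
        using unscale[of "- \<gamma> * g x x" "?w y z"] False nz[of x] z by simp
      then show ?thesis
        using all[of y z x] z card by (simp add: insert_commute)
    qed
    then show ?thesis
      using I_sub by blast
  qed
  then show ?thesis
    using nonab by (auto simp: lie_simple_def)
qed

end

section \<open>Triples of spaces with a composition product\<close>

context sym_form
begin

lemma ortho_card_span:
  assumes W: "subspace W" "finite S" "span S = W" and nondeg: "nondegenerate_on g W"
    and B: "ortho B" "B \<subseteq> W" "card B = dim W"
  shows "span B = W"
proof -
  obtain B' where B': "B \<subseteq> B'" "ortho B'" "span B' = W"
    using ortho_extend[OF W nondeg B(1,2)] .
  then have "B = B'"
    using B(3) ortho_card[OF B'(2)] by (intro card_subset_eq) (auto simp: ortho_def)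
  then show ?thesis using B' by simp
qed

end

text \<open>\<open>m_form\<close> is the symmetry of the trilinear form read through
  \<open>g\<close>. Together with \<open>m_comm\<close> it makes every multiplication operator
  self-adjoint.\<close>

locale prod_form = sym_form scale g
  for scale :: "'f::field_char_0 \<Rightarrow> 'v::ab_group_add \<Rightarrow> 'v" (infixr "*s" 75)
    and g :: "'v \<Rightarrow> 'v \<Rightarrow> 'f" +
  fixes m :: "'v \<Rightarrow> 'v \<Rightarrow> 'v" (infixl "\<bullet>" 76)
  assumes m_comm: "x \<bullet> y = y \<bullet> x"
    and m_add: "x \<bullet> (y + z) = x \<bullet> y + x \<bullet> z"
    and m_scale: "x \<bullet> (c *s y) = c *s (x \<bullet> y)"
    and m_form: "g (x \<bullet> y) z = g x (y \<bullet> z)"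
begin

lemma m_zero: "x \<bullet> 0 = 0"
  using m_scale[of x 0 0] by simp

lemma m_neg: "x \<bullet> (- y) = - (x \<bullet> y)"
  using m_scale[of x "- 1" y] by simp

lemma m_diff: "x \<bullet> (y - z) = x \<bullet> y - x \<bullet> z"
  using m_add[of x y "- z"] by (simp add: m_neg)

lemmas m_right = m_add m_diff m_neg m_zero m_scale

lemma m_left: "(y + z) \<bullet> x = y \<bullet> x + z \<bullet> x" "(y - z) \<bullet> x = y \<bullet> x - z \<bullet> x"
  "(- y) \<bullet> x = - (y \<bullet> x)" "0 \<bullet> x = 0" "(c *s y) \<bullet> x = c *s (y \<bullet> x)"
  by (simp_all add: m_comm[of _ x] m_right)

lemma m_adjoint: "g (x \<bullet> y) z = g y (x \<bullet> z)"
  by (metis m_comm m_form)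

text \<open>The order of the three subspaces is left free, so that permuting the slots of a triple
  is a map between instances of the same definition.\<close>

definition tri :: "'v set \<Rightarrow> 'v set \<Rightarrow> 'v set \<Rightarrow> (('v \<Rightarrow> 'v) \<times> ('v \<Rightarrow> 'v) \<times> ('v \<Rightarrow> 'v)) set" where
  "tri A B C = {(p, q, r). p \<in> so A \<and> q \<in> so B \<and> r \<in> so C \<and>
     (\<forall>x\<in>A. \<forall>y\<in>B. \<forall>z\<in>C. g (p x \<bullet> y) z + g (x \<bullet> q y) z + g (x \<bullet> y) (r z) = 0)}"

lemma tri_swap: "(p, q, r) \<in> tri A B C \<Longrightarrow> (q, p, r) \<in> tri B A C"
  unfolding tri_def by (clarsimp, metis m_comm add.commute)

lemma tri_rotate:
  assumes "(p, q, r) \<in> tri A B C"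
  shows "(q, r, p) \<in> tri B C A"
proof -
  have "g (q y \<bullet> z) x + g (y \<bullet> r z) x + g (y \<bullet> z) (p x) = 0" if "x \<in> A" "y \<in> B" "z \<in> C" for x y z
  proof -
    have "g (p x \<bullet> y) z + g (x \<bullet> q y) z + g (x \<bullet> y) (r z) = 0"
      using assms that by (simp add: tri_def)
    then show ?thesis
      by (simp add: m_form g_sym[of _ x] g_sym[of _ "p x"] algebra_simps)
  qed
  then show ?thesis
    using assms by (simp add: tri_def)
qed

text \<open>For \<open>n = 4\<close>, \<open>Ann A B C\<close> and \<open>Ann A C B\<close> are the two chiral summands of \<open>so A\<close>.\<close>

definition Ann :: "'v set \<Rightarrow> 'v set \<Rightarrow> 'v set \<Rightarrow> ('v \<Rightarrow> 'v) set" where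
  "Ann A B C = {p. \<exists>s. (p, 0, s) \<in> tri A B C}"

text \<open>The action of the even Clifford element \<open>u v\<close>, cut off outside
  \<open>S\<close> because members of \<open>so S\<close> vanish there.\<close>

definition opr :: "'v set \<Rightarrow> 'v \<Rightarrow> 'v \<Rightarrow> 'v \<Rightarrow> 'v" where
  "opr S u v = (\<lambda>x. if x \<in> S then u \<bullet> (v \<bullet> x) else 0)"

end

text \<open>The assumptions are symmetric in the three subspaces. \<open>trip_swap\<close> and
  \<open>trip_rotate\<close> generate all permutations, so each fact proved for one slot transfers
  to the others by interpretation.\<close>

locale composition_triple = prod_form scale g m
  for scale :: "'f::field_char_0 \<Rightarrow> 'v::ab_group_add \<Rightarrow> 'v" (infixr "*s" 75)
    and g :: "'v \<Rightarrow> 'v \<Rightarrow> 'f" and m :: "'v \<Rightarrow> 'v \<Rightarrow> 'v" (infixl "\<bullet>" 76) +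
  fixes A B C :: "'v set" and n :: nat
  assumes n_pos: "n > 0"
    and spaces: "S \<in> {A, B, C} \<Longrightarrow>
      subspace S \<and> (\<exists>T. finite T \<and> span T = S) \<and> nondegenerate_on g S \<and> dim S = n"
    and AB: "x \<in> A \<Longrightarrow> y \<in> B \<Longrightarrow> x \<bullet> y \<in> C"
    and AC: "x \<in> A \<Longrightarrow> y \<in> C \<Longrightarrow> x \<bullet> y \<in> B"
    and BC: "x \<in> B \<Longrightarrow> y \<in> C \<Longrightarrow> x \<bullet> y \<in> A"
    and sqA: "x \<in> A \<Longrightarrow> y \<in> B \<union> C \<Longrightarrow> x \<bullet> (x \<bullet> y) = g x x *s y"
    and sqB: "x \<in> B \<Longrightarrow> y \<in> A \<union> C \<Longrightarrow> x \<bullet> (x \<bullet> y) = g x x *s y"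
    and sqC: "x \<in> C \<Longrightarrow> y \<in> A \<union> B \<Longrightarrow> x \<bullet> (x \<bullet> y) = g x x *s y"
begin

lemma BA: "x \<in> B \<Longrightarrow> y \<in> A \<Longrightarrow> x \<bullet> y \<in> C"
  and CA: "x \<in> C \<Longrightarrow> y \<in> A \<Longrightarrow> x \<bullet> y \<in> B"
  and CB: "x \<in> C \<Longrightarrow> y \<in> B \<Longrightarrow> x \<bullet> y \<in> A"
  using AB AC BC m_comm by metis+

lemma trip_swap: "composition_triple scale g m B A C n"
proof (intro composition_triple.intro composition_triple_axioms.intro)
  show "prod_form scale g m" by (rule prod_form_axioms)
  show "0 < n" by (rule n_pos)
  show "subspace S \<and> (\<exists>T. finite T \<and> span T = S) \<and> nondegenerate_on g S \<and> dim S = n"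
    if "S \<in> {B, A, C}" for S using that by (intro spaces) blast
  show "x \<in> B \<Longrightarrow> y \<in> A \<Longrightarrow> x \<bullet> y \<in> C"
    "x \<in> B \<Longrightarrow> y \<in> C \<Longrightarrow> x \<bullet> y \<in> A"
    "x \<in> A \<Longrightarrow> y \<in> C \<Longrightarrow> x \<bullet> y \<in> B" for x y
    by (rule BA BC AC; assumption)+
  show "y \<in> A \<union> C \<Longrightarrow> x \<bullet> (x \<bullet> y) = g x x *s y" if "x \<in> B" for x y
    by (rule sqB[OF that]) blast
  show "y \<in> B \<union> C \<Longrightarrow> x \<bullet> (x \<bullet> y) = g x x *s y" if "x \<in> A" for x y
    by (rule sqA[OF that]) blast
  show "y \<in> B \<union> A \<Longrightarrow> x \<bullet> (x \<bullet> y) = g x x *s y" if "x \<in> C" for x y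
    by (rule sqC[OF that]) blast
qed

lemma trip_rotate: "composition_triple scale g m B C A n"
proof (intro composition_triple.intro composition_triple_axioms.intro)
  show "prod_form scale g m" by (rule prod_form_axioms)
  show "0 < n" by (rule n_pos)
  show "subspace S \<and> (\<exists>T. finite T \<and> span T = S) \<and> nondegenerate_on g S \<and> dim S = n"
    if "S \<in> {B, C, A}" for S using that by (intro spaces) blast
  show "x \<in> B \<Longrightarrow> y \<in> C \<Longrightarrow> x \<bullet> y \<in> A"
    "x \<in> B \<Longrightarrow> y \<in> A \<Longrightarrow> x \<bullet> y \<in> C"
    "x \<in> C \<Longrightarrow> y \<in> A \<Longrightarrow> x \<bullet> y \<in> B" for x y
    by (rule BC BA CA; assumption)+
  show "y \<in> C \<union> A \<Longrightarrow> x \<bullet> (x \<bullet> y) = g x x *s y" if "x \<in> B" for x y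
    by (rule sqB[OF that]) blast
  show "y \<in> B \<union> A \<Longrightarrow> x \<bullet> (x \<bullet> y) = g x x *s y" if "x \<in> C" for x y
    by (rule sqC[OF that]) blast
  show "y \<in> B \<union> C \<Longrightarrow> x \<bullet> (x \<bullet> y) = g x x *s y" if "x \<in> A" for x y
    by (rule sqA[OF that]) blast
qed

lemma sub: "subspace A" "subspace B" "subspace C"
  using spaces by auto

lemma ortho_basis_extend:
  assumes "S \<in> {A, B, C}" "ortho E0" "E0 \<subseteq> S"
  obtains E where "E0 \<subseteq> E" "ortho E" "span E = S" "card E = n"
proof -
  obtain T where "subspace S" "finite T" "span T = S" "nondegenerate_on g S" "dim S = n"
    using spaces[OF assms(1)] by blast
  then obtain E where "E0 \<subseteq> E" "ortho E" "span E = S"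
    using ortho_extend assms by metis
  then show thesis
    using that ortho_card \<open>dim S = n\<close> by blast
qed

lemma ortho_basis:
  assumes "S \<in> {A, B, C}"
  obtains E where "ortho E" "span E = S" "card E = n"
  using ortho_basis_extend[OF assms, of "{}"] by (auto simp: ortho_def)

lemma anisotropic:
  assumes "S \<in> {A, B, C}"
  obtains e where "e \<in> S" "g e e \<noteq> 0"
proof -
  obtain E where E: "ortho E" "span E = S" "card E = n"
    using ortho_basis[OF assms] .
  then obtain e where "e \<in> E" using n_pos by fastforce
  then show thesis
    using that E span_base by (auto simp: ortho_def)
qed

lemma ortho_spans:
  assumes "S \<in> {A, B, C}" "ortho E" "E \<subseteq> S" "card E = n"
  shows "span E = S"
proof -
  obtain T where "subspace S" "finite T" "span T = S" "nondegenerate_on g S" "dim S = n"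
    using spaces[OF assms(1)] by blast
  then show ?thesis
    using ortho_card_span assms by metis
qed

section \<open>Clifford relations and orthogonal bases obtained by multiplication\<close>

lemma AH: "x \<in> A \<Longrightarrow> y \<in> B \<union> C \<Longrightarrow> x \<bullet> y \<in> B \<union> C"
  using AB AC by blast

text \<open>Polarisation of \<open>sqA\<close> at \<open>u + v\<close>: the defining relation of the
  Clifford algebra of \<open>A\<close>.\<close>

lemma polar:
  assumes "u \<in> A" "v \<in> A" "y \<in> B \<union> C"
  shows "u \<bullet> (v \<bullet> y) + v \<bullet> (u \<bullet> y) = (2 * g u v) *s y"
proof -
  have "(u + v) \<bullet> ((u + v) \<bullet> y) = g (u + v) (u + v) *s y"
    by (intro sqA subspace_add sub assms)
  moreover have "(u + v) \<bullet> ((u + v) \<bullet> y)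
      = u \<bullet> (u \<bullet> y) + v \<bullet> (v \<bullet> y) + (u \<bullet> (v \<bullet> y) + v \<bullet> (u \<bullet> y))"
    by (simp only: m_left m_right add_ac)
  moreover have "g (u + v) (u + v) = g u u + g v v + 2 * g u v"
    by (simp only: g_simps g_sym[of v u] mult_2 add_ac)
  ultimately show ?thesis
    using sqA[OF assms(1,3)] sqA[OF assms(2,3)] by (simp only: scale_left_distrib add_left_cancel)
qed

lemma anticomm: "u \<in> A \<Longrightarrow> v \<in> A \<Longrightarrow> g u v = 0 \<Longrightarrow> y \<in> B \<union> C \<Longrightarrow> v \<bullet> (u \<bullet> y) = - (u \<bullet> (v \<bullet> y))"
  using polar[of u v y] by (simp add: eq_neg_iff_add_eq_0 add.commute)

lemma isometry:
  assumes "x \<in> A" "y \<in> B \<union> C"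
  shows "g (x \<bullet> y) (x \<bullet> z) = g x x * g y z"
proof -
  have "g (x \<bullet> y) (x \<bullet> z) = g (x \<bullet> (x \<bullet> y)) z"
    by (rule m_adjoint[symmetric])
  then show ?thesis by (simp only: sqA[OF assms] g_left)
qed

lemma isometry':
  assumes "x \<in> A" "y \<in> B"
  shows "g (x \<bullet> y) (z \<bullet> y) = g y y * g x z"
proof -
  have "g (x \<bullet> y) (z \<bullet> y) = g (y \<bullet> (y \<bullet> x)) z"
    by (simp only: m_comm[of x y] m_comm[of z y] m_adjoint)
  then show ?thesis using sqB[of y x] assms by (simp add: g_left)
qed

text \<open>Multiplication by \<open>f\<close> scales the form by \<open>g f f\<close>, so it keeps
  the basis orthogonal and anisotropic. Its size \<open>n\<close> then forces it to span.\<close>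

lemma basis_C:
  assumes E: "ortho E" "span E = A" and f: "f \<in> B" "g f f \<noteq> 0"
  shows "ortho ((\<lambda>x. x \<bullet> f) ` E)" "span ((\<lambda>x. x \<bullet> f) ` E) = C"
proof -
  have EA: "x \<in> A" if "x \<in> E" for x using that E span_base by blast
  have gE: "g (x \<bullet> f) (y \<bullet> f) = g f f * g x y" if "x \<in> E" "y \<in> E" for x y
    using isometry' EA that f by simp
  show o: "ortho ((\<lambda>x. x \<bullet> f) ` E)"
    using E(1) f(2) by (auto simp: ortho_def gE)
  have "inj_on (\<lambda>x. x \<bullet> f) E"
  proof (rule inj_onI)
    fix x y assume *: "x \<in> E" "y \<in> E" "x \<bullet> f = y \<bullet> f"
    then have "g f f * g x y = g f f * g x x"
      using gE by metis
    then have "g x y = g x x"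
      using f(2) by simp
    then show "x = y"
      using E(1) *(1,2) unfolding ortho_def by metis
  qed
  then have "card ((\<lambda>x. x \<bullet> f) ` E) = n"
    using ortho_card[OF E(1)] E(2) spaces by (simp add: card_image)
  then show "span ((\<lambda>x. x \<bullet> f) ` E) = C"
    using o EA f AB by (intro ortho_spans) auto
qed

text \<open>A second multiplication, by \<open>e\<close>, carries the basis of \<open>C\<close> on
  to \<open>B\<close>. Thus even products applied to a single anisotropic vector of \<open>B\<close>
  already fill \<open>B\<close>.\<close>

lemma basis_B:
  assumes "ortho E" "span E = A" "f \<in> B" "g f f \<noteq> 0" "e \<in> A" "g e e \<noteq> 0"
  shows "ortho ((\<lambda>x. e \<bullet> (x \<bullet> f)) ` E)" "span ((\<lambda>x. e \<bullet> (x \<bullet> f)) ` E) = B"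
proof -
  interpret R: composition_triple scale g m C A B n
    by (rule composition_triple.trip_rotate[OF trip_rotate])
  have "ortho ((\<lambda>z. z \<bullet> e) ` (\<lambda>x. x \<bullet> f) ` E)" "span ((\<lambda>z. z \<bullet> e) ` (\<lambda>x. x \<bullet> f) ` E) = B"
    by (rule R.basis_C[OF basis_C[OF assms(1-4)] assms(5,6)])+
  then show "ortho ((\<lambda>x. e \<bullet> (x \<bullet> f)) ` E)" "span ((\<lambda>x. e \<bullet> (x \<bullet> f)) ` E) = B"
    by (simp_all only: image_image m_comm[of _ e])
qed

section \<open>The triality constraint as a derivation rule\<close>

lemma triI:
  assumes "p \<in> so A" "q \<in> so B" "r \<in> so C"
    and "\<And>x y. x \<in> A \<Longrightarrow> y \<in> B \<Longrightarrow> r (x \<bullet> y) = p x \<bullet> y + x \<bullet> q y"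
  shows "(p, q, r) \<in> tri A B C"
proof -
  have "g (p x \<bullet> y) z + g (x \<bullet> q y) z + g (x \<bullet> y) (r z) = 0" if "x \<in> A" "y \<in> B" "z \<in> C" for x y z
    using so_skew[OF assms(3), of "x \<bullet> y" z] AB that assms(4)[OF that(1,2)] by (simp add: g_simps)
  then show ?thesis
    using assms by (simp add: tri_def)
qed

lemma tri_so:
  assumes "(p, q, r) \<in> tri A B C"
  shows "p \<in> so A" "q \<in> so B" "r \<in> so C"
  using assms by (auto simp: tri_def)

text \<open>Skewness of \<open>r\<close> moves it off \<open>z\<close> in the constraint, and
  nondegeneracy on \<open>C\<close> removes \<open>z\<close>. What remains is a Leibniz rule for the
  product.\<close>

lemma tri_C:
  assumes "(p, q, r) \<in> tri A B C" "x \<in> A" "y \<in> B"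
  shows "r (x \<bullet> y) = p x \<bullet> y + x \<bullet> q y"
proof (rule nondegenerate_eqI[of C])
  note so = tri_so[OF assms(1)]
  show "nondegenerate_on g C" using spaces by blast
  show "r (x \<bullet> y) \<in> C" "p x \<bullet> y + x \<bullet> q y \<in> C"
    using assms so_mem[OF so(1)] so_mem[OF so(2)] so_mem[OF so(3)] AB
    by (auto intro!: subspace_add sub)
  fix z assume "z \<in> C"
  then have "g (p x \<bullet> y) z + g (x \<bullet> q y) z + g (x \<bullet> y) (r z) = 0"
    "g (r (x \<bullet> y)) z = - g (x \<bullet> y) (r z)"
    using assms so_skew[OF so(3)] AB by (auto simp: tri_def)
  then show "g (r (x \<bullet> y)) z = g (p x \<bullet> y + x \<bullet> q y) z"
    unfolding g_left by (metis eq_neg_iff_add_eq_0)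
qed (rule sub)

lemma tri_B:
  assumes "(p, q, r) \<in> tri A B C" "x \<in> A" "z \<in> C"
  shows "q (x \<bullet> z) = p x \<bullet> z + x \<bullet> r z"
proof -
  interpret R: composition_triple scale g m C A B n
    by (rule composition_triple.trip_rotate[OF trip_rotate])
  have "q (z \<bullet> x) = r z \<bullet> x + z \<bullet> p x"
    by (rule R.tri_C[OF tri_rotate[OF tri_rotate[OF assms(1)]] assms(3,2)])
  then show ?thesis
    by (metis m_comm add.commute)
qed

lemma tri_add:
  assumes "(p, q, r) \<in> tri A B C" "(p', q', r') \<in> tri A B C"
  shows "(p + p', q + q', r + r') \<in> tri A B C"
  using tri_so[OF assms(1)] tri_so[OF assms(2)]
  by (intro triI fn.subspace_add so_subspace sub)
    (simp_all add: tri_C[OF assms(1)] tri_C[OF assms(2)] m_left m_right)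

lemma tri_scale:
  assumes "(p, q, r) \<in> tri A B C"
  shows "(\<lambda>x. c *s p x, \<lambda>x. c *s q x, \<lambda>x. c *s r x) \<in> tri A B C"
  using tri_so[OF assms]
  by (intro triI fn.subspace_scale so_subspace sub)
    (simp_all add: tri_C[OF assms] m_left m_right scale_right_distrib)

lemma tri_diff:
  assumes "(p, q, r) \<in> tri A B C" "(p', q', r') \<in> tri A B C"
  shows "(p - p', q - q', r - r') \<in> tri A B C"
  using tri_so[OF assms(1)] tri_so[OF assms(2)]
  by (intro triI fn.subspace_diff so_subspace sub)
    (simp_all add: tri_C[OF assms(1)] tri_C[OF assms(2)] m_left m_right)

lemma tri_zero: "(0, 0, 0) \<in> tri A B C"
  by (intro triI fn.subspace_0 so_subspace sub) (simp add: m_left m_right)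

lemma tri_bracket:
  assumes "(p, q, r) \<in> tri A B C" "(p', q', r') \<in> tri A B C"
  shows "(lbracket (so_lie scale g A) p p', lbracket (so_lie scale g B) q q',
    lbracket (so_lie scale g C) r r') \<in> tri A B C"
proof (intro triI so_bracket sub)
  note so = tri_so[OF assms(1)] and so' = tri_so[OF assms(2)]
  show "p \<in> so A" "q \<in> so B" "r \<in> so C" "p' \<in> so A" "q' \<in> so B" "r' \<in> so C"
    by (fact so so')+
  fix x y assume xy: "x \<in> A" "y \<in> B"
  note mem = so_mem[OF so(1) xy(1)] so_mem[OF so'(1) xy(1)] so_mem[OF so(2) xy(2)] so_mem[OF so'(2) xy(2)]
  show "lbracket (so_lie scale g C) r r' (x \<bullet> y) =
    lbracket (so_lie scale g A) p p' x \<bullet> y + x \<bullet> lbracket (so_lie scale g B) q q' y"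
    using xy mem by (simp add: lbracket_so_lie tri_C[OF assms(1)] tri_C[OF assms(2)]
        so_add[OF so(3)] so_add[OF so'(3)] AB m_left m_right)
qed

lemma opr_so:
  assumes "u \<in> A" "v \<in> A" "g u v = 0"
  shows "opr B u v \<in> so B" "opr C u v \<in> so C"
proof -
  have "g (u \<bullet> (v \<bullet> x)) y = - g x (u \<bullet> (v \<bullet> y))" if "y \<in> B \<union> C" for x y
    using anticomm[OF assms that] by (simp add: m_adjoint g_simps)
  then show "opr B u v \<in> so B" "opr C u v \<in> so C"
    using assms by (auto simp: so_iff opr_def subspace_add subspace_scale sub m_right AB AC)
qed

text \<open>The commutator of the Clifford element \<open>u v\<close> with a vector \<open>x\<close>
  is twice the rotation of \<open>x\<close> in the plane of \<open>u\<close> and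
  \<open>v\<close>.\<close>

lemma tri_wedge:
  assumes uv: "u \<in> A" "v \<in> A" "g u v = 0"
  shows "(\<lambda>x. 2 *s wedge A u v x, opr B u v, opr C u v) \<in> tri A B C"
proof (rule triI)
  show "(\<lambda>x. 2 *s wedge A u v x) \<in> so A"
    by (intro fn.subspace_scale so_subspace sub wedge_so uv)
  show "opr B u v \<in> so B" "opr C u v \<in> so C"
    by (rule opr_so[OF uv])+
  fix x y assume xy: "x \<in> A" "y \<in> B"
  \<comment> \<open>The vector \<open>x\<close> is moved to the left past \<open>v\<close> and then
    past \<open>u\<close>. The two polar terms make up the rotation.\<close>
  have "v \<bullet> (x \<bullet> y) = (2 * g v x) *s y - x \<bullet> (v \<bullet> y)"
    "u \<bullet> (x \<bullet> (v \<bullet> y)) = (2 * g u x) *s (v \<bullet> y) - x \<bullet> (u \<bullet> (v \<bullet> y))"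
    using polar[of v x y] polar[of u x "v \<bullet> y"] uv xy AB by (simp_all add: eq_diff_eq)
  then show "opr C u v (x \<bullet> y) = (2 *s wedge A u v x) \<bullet> y + x \<bullet> opr B u v y"
    using xy AB by (simp add: opr_def wedge_def m_left m_right scale_right_diff_distrib)
qed

lemma tri_surj:
  assumes "p \<in> so A"
  shows "\<exists>q r. (p, q, r) \<in> tri A B C"
proof -
  obtain E where E: "ortho E" "span E = A"
    using ortho_basis[of A] by blast
  have "fn.subspace {p. \<exists>q r. (p, q, r) \<in> tri A B C}"
    unfolding fn.subspace_def using tri_zero tri_add tri_scale by blast
  moreover have "wedge A b c \<in> {p. \<exists>q r. (p, q, r) \<in> tri A B C}" if "b \<in> E" "c \<in> E" "b \<noteq> c" for b c
  proof -
    have "b \<in> A" "c \<in> A" "g b c = 0"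
      using that E span_base by (auto simp: ortho_def)
    from tri_scale[OF tri_wedge[OF this], of "1/2"] show ?thesis
      by auto
  qed
  ultimately have "fn.span {wedge A b c |b c. b \<in> E \<and> c \<in> E \<and> b \<noteq> c} \<subseteq> {p. \<exists>q r. (p, q, r) \<in> tri A B C}"
    by (intro fn.span_minimal) blast+
  then have "so A \<subseteq> {p. \<exists>q r. (p, q, r) \<in> tri A B C}"
    using so_span_wedge[OF E(1)] unfolding E(2) by simp
  then show ?thesis
    using assms by blast
qed

text \<open>With zero in the first slot, passing a vector of \<open>A\<close> exchanges
  \<open>q\<close> and \<open>r\<close>. After two vectors \<open>q\<close> is back.\<close>

lemma tri_kernel_comm:
  assumes "(0, q, r) \<in> tri A B C" "u \<in> A" "v \<in> A" "y \<in> B"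
  shows "q (u \<bullet> (v \<bullet> y)) = u \<bullet> (v \<bullet> q y)"
proof -
  have "q (u \<bullet> (v \<bullet> y)) = 0 u \<bullet> (v \<bullet> y) + u \<bullet> r (v \<bullet> y)"
    by (rule tri_B[OF assms(1,2) AB[OF assms(3,4)]])
  also have "r (v \<bullet> y) = 0 v \<bullet> y + v \<bullet> q y"
    by (rule tri_C[OF assms(1,3,4)])
  finally show ?thesis by (simp add: m_left)
qed

text \<open>The vectors \<open>e (x f)\<close> span \<open>B\<close> and the vectors
  \<open>x f\<close> span \<open>C\<close>, so commutation propagates the vanishing of
  \<open>q\<close> at \<open>f\<close> to both spaces.\<close>

lemma tri_kernel_zero:
  assumes T: "(0, q, r) \<in> tri A B C" and f: "f \<in> B" "g f f \<noteq> 0" "q f = 0"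
  shows "q = 0 \<and> r = 0"
proof -
  note so = tri_so[OF T]
  obtain E where E: "ortho E" "span E = A"
    using ortho_basis[of A] by blast
  obtain e where e: "e \<in> A" "g e e \<noteq> 0"
    using anisotropic[of A] by blast
  have EA: "x \<in> A" if "x \<in> E" for x using that E span_base by blast
  have "q = 0"
  proof (rule so_eqI)
    let ?E = "(\<lambda>x. e \<bullet> (x \<bullet> f)) ` E"
    have span: "span ?E = B"
      using basis_B[OF E f(1,2) e] by simp
    show "q \<in> so (span ?E)" "0 \<in> so (span ?E)"
      unfolding span by (rule so, intro fn.subspace_0 so_subspace sub)
    fix x assume "x \<in> ?E"
    then show "q x = 0 x"
      using tri_kernel_comm[OF T e(1) EA f(1)] f(3) by (auto simp: m_right)
  qed
  moreover have "r = 0"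
  proof (rule so_eqI)
    let ?E = "(\<lambda>x. x \<bullet> f) ` E"
    have span: "span ?E = C"
      using basis_C[OF E f(1,2)] by simp
    show "r \<in> so (span ?E)" "0 \<in> so (span ?E)"
      unfolding span by (rule so, intro fn.subspace_0 so_subspace sub)
    fix x assume "x \<in> ?E"
    then show "r x = 0 x"
      using tri_C[OF T EA f(1)] f(3) by (auto simp: m_right m_left)
  qed
  ultimately show ?thesis ..
qed

text \<open>After a permutation of the slots this is \<open>tri_kernel_zero\<close> with
  \<open>q = 0\<close>.\<close>

lemma tri_single:
  assumes "(p, 0, 0) \<in> tri A B C"
  shows "p = 0"
proof -
  obtain e where e: "e \<in> B" "g e e \<noteq> 0"
    using anisotropic[of B] by blast
  interpret R: composition_triple scale g m C B A n
    by (rule composition_triple.trip_swap[OF trip_rotate])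
  have "(0, 0, p) \<in> tri C B A"
    using tri_swap[OF tri_rotate[OF assms]] .
  from R.tri_kernel_zero[OF this e] show ?thesis
    by simp
qed

section \<open>The triality algebra in dimensions one, two and eight\<close>

lemma tri_one:
  assumes "n = 1" "(p, q, r) \<in> tri A B C"
  shows "p = 0" "q = 0" "r = 0"
proof -
  have "f = 0" if S: "S \<in> {A, B, C}" and f: "f \<in> so S" for f S
  proof -
    obtain E where E: "ortho E" "span E = S" "card E = n"
      using ortho_basis[OF S] .
    then obtain e where "E = {e}"
      using assms(1) card_1_singletonE by metis
    then have "{wedge S b c |b c. b \<in> E \<and> c \<in> E \<and> b \<noteq> c} = {}"
      by blast
    then show ?thesis
      using f so_span_wedge[OF E(1)] unfolding E(2) by (metis fn.span_empty singletonD)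
  qed
  then show "p = 0" "q = 0" "r = 0"
    using tri_so[OF assms(2)] by blast+
qed

text \<open>When \<open>u\<close> and \<open>v\<close> span \<open>A\<close>, the element
  \<open>u v\<close> anticommutes with all of \<open>A\<close>, so it acts on \<open>B\<close> and
  its negative on \<open>C\<close> with zero in the first slot. The minus sign at \<open>J3\<close>
  makes multiples \<open>a\<close>, \<open>b\<close>, \<open>c\<close> of the generators compatible
  exactly when their sum is zero.\<close>

lemma tri_two:
  assumes n: "n = 2"
  obtains J1 J2 J3 where "J1 \<noteq> 0" "J2 \<noteq> 0" "J3 \<noteq> 0" "(J1, 0, - J3) \<in> tri A B C" "(0, J2, - J3) \<in> tri A B C"
proof -
  obtain E where E: "ortho E" "span E = A" "card E = n"
    using ortho_basis[of A] by blast
  then obtain u v where uv: "E = {u, v}" "u \<noteq> v"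
    using n card_2_iff by metis
  then have A: "u \<in> A" "v \<in> A" and gg: "g u v = 0" "g u u \<noteq> 0" "g v v \<noteq> 0"
    using E span_base by (auto simp: ortho_def)
  obtain f where f: "f \<in> B" "g f f \<noteq> 0"
    using anisotropic[of B] by blast
  have T1: "(\<lambda>x. 2 *s wedge A u v x, opr B u v, opr C u v) \<in> tri A B C"
    by (rule tri_wedge[OF A gg(1)])
  have T2: "(0, opr B u v, - opr C u v) \<in> tri A B C"
  proof (rule triI)
    show "0 \<in> so A" "opr B u v \<in> so B" "- opr C u v \<in> so C"
      using opr_so[OF A gg(1)] by (auto intro!: fn.subspace_neg fn.subspace_0 so_subspace sub)
    fix x y assume x: "x \<in> A" and y: "y \<in> B"
    have "- (u \<bullet> (v \<bullet> (x \<bullet> y))) = x \<bullet> (u \<bullet> (v \<bullet> y))"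
      using x[folded E(2)]
    proof (induction rule: span_induct_alt)
      case base
      show ?case by (simp add: m_left m_right)
    next
      case (step c x z)
      have "u \<bullet> (v \<bullet> (u \<bullet> y)) = - (u \<bullet> (u \<bullet> (v \<bullet> y)))"
        using anticomm[OF A gg(1), of y] y by (simp add: m_right)
      moreover have "u \<bullet> (v \<bullet> (v \<bullet> y)) = - (v \<bullet> (u \<bullet> (v \<bullet> y)))"
        using anticomm[OF A gg(1), of "v \<bullet> y"] AB[OF A(2) y] by simp
      ultimately have "- (u \<bullet> (v \<bullet> (x \<bullet> y))) = x \<bullet> (u \<bullet> (v \<bullet> y))"
        using step(1) uv(1) by auto
      then show ?case
        using step(2) by (simp add: m_left m_right flip: scale_minus_right)
    qed
    then show "(- opr C u v) (x \<bullet> y) = 0 x \<bullet> y + x \<bullet> opr B u v y"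
      using x y AB by (simp add: opr_def m_left)
  qed
  \<comment> \<open>The difference of the two triples cancels the slot of \<open>B\<close> and
    doubles that of \<open>C\<close>.\<close>
  have "((\<lambda>x. 2 *s wedge A u v x), 0, (\<lambda>x. 2 *s opr C u v x)) \<in> tri A B C"
    using tri_diff[OF T1 T2] scale_left_distrib[of 1 1] by (simp add: fun_diff_def plus_fun_def fun_Compl_def zero_fun_def)
  from tri_scale[OF this, of "1/2"]
  have T3: "(wedge A u v, 0, opr C u v) \<in> tri A B C"
    by (simp add: zero_fun_def)
  have T4: "(0, - opr B u v, opr C u v) \<in> tri A B C"
    using tri_diff[OF tri_zero T2] by simp
  have "g (wedge A u v v) u \<noteq> 0"
    using A gg by (simp add: wedge_def g_simps)
  then have 1: "wedge A u v \<noteq> 0" by (auto simp: g_simps)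
  have 2: "opr S u v \<noteq> 0" if x: "x \<in> S" "S \<in> {B, C}" "g x x \<noteq> 0" for x S
  proof -
    \<comment> \<open>\<open>v u\<close> inverts \<open>u v\<close> up to the nonzero factor
      \<open>g u u * g v v\<close>, so the operator is nonzero.\<close>
    have "v \<bullet> (u \<bullet> (opr S u v x)) = (g u u * g v v) *s x"
      using x A sqA AH by (auto simp: opr_def m_right)
    moreover have "x \<noteq> 0" using x(3) by (auto simp: g_simps)
    ultimately show ?thesis
      using gg by (auto simp: m_right)
  qed
  obtain h where h: "h \<in> C" "g h h \<noteq> 0"
    using anisotropic[of C] by blast
  show thesis
    using that[of "wedge A u v" "- opr B u v" "- opr C u v"] T3 T4 1 2[of f B] 2[of h C] f h
    by simp
qed

text \<open>It suffices that \<open>q f\<close> is orthogonal to the basis \<open>e (v f)\<close> of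
  \<open>B\<close>. For \<open>v = e\<close> this is skewness of \<open>q\<close>. For
  \<open>v\<close> orthogonal to \<open>e\<close>, the twofold product is rewritten as a multiple of
  a fourfold product \<open>e (a (b (c f)))\<close> of orthogonal vectors.\<close>

lemma tri_eight:
  assumes n: "n = 8" and T: "(0, q, r) \<in> tri A B C"
  shows "q = 0 \<and> r = 0"
proof -
  note so = tri_so[OF T]
  obtain f where f: "f \<in> B" "g f f \<noteq> 0"
    using anisotropic[of B] by blast
  obtain E where E: "ortho E" "span E = A" "card E = n"
    using ortho_basis[of A] by blast
  have EA: "x \<in> A" "g x x \<noteq> 0" if "x \<in> E" for x
    using that E span_base by (auto simp: ortho_def)
  have E_orth: "g x y = 0" if "x \<in> E" "y \<in> E" "x \<noteq> y" for x y
    using that E by (simp add: ortho_def)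
  obtain e where e: "e \<in> E"
    using E n by fastforce
  define w where "w = q f"
  have w: "w \<in> B" unfolding w_def by (rule so_mem[OF so(2) f(1)])
  have fw: "g f w = 0" unfolding w_def by (rule so_self[OF so(2) f(1)])
  text \<open>\<open>w\<close> is orthogonal to \<open>x\<^sub>1(x\<^sub>2(x\<^sub>3(x\<^sub>4 f)))\<close> for orthogonal \<open>x\<^sub>i\<close> in \<open>A\<close>, since that
    operator is self-adjoint and commutes with the skew \<open>q\<close>.\<close>
  have four: "g (x1 \<bullet> (x2 \<bullet> (x3 \<bullet> (x4 \<bullet> f)))) w = 0"
    if x: "x1 \<in> A" "x2 \<in> A" "x3 \<in> A" "x4 \<in> A"
      and o: "g x1 x2 = 0" "g x1 x3 = 0" "g x1 x4 = 0" "g x2 x3 = 0" "g x2 x4 = 0" "g x3 x4 = 0"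
    for x1 x2 x3 x4
  proof -
    \<comment> \<open>Reversing four anticommuting factors takes six transpositions, an even number,
      so no sign appears.\<close>
    have rev: "x4 \<bullet> (x3 \<bullet> (x2 \<bullet> (x1 \<bullet> y))) = x1 \<bullet> (x2 \<bullet> (x3 \<bullet> (x4 \<bullet> y)))" if "y \<in> B \<union> C" for y
      using x o that AH
      by (simp add: anticomm[of x1 x2] anticomm[of x1 x3] anticomm[of x1 x4] anticomm[of x2 x3]
          anticomm[of x2 x4] anticomm[of x3 x4] m_right)
    let ?z = "x1 \<bullet> (x2 \<bullet> (x3 \<bullet> (x4 \<bullet> f)))"
    have "g ?z w = g f (x4 \<bullet> (x3 \<bullet> (x2 \<bullet> (x1 \<bullet> w))))"
      by (simp add: m_adjoint)
    also have "\<dots> = g f (x1 \<bullet> (x2 \<bullet> (x3 \<bullet> (x4 \<bullet> w))))"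
      using w by (simp add: rev)
    also have "\<dots> = g f (q ?z)"
      using tri_kernel_comm[OF T x(1,2), of "x3 \<bullet> (x4 \<bullet> f)"] tri_kernel_comm[OF T x(3,4) f(1)] x AB AC f
      by (simp add: w_def)
    also have "\<dots> = - g w ?z"
      using so_skew[OF so(2) f(1), of ?z] x AB AC f by (simp add: w_def)
    finally have "2 * g ?z w = 0"
      by (metis g_sym eq_neg_iff_add_eq_0 mult_2)
    then show ?thesis by simp
  qed
  have "g (e \<bullet> (v \<bullet> f)) w = 0" if v: "v \<in> E" for v
  proof (cases "v = e")
    case True
    then show ?thesis
      using EA[OF e] f fw by (simp add: sqA g_simps)
  next
    case False
    have "card (E - {e, v}) = 6"
      using E n e v False by (simp add: card_Diff_subset)
    then obtain a where a: "a \<in> E" "a \<noteq> e" "a \<noteq> v"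
      by (metis DiffE card.empty ex_in_conv insertCI zero_neq_numeral)
    note mem = EA[OF e] EA[OF v] EA[OF a(1)]
    have orth: "g e v = 0" "g e a = 0" "g v a = 0" "g v e = 0" "g a e = 0" "g a v = 0"
      using E_orth e v a False by auto
    \<comment> \<open>The choice is made backwards. If \<open>c f\<close> is a multiple of
      \<open>b y\<close>, then \<open>b\<close> and \<open>a\<close> square away and leave
      \<open>v f\<close>, which suggests \<open>c = f (b y)\<close>. Then
      \<open>g c e = g b t\<close>, so \<open>b\<close> has to be orthogonal to \<open>t\<close> as
      well.\<close>
    define y where "y = a \<bullet> (v \<bullet> f)"
    define t where "t = y \<bullet> (e \<bullet> f)"
    have yB: "y \<in> B" and ef: "e \<bullet> f \<in> C" and vf: "v \<bullet> f \<in> C"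
      using mem f AB AC by (simp_all add: y_def)
    have t: "t \<in> A"
      using BC yB ef by (simp add: t_def)
    have "g t t = g y y * g (e \<bullet> f) (e \<bullet> f)"
      using yB ef unfolding t_def by (subst m_adjoint) (simp add: sqB g_simps)
    also have "\<dots> = (g a a * (g v v * g f f)) * (g e e * g f f)"
      using mem f vf by (simp add: y_def isometry)
    \<comment> \<open>Anisotropy of \<open>t\<close> is needed to include it in an orthogonal
      basis.\<close>
    finally have tt: "g t t \<noteq> 0"
      using mem f by simp
    have te: "g t e = 0"
    proof -
      have "g t e = g y (e \<bullet> (e \<bullet> f))"
        by (simp add: t_def m_form m_comm)
      also have "\<dots> = g e e * g (a \<bullet> (v \<bullet> f)) f"
        using mem f by (simp add: sqA g_simps y_def)
      also have "g (a \<bullet> (v \<bullet> f)) f = g (v \<bullet> f) (a \<bullet> f)"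
        by (rule m_adjoint)
      finally show ?thesis
        using isometry'[OF mem(3) f(1)] orth by simp
    qed
    have tv: "g t v = 0"
    proof -
      have "g t v = g y (v \<bullet> (e \<bullet> f))"
        by (simp add: t_def m_form m_comm)
      also have "\<dots> = - g y (e \<bullet> (v \<bullet> f))"
        using anticomm[OF mem(1,3) orth(1), of f] f by (simp add: g_simps)
      also have "g y (e \<bullet> (v \<bullet> f)) = g ((v \<bullet> f) \<bullet> a) ((v \<bullet> f) \<bullet> e)"
        unfolding y_def by (simp only: m_comm[of _ "v \<bullet> f"])
      also have "\<dots> = g a ((v \<bullet> f) \<bullet> ((v \<bullet> f) \<bullet> e))"
        by (rule m_adjoint)
      also have "\<dots> = g a (g (v \<bullet> f) (v \<bullet> f) *s e)"
        using vf mem by (simp add: sqC)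
      finally show ?thesis
        using orth by (simp add: g_simps)
    qed
    have ta: "g t a = 0"
    proof -
      have "g t a = g (a \<bullet> (v \<bullet> f)) (a \<bullet> (e \<bullet> f))"
        by (simp only: t_def y_def m_form m_comm[of "e \<bullet> f" a])
      also have "\<dots> = g a a * g (v \<bullet> f) (e \<bullet> f)"
        using vf by (intro isometry mem) simp
      also have "g (v \<bullet> f) (e \<bullet> f) = g f f * g v e"
        by (rule isometry'[OF mem(3) f(1)])
      finally show ?thesis
        using orth by simp
    qed
    have "ortho {e, v, a, t}"
    proof -
      have "g e t = 0" "g v t = 0" "g a t = 0"
        using te tv ta by (simp_all only: g_sym[of e t] g_sym[of v t] g_sym[of a t])
      then show ?thesis
        using mem orth tt te tv ta by (simp add: ortho_def)
    qed
    moreover have "{e, v, a, t} \<subseteq> A"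
      using mem t by simp
    ultimately obtain E' where E': "{e, v, a, t} \<subseteq> E'" "ortho E'" "span E' = A" "card E' = n"
      using ortho_basis_extend[of A] by blast
    \<comment> \<open>Here the dimension has to exceed four: \<open>b\<close> is a further basis
      vector beyond these.\<close>
    have "card {e, v, a, t} \<le> 4"
      by (simp add: card_insert_if)
    then have "E' \<noteq> {e, v, a, t}"
      using E'(4) n by auto
    then obtain b where b: "b \<in> E'" "b \<notin> {e, v, a, t}"
      using E'(1) by blast
    have bA: "b \<in> A" "g b b \<noteq> 0" and gb: "g b e = 0" "g b v = 0" "g b a = 0" "g b t = 0"
      using b E' span_base by (auto simp: ortho_def)
    have gb': "g e b = 0" "g v b = 0" "g a b = 0"
      using gb g_sym by metis+
    have byC: "b \<bullet> y \<in> C"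
      using bA yB AB by simp
    define c where "c = f \<bullet> (b \<bullet> y)"
    have c: "c \<in> A"
      using BC f byC by (simp add: c_def)
    have gc: "g c x = g (b \<bullet> y) (x \<bullet> f)" for x
      by (simp add: c_def m_adjoint m_comm)
    have ce: "g c e = 0"
      using gb(4) by (simp add: gc m_form t_def)
    have ca: "g c a = 0"
    proof -
      have "b \<bullet> y = - (a \<bullet> (b \<bullet> (v \<bullet> f)))"
        using anticomm[OF mem(5) bA(1) gb'(3), of "v \<bullet> f"] vf by (simp add: y_def)
      then have "g c a = - (g a a * g (b \<bullet> (v \<bullet> f)) f)"
        using isometry[OF mem(5), of "b \<bullet> (v \<bullet> f)" f] AC[OF bA(1) vf] by (simp add: gc g_simps)
      also have "g (b \<bullet> (v \<bullet> f)) f = g (v \<bullet> f) (b \<bullet> f)"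
        by (rule m_adjoint)
      finally show ?thesis
        using isometry'[OF mem(3) f(1)] gb' by simp
    qed
    have cb: "g c b = 0"
    proof -
      have "g c b = g b b * g (a \<bullet> (v \<bullet> f)) f"
        using isometry[OF bA(1), of y f] yB by (simp add: gc y_def)
      also have "g (a \<bullet> (v \<bullet> f)) f = g (v \<bullet> f) (a \<bullet> f)"
        by (rule m_adjoint)
      finally show ?thesis
        using isometry'[OF mem(3) f(1)] orth by simp
    qed
    have "c \<bullet> f = g f f *s (b \<bullet> y)"
      using f byC by (simp add: c_def sqB m_comm[of _ f])
    \<comment> \<open>The factor \<open>c f\<close> contributes \<open>g f f\<close> times
      \<open>b y\<close>, and the repeated \<open>b\<close> and \<open>a\<close> contribute their
      squares. All three factors are nonzero.\<close>
    then have "e \<bullet> (a \<bullet> (b \<bullet> (c \<bullet> f))) = (g f f * g b b * g a a) *s (e \<bullet> (v \<bullet> f))"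
      using bA mem yB vf by (simp add: m_right sqA y_def)
    moreover have "g (e \<bullet> (a \<bullet> (b \<bullet> (c \<bullet> f)))) w = 0"
      using four[OF mem(1,5) bA(1) c orth(2) gb'(1) _ gb'(3)] ce ca cb
      by (simp only: g_sym[of e c] g_sym[of a c] g_sym[of b c])
    ultimately show ?thesis
      using f bA mem by (simp add: g_simps)
  qed
  then have "w = 0"
    using basis_B[OF E(1,2) f EA[OF e]] w by (intro ortho_eq_0[of "(\<lambda>x. e \<bullet> (x \<bullet> f)) ` E"]) auto
  then show ?thesis
    using tri_kernel_zero[OF T f] by (simp add: w_def)
qed

end

section \<open>Ideal decompositions and extension by zero\<close>

locale lie_split = lie_algebra L for L :: "('f::field, 'a::ab_group_add) lie" +
  fixes P M :: "'a set"
  assumes ideals: "lie_ideal P L" "lie_ideal M L"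
    and direct: "direct_sum2 P M (lcarrier L)"
begin

sublocale vs: vector_space "lsmult L" by (rule vector_space)

lemma ideal_sub: "vs.subspace P" "vs.subspace M" "P \<subseteq> lcarrier L" "M \<subseteq> lcarrier L"
  using ideals by (auto simp: lie_ideal_def)

lemma lie_algebra_P: "lie_algebra (L\<lparr>lcarrier := P\<rparr>)"
  using ideals(1) by (intro lie_algebra_restrict lie_algebra_axioms) (auto simp: lie_ideal_def)

lemma component_eq:
  assumes "p \<in> P" "x - p \<in> M"
  shows "component P M x = p"
  unfolding component_def
proof (rule the_equality)
  show "p \<in> P \<and> x - p \<in> M" using assms by simp
  fix p' assume p': "p' \<in> P \<and> x - p' \<in> M"
  have "p - p' \<in> P"
    using assms p' vs.subspace_diff[OF ideal_sub(1)] by blast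
  moreover have "p - p' = (x - p') - (x - p)" by simp
  then have "p - p' \<in> M"
    using assms p' vs.subspace_diff[OF ideal_sub(2)] by metis
  ultimately have "p - p' = 0"
    using direct unfolding direct_sum2_def by blast
  then show "p' = p" by simp
qed

lemma component_mem:
  assumes "x \<in> lcarrier L"
  shows "component P M x \<in> P" "x - component P M x \<in> M"
proof -
  obtain p q where "x = p + q" "p \<in> P" "q \<in> M"
    using direct assms unfolding direct_sum2_def by blast
  then show "component P M x \<in> P" "x - component P M x \<in> M"
    using component_eq[of p x] by simp_all
qed

lemma component_smult:
  assumes "x \<in> lcarrier L"
  shows "component P M (lsmult L c x) = lsmult L c (component P M x)"
  using component_mem[OF assms] vs.subspace_scale[OF ideal_sub(2), of "x - component P M x" c]
  by (intro component_eq vs.subspace_scale[OF ideal_sub(1)]) (simp_all add: vs.scale_right_diff_distrib)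

text \<open>The difference between the bracket of \<open>x\<close> and \<open>y\<close> and that of
  their \<open>P\<close> components is a sum of two brackets, each with one entry in the ideal
  \<open>M\<close>, hence lies in \<open>M\<close>.\<close>

lemma component_hom:
  assumes "x \<in> lcarrier L" "y \<in> lcarrier L"
  shows "component P M (x + y) = component P M x + component P M y"
    "component P M (lbracket L x y) = lbracket L (component P M x) (component P M y)"
proof -
  let ?c = "component P M"
  note mem = component_mem[OF assms(1)] component_mem[OF assms(2)]
  have L: "?c x \<in> lcarrier L" "?c y \<in> lcarrier L"
    using mem ideal_sub by auto
  have "x + y - (?c x + ?c y) = (x - ?c x) + (y - ?c y)" by simp
  then have "x + y - (?c x + ?c y) \<in> M"
    using mem vs.subspace_add[OF ideal_sub(2)] by metis
  then show "?c (x + y) = ?c x + ?c y"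
    using mem by (intro component_eq vs.subspace_add[OF ideal_sub(1)])
  have diffM: "y - ?c y \<in> lcarrier L" "x - ?c x \<in> lcarrier L"
    using mem ideal_sub by auto
  have "lbracket L x y = lbracket L x (?c y) + lbracket L x (y - ?c y)"
    using add_right[OF assms(1) L(2) diffM(1)] by simp
  also have "lbracket L x (?c y) = lbracket L (?c x) (?c y) + lbracket L (x - ?c x) (?c y)"
    using add_left[OF L(1) diffM(2) L(2)] by simp
  finally have eq: "lbracket L x y - lbracket L (?c x) (?c y)
      = lbracket L (x - ?c x) (?c y) + lbracket L x (y - ?c y)"
    by (simp add: algebra_simps)
  \<comment> \<open>Antisymmetry is derived from \<open>alternating\<close> by expanding the bracket
    of a sum with itself. It is needed because the member of \<open>M\<close> stands in the first
    argument.\<close>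
  have "lbracket L (x - ?c x) (?c y) = - lbracket L (?c y) (x - ?c x)"
  proof -
    let ?u = "x - ?c x" and ?v = "?c y"
    have uv: "?u + ?v \<in> lcarrier L"
      using diffM L vs.subspace_add[OF subspace] by blast
    have "0 = lbracket L (?u + ?v) (?u + ?v)"
      using alternating[OF uv] by simp
    also have "\<dots> = lbracket L ?u ?v + lbracket L ?v ?u"
      using add_left[OF diffM(2) L(2) uv] add_right[OF diffM(2) diffM(2) L(2)]
        add_right[OF L(2) diffM(2) L(2)] alternating[OF diffM(2)] alternating[OF L(2)] by simp
    finally show ?thesis
      by (simp add: eq_neg_iff_add_eq_0)
  qed
  then have "lbracket L (x - ?c x) (?c y) \<in> M"
    using ideals(2) mem L vs.subspace_neg[OF ideal_sub(2)] by (auto simp: lie_ideal_def)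
  moreover have "lbracket L x (y - ?c y) \<in> M"
    using ideals(2) mem assms by (auto simp: lie_ideal_def)
  ultimately have "lbracket L x y - lbracket L (?c x) (?c y) \<in> M"
    unfolding eq by (rule vs.subspace_add[OF ideal_sub(2)])
  moreover have "lbracket L (?c x) (?c y) \<in> P"
    using ideals(1) mem L by (auto simp: lie_ideal_def)
  ultimately show "?c (lbracket L x y) = lbracket L (?c x) (?c y)"
    by (intro component_eq)
qed

end

context sym_form
begin

section \<open>The stabiliser of an anisotropic vector in the orthogonal Lie algebra\<close>

definition perp :: "'v \<Rightarrow> 'v \<Rightarrow> 'v" where
  "perp e x = x - (g e x / g e e) *s e"

text \<open>Extends a skew map of the hyperplane orthogonal to \<open>e\<close> by zero on
  \<open>e\<close>, embedding its orthogonal Lie algebra as the stabiliser of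
  \<open>e\<close>.\<close>

definition ext :: "'v set \<Rightarrow> 'v \<Rightarrow> ('v \<Rightarrow> 'v) \<Rightarrow> 'v \<Rightarrow> 'v" where
  "ext A e f = (\<lambda>x. if x \<in> A then f (perp e x) else 0)"

context
  fixes e :: 'v and E :: "'v set" and A W :: "'v set"
  assumes E: "ortho (insert e E)" "e \<notin> E" and A: "A = span (insert e E)" and W: "W = span E"
begin

lemma ee: "g e e \<noteq> 0"
  using E by (simp add: ortho_def)

lemma subAW: "subspace A" "subspace W" "W \<subseteq> A" "e \<in> A"
  by (auto simp: A W span_base intro: set_mp[OF span_mono])

lemma gW: "x \<in> W \<Longrightarrow> g e x = 0"
proof -
  have "subspace {x. g e x = 0}"
    by (auto simp: subspace_def g_simps)
  then have "span E \<subseteq> {x. g e x = 0}"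
    using E by (intro span_minimal) (auto simp: ortho_def)
  then show "x \<in> W \<Longrightarrow> g e x = 0"
    by (auto simp: W)
qed

lemma W_iff: "x \<in> W \<longleftrightarrow> x \<in> A \<and> g e x = 0"
proof
  assume x: "x \<in> A \<and> g e x = 0"
  then have "x = (\<Sum>b\<in>insert e E. (g b x / g b b) *s b)"
    using ortho_expand[OF E(1)] A by simp
  also have "\<dots> = (\<Sum>b\<in>E. (g b x / g b b) *s b)"
    using x E by (simp add: ortho_def)
  finally show "x \<in> W"
    unfolding W by (metis (no_types, lifting) span_base span_scale span_sum)
qed (use gW subAW in auto)

lemma perp_mem: "x \<in> A \<Longrightarrow> perp e x \<in> W"
  using subAW ee by (auto simp: W_iff perp_def g_simps subspace_diff subspace_scale)

lemma perp_W: "x \<in> W \<Longrightarrow> perp e x = x"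
  by (simp add: perp_def gW)

lemma perp_hom: "perp e (x + y) = perp e x + perp e y" "perp e (c *s x) = c *s perp e x"
  by (simp_all add: perp_def g_simps add_divide_distrib scale_left_distrib scale_right_diff_distrib)

lemma ext_so:
  assumes f: "f \<in> so W"
  shows "ext A e f \<in> so A"
proof -
  have "g (f (perp e x)) y = - g x (f (perp e y))" if "x \<in> A" "y \<in> A" for x y
  proof -
    have fx: "f (perp e x) \<in> W" "f (perp e y) \<in> W"
      using that by (auto intro!: so_mem[OF f] perp_mem)
    have "g (f (perp e x)) y = g (f (perp e x)) (perp e y)"
      using gW[OF fx(1)] g_sym[of e "f (perp e x)"] by (simp add: perp_def[of e y] g_right)
    also have "\<dots> = - g (perp e x) (f (perp e y))"
      using that by (intro so_skew[OF f] perp_mem)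
    also have "\<dots> = - g x (f (perp e y))"
      using gW[OF fx(2)] by (simp add: perp_def[of e x] g_left)
    finally show ?thesis .
  qed
  then show ?thesis
    using subAW so_mem[OF f] perp_mem
    by (auto simp: so_iff ext_def perp_hom so_add[OF f] so_scale[OF f] subspace_add subspace_scale)
qed

lemma ext_e: "f \<in> so W \<Longrightarrow> ext A e f e = 0"
  using ee by (simp add: ext_def perp_def so_zero)

lemma ext_bracket:
  assumes f: "f \<in> so W" and h: "h \<in> so W"
  shows "ext A e (lbracket (so_lie scale g W) f h) = lbracket (so_lie scale g A) (ext A e f) (ext A e h)"
proof
  fix x
  have "perp e 0 = 0" by (simp add: perp_def g_simps)
  then show "ext A e (lbracket (so_lie scale g W) f h) x =
      lbracket (so_lie scale g A) (ext A e f) (ext A e h) x"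
    using so_mem[OF f perp_mem] so_mem[OF h perp_mem] subAW
    by (auto simp: ext_def lbracket_so_lie perp_W so_zero[OF f] so_zero[OF h] subspace_0)
qed

lemma ext_eq:
  assumes "f \<in> so W" "h \<in> so W" "ext A e f = ext A e h"
  shows "f = h"
proof
  fix x show "f x = h x"
    using fun_cong[OF assms(3), of x] subAW so_outside[OF assms(1)] so_outside[OF assms(2)]
    by (cases "x \<in> W") (auto simp: ext_def perp_W)
qed

text \<open>A skew map killing \<open>e\<close> preserves the orthogonal complement of
  \<open>e\<close>, so it is the extension of its restriction.\<close>

lemma ext_surj:
  assumes h: "h \<in> so A" "h e = 0"
  obtains f where "f \<in> so W" "ext A e f = h"
proof -
  let ?f = "\<lambda>x. if x \<in> W then h x else 0"
  have hW: "h x \<in> W" if "x \<in> W" for x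
    using that so_mem[OF h(1)] so_skew[OF h(1), of e x] h(2) subAW by (auto simp: W_iff g_simps)
  have "?f \<in> so W"
    using subAW hW so_add[OF h(1)] so_scale[OF h(1)] so_skew[OF h(1)]
    by (auto simp: so_iff subspace_add subspace_scale subset_iff)
  moreover have "ext A e ?f = h"
  proof
    fix x
    show "ext A e ?f x = h x"
    proof (cases "x \<in> A")
      case True
      then have "h (perp e x) = h x - (g e x / g e e) *s h e"
        using subAW by (simp add: perp_def so_diff[OF h(1)] so_scale[OF h(1)] subspace_scale)
      then show ?thesis
        using True h(2) perp_mem by (simp add: ext_def)
    next
      case False
      then show ?thesis
        using so_outside[OF h(1)] by (simp add: ext_def)
    qed
  qed
  ultimately show thesis by (rule that)
qed

end

end

section \<open>Dimension four: chirality\<close>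

locale quaternionic_triple = composition_triple scale g m A B C n
  for scale :: "'f::field_char_0 \<Rightarrow> 'v::ab_group_add \<Rightarrow> 'v" (infixr "*s" 75)
    and g :: "'v \<Rightarrow> 'v \<Rightarrow> 'f" and m :: "'v \<Rightarrow> 'v \<Rightarrow> 'v" (infixl "\<bullet>" 76) and A B C n +
  assumes n: "n = 4"
begin

lemma quaternionic_triple_swap: "quaternionic_triple scale g m B A C n" "quaternionic_triple scale g m A C B n"
  using trip_swap composition_triple.trip_rotate[OF trip_swap] n
  by (auto simp: quaternionic_triple_def quaternionic_triple_axioms_def)

lemma quaternionic_triple_rotate: "quaternionic_triple scale g m B C A n"
  using trip_rotate n by (auto simp: quaternionic_triple_def quaternionic_triple_axioms_def)

text \<open>The product of all four basis vectors is the Clifford volume element. It commutes with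
  even products, which fill \<open>B\<close> from a single \<open>f\<close>, so it suffices that
  \<open>f\<close> is an eigenvector. It anticommutes with vectors, whence the opposite sign on
  \<open>C\<close>.\<close>

lemma quad_scalar:
  assumes E: "ortho {a, b, c, d}" "card {a, b, c, d} = 4" "{a, b, c, d} \<subseteq> A"
  obtains \<kappa> where "\<kappa> \<noteq> 0" "\<And>y. y \<in> B \<Longrightarrow> a \<bullet> (b \<bullet> (c \<bullet> (d \<bullet> y))) = \<kappa> *s y"
    "\<And>z. z \<in> C \<Longrightarrow> a \<bullet> (b \<bullet> (c \<bullet> (d \<bullet> z))) = - \<kappa> *s z"
proof -
  let ?E = "{a, b, c, d}"
  have span: "span ?E = A"
    using E n by (intro ortho_spans) auto
  have ne: "a \<noteq> b" "a \<noteq> c" "a \<noteq> d" "b \<noteq> c" "b \<noteq> d" "c \<noteq> d"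
    using E(2) by (auto simp: card_insert_if split: if_splits)
  have mem: "a \<in> A" "b \<in> A" "c \<in> A" "d \<in> A"
    using E by auto
  have nz: "g a a \<noteq> 0" "g b b \<noteq> 0" "g c c \<noteq> 0" "g d d \<noteq> 0"
    and orth: "g a b = 0" "g a c = 0" "g a d = 0" "g b c = 0" "g b d = 0" "g c d = 0"
    using E(1) ne by (auto simp: ortho_def)
  obtain f where f: "f \<in> B" "g f f \<noteq> 0"
    using anisotropic[of B] by blast
  define H where "H = B \<union> C"
  have H: "x \<bullet> y \<in> H" if "x \<in> {a, b, c, d}" "y \<in> H" for x y
    using that mem AH by (auto simp: H_def)
  have H': "a \<bullet> y \<in> H" "b \<bullet> y \<in> H" "c \<bullet> y \<in> H" "d \<bullet> y \<in> H" if "y \<in> H" for y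
    using H that by auto
  have ac: "b \<bullet> (a \<bullet> y) = - (a \<bullet> (b \<bullet> y))" "c \<bullet> (a \<bullet> y) = - (a \<bullet> (c \<bullet> y))"
    "d \<bullet> (a \<bullet> y) = - (a \<bullet> (d \<bullet> y))" "c \<bullet> (b \<bullet> y) = - (b \<bullet> (c \<bullet> y))"
    "d \<bullet> (b \<bullet> y) = - (b \<bullet> (d \<bullet> y))" "d \<bullet> (c \<bullet> y) = - (c \<bullet> (d \<bullet> y))" if "y \<in> H" for y
    using that mem orth anticomm unfolding H_def by blast+
  have sq: "a \<bullet> (a \<bullet> y) = g a a *s y" "b \<bullet> (b \<bullet> y) = g b b *s y" "c \<bullet> (c \<bullet> y) = g c c *s y"
    "d \<bullet> (d \<bullet> y) = g d d *s y" if "y \<in> H" for y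
    using that mem sqA unfolding H_def by blast+
  have sq': "g (a \<bullet> x) (a \<bullet> y) = g a a * g x y" "g (b \<bullet> x) (b \<bullet> y) = g b b * g x y"
    "g (c \<bullet> x) (c \<bullet> y) = g c c * g x y" "g (d \<bullet> x) (d \<bullet> y) = g d d * g x y" if "x \<in> H" for x y
    using that mem isometry unfolding H_def by blast+
  have fH: "f \<in> H" using f by (simp add: H_def)
  have xf: "g (x \<bullet> f) (y \<bullet> f) = g f f * g x y" if "x \<in> {a, b, c, d}" for x y
    using isometry'[of x f y] that mem f(1) by blast
  let ?w = "\<lambda>y. a \<bullet> (b \<bullet> (c \<bullet> (d \<bullet> y)))"
  have wB: "?w y \<in> B" if "y \<in> B" for y
    using that mem AB AC by blast
  define \<kappa> where "\<kappa> = g f (?w f) / g f f"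
  let ?F = "(\<lambda>x. a \<bullet> (x \<bullet> f)) ` ?E"
  have F: "ortho ?F" "span ?F = B"
    using basis_B[OF E(1) span f mem(1) nz(1)] .
  \<comment> \<open>Paired with \<open>a (x f)\<close> for \<open>x\<close> among \<open>b\<close>,
    \<open>c\<close>, \<open>d\<close>, the fourfold product loses \<open>a\<close> and
    \<open>x\<close>. The two remaining orthogonal vectors send \<open>f\<close> to orthogonal
    vectors of \<open>C\<close>. Only \<open>x = a\<close>, the direction of \<open>f\<close>,
    survives.\<close>
  have wf: "?w f = \<kappa> *s f"
  proof -
    have "?w f - \<kappa> *s f = 0"
    proof (rule ortho_eq_0[OF F(1)])
      show "?w f - \<kappa> *s f \<in> span ?F"
        unfolding F(2) using wB f sub by (simp add: subspace_diff subspace_scale)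
      have "g (a \<bullet> (b \<bullet> f)) (?w f) = 0"
      proof -
        have "g (a \<bullet> (b \<bullet> f)) (?w f) = g a a * (g b b * g f (c \<bullet> (d \<bullet> f)))"
          using fH by (simp only: sq' H')
        also have "g f (c \<bullet> (d \<bullet> f)) = g (c \<bullet> f) (d \<bullet> f)"
          by (rule m_adjoint[symmetric])
        finally show ?thesis using orth by (simp add: xf)
      qed
      moreover have "g (a \<bullet> (c \<bullet> f)) (?w f) = 0"
      proof -
        have "?w f = - (a \<bullet> (c \<bullet> (b \<bullet> (d \<bullet> f))))"
          using ac(4)[of "d \<bullet> f"] fH H' by (simp add: m_right)
        then have "g (a \<bullet> (c \<bullet> f)) (?w f) = - (g a a * (g c c * g f (b \<bullet> (d \<bullet> f))))"
          using fH by (simp add: sq' H' g_simps)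
        also have "g f (b \<bullet> (d \<bullet> f)) = g (b \<bullet> f) (d \<bullet> f)"
          by (rule m_adjoint[symmetric])
        finally show ?thesis using orth by (simp add: xf)
      qed
      moreover have "g (a \<bullet> (d \<bullet> f)) (?w f) = 0"
      proof -
        have "?w f = a \<bullet> (d \<bullet> (b \<bullet> (c \<bullet> f)))"
          using fH H' by (simp add: ac m_right)
        then have "g (a \<bullet> (d \<bullet> f)) (?w f) = g a a * (g d d * g f (b \<bullet> (c \<bullet> f)))"
          using fH by (simp add: sq' H')
        also have "g f (b \<bullet> (c \<bullet> f)) = g (b \<bullet> f) (c \<bullet> f)"
          by (rule m_adjoint[symmetric])
        finally show ?thesis using orth by (simp add: xf)
      qed
      moreover have "g (a \<bullet> (x \<bullet> f)) f = 0" if "x \<in> {b, c, d}" for x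
      proof -
        have "g (a \<bullet> (x \<bullet> f)) f = g (x \<bullet> f) (a \<bullet> f)"
          by (rule m_adjoint)
        also have "\<dots> = g f f * g x a"
          using that by (intro xf) auto
        finally show ?thesis using that orth g_sym[of x a] by auto
      qed
      moreover have "g (a \<bullet> (a \<bullet> f)) (?w f - \<kappa> *s f) = 0"
        using f(2) fH by (simp add: sq g_simps \<kappa>_def)
      ultimately have "g (a \<bullet> (x \<bullet> f)) (?w f - \<kappa> *s f) = 0" if "x \<in> ?E" for x
        using that by (elim insertE emptyE) (simp_all only: g_right insert_iff simp_thms, simp_all)
      then show "g x (?w f - \<kappa> *s f) = 0" if "x \<in> ?F" for x
        using that by blast
    qed
    then show ?thesis by simp
  qed
  have "\<kappa> \<noteq> 0"
  proof
    assume "\<kappa> = 0"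
    then have "g (?w f) (?w f) = 0"
      unfolding wf by (simp add: g_simps)
    then show False
      using fH f(2) nz by (simp add: sq' H')
  qed
  \<comment> \<open>Each basis vector anticommutes with the product of all four, so two of them pass
    through without a sign.\<close>
  have comm: "?w (a \<bullet> (x \<bullet> f)) = a \<bullet> (x \<bullet> ?w f)" if "x \<in> ?E" for x
    using that fH by (auto simp: ac sq H' m_right mult.commute mult.left_commute)
  have B: "?w y = \<kappa> *s y" if "y \<in> B" for y
  proof -
    have "subspace {y. ?w y = \<kappa> *s y}"
      by (auto simp: subspace_def m_right scale_right_distrib)
    moreover have "?F \<subseteq> {y. ?w y = \<kappa> *s y}"
      using comm by (auto simp: wf m_right)
    ultimately have "span ?F \<subseteq> {y. ?w y = \<kappa> *s y}"
      by (intro span_minimal)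
    then show ?thesis using that F(2) by blast
  qed
  moreover have "?w z = - \<kappa> *s z" if "z \<in> C" for z
  proof -
    have az: "a \<bullet> z \<in> B" using AC mem that by blast
    have zH: "z \<in> H" using that by (simp add: H_def)
    \<comment> \<open>A single vector costs one sign. As \<open>a z\<close> lies in
      \<open>B\<close>, this transfers the scalar to \<open>C\<close> with the sign
      reversed.\<close>
    have "?w (a \<bullet> (a \<bullet> z)) = - (a \<bullet> ?w (a \<bullet> z))"
      using zH by (simp add: ac sq H' m_right)
    then have "g a a *s ?w z = g a a *s (- \<kappa> *s z)"
      using zH by (simp add: B[OF az] sq m_right mult.commute)
    then show ?thesis
      using nz(1) by (simp only: scale_cancel_left simp_thms)
  qed
  ultimately show thesis
    using that \<open>\<kappa> \<noteq> 0\<close> by blast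
qed

end

context prod_form
begin

text \<open>Permuting the slots moves the zero to the last one, so both chiralities can be described
  in the same \<open>tri A B C\<close>.\<close>

lemma Ann_iff: "p \<in> Ann A C B \<longleftrightarrow> (\<exists>q. (p, q, 0) \<in> tri A B C)"
  unfolding Ann_def using tri_swap tri_rotate by blast

end

section \<open>Ideals of rotations extending to a triple with a zero slot\<close>

context composition_triple
begin

lemma Ann_so: "Ann A B C \<subseteq> so A"
  using tri_so(1) by (auto simp: Ann_def)

lemma Ann_subspace: "fn.subspace (Ann A B C)"
proof (rule fn.subspaceI)
  show "0 \<in> Ann A B C"
    using tri_zero by (auto simp: Ann_def)
  fix p p' assume p: "p \<in> Ann A B C"
  then obtain s where s: "(p, 0, s) \<in> tri A B C" by (auto simp: Ann_def)
  show "(\<lambda>x. c *s p x) \<in> Ann A B C" for c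
    using tri_scale[OF s, of c] by (auto simp: Ann_def zero_fun_def)
  assume "p' \<in> Ann A B C"
  then obtain s' where "(p', 0, s') \<in> tri A B C" by (auto simp: Ann_def)
  from tri_add[OF s this] show "p + p' \<in> Ann A B C"
    by (auto simp: Ann_def)
qed

lemma bracket_zero: "f \<in> so S \<Longrightarrow> lbracket (so_lie scale g S) f 0 = 0"
  "f \<in> so S \<Longrightarrow> lbracket (so_lie scale g S) 0 f = 0"
  by (simp_all add: fun_eq_iff lbracket_so_lie so_zero)

text \<open>Every \<open>f\<close> in \<open>so A\<close> extends to a full triple, whose bracket
  with \<open>(p, 0, s)\<close> keeps the zero in the middle.\<close>

lemma Ann_ideal: "lie_ideal (Ann A B C) (so_lie scale g A)"
  unfolding lie_ideal_def lsmult_so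
proof (intro conjI ballI Ann_subspace Ann_so)
  fix f p assume "f \<in> so A" "p \<in> Ann A B C"
  then obtain q r s where T: "(f, q, r) \<in> tri A B C" and "(p, 0, s) \<in> tri A B C"
    using tri_surj unfolding Ann_def by blast
  from tri_bracket[OF this] show "lbracket (so_lie scale g A) f p \<in> Ann A B C"
    using tri_so(2)[OF T] by (auto simp: Ann_def bracket_zero)
qed

text \<open>The bracket of \<open>(p, 0, s)\<close> with \<open>(h, q, 0)\<close> lives in the first
  slot alone, where \<open>tri_single\<close> kills it.\<close>

lemma Ann_commute:
  assumes "p \<in> Ann A B C" "h \<in> Ann A C B"
  shows "lbracket (so_lie scale g A) p h = 0"
proof -
  obtain q s where T: "(p, 0, s) \<in> tri A B C" "(h, q, 0) \<in> tri A B C"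
    using assms by (auto simp: Ann_iff[of h] Ann_def[of A B C])
  from tri_bracket[OF this] show ?thesis
    using tri_so(3)[OF T(1)] tri_so(2)[OF T(2)] by (intro tri_single) (simp add: bracket_zero)
qed

text \<open>After swapping the slots, the zero stands first and \<open>p\<close> is in the position
  to which \<open>tri_kernel_zero\<close> applies.\<close>

lemma Ann_eval:
  assumes "p \<in> Ann A B C" "e \<in> A" "g e e \<noteq> 0" "p e = 0"
  shows "p = 0"
proof -
  interpret S: composition_triple scale g m B A C n by (rule trip_swap)
  obtain s where "(p, 0, s) \<in> tri A B C"
    using assms by (auto simp: Ann_def)
  then show ?thesis
    using S.tri_kernel_zero[OF tri_swap[of p 0 s A B C] assms(2,3,4)] by blast
qed

end

context quaternionic_triple
begin

lemma wedge_Ann: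
  assumes E: "ortho {a, b, c, d}" "card {a, b, c, d} = 4" "{a, b, c, d} \<subseteq> A"
  obtains \<mu> where "wedge A a b + (\<lambda>x. \<mu> *s wedge A c d x) \<in> Ann A B C"
    "wedge A a b - (\<lambda>x. \<mu> *s wedge A c d x) \<in> Ann A C B"
proof -
  obtain \<kappa> where \<kappa>: "\<kappa> \<noteq> 0" "\<And>y. y \<in> B \<Longrightarrow> a \<bullet> (b \<bullet> (c \<bullet> (d \<bullet> y))) = \<kappa> *s y"
    "\<And>z. z \<in> C \<Longrightarrow> a \<bullet> (b \<bullet> (c \<bullet> (d \<bullet> z))) = - \<kappa> *s z"
    using quad_scalar[OF E] by blast
  have ne: "a \<noteq> b" "c \<noteq> d"
    using E(2) by (auto simp: card_insert_if split: if_splits)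
  have mem: "a \<in> A" "b \<in> A" "c \<in> A" "d \<in> A"
    using E by auto
  have orth: "g a b = 0" "g c d = 0"
    using E(1) ne by (auto simp: ortho_def)
  \<comment> \<open>Multiplying \<open>a b c d = \<kappa>\<close> by \<open>b a\<close> from the
    left gives \<open>a b = - \<mu> c d\<close> on \<open>B\<close>. On \<open>C\<close> the scalar
    is \<open>- \<kappa>\<close>, so there \<open>a b = \<mu> c d\<close>.\<close>
  define \<mu> where "\<mu> = g a a * g b b / \<kappa>"
  have rel: "k *s (a \<bullet> (b \<bullet> y)) = - (g a a * g b b) *s (c \<bullet> (d \<bullet> y))"
    if "y \<in> B \<union> C" and k: "a \<bullet> (b \<bullet> (c \<bullet> (d \<bullet> y))) = k *s y" for y k
  proof -
    have H: "c \<bullet> (d \<bullet> y) \<in> B \<union> C" "b \<bullet> (c \<bullet> (d \<bullet> y)) \<in> B \<union> C"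
      using that(1) AH mem by blast+
    have "k *s (a \<bullet> (b \<bullet> y)) = - (b \<bullet> (a \<bullet> (k *s y)))"
      using anticomm[OF mem(1,2) orth(1) that(1)] by (simp add: m_right)
    also have "\<dots> = - (b \<bullet> (a \<bullet> (a \<bullet> (b \<bullet> (c \<bullet> (d \<bullet> y))))))"
      by (simp only: k)
    also have "\<dots> = - (g a a * g b b) *s (c \<bullet> (d \<bullet> y))"
      using mem H by (simp add: sqA m_right)
    finally show ?thesis .
  qed
  have opB: "opr B a b + (\<lambda>x. \<mu> *s opr B c d x) = 0"
  proof
    fix y show "(opr B a b + (\<lambda>x. \<mu> *s opr B c d x)) y = 0 y"
    proof (cases "y \<in> B")
      case True
      then have "\<kappa> *s (a \<bullet> (b \<bullet> y) + \<mu> *s (c \<bullet> (d \<bullet> y))) = 0"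
        using rel[OF _ \<kappa>(2)] \<kappa>(1) by (simp add: scale_right_distrib \<mu>_def)
      then show ?thesis using True \<kappa>(1) by (simp add: opr_def)
    qed (simp add: opr_def)
  qed
  have opC: "opr C a b - (\<lambda>x. \<mu> *s opr C c d x) = 0"
  proof
    fix y show "(opr C a b - (\<lambda>x. \<mu> *s opr C c d x)) y = 0 y"
    proof (cases "y \<in> C")
      case True
      then have "\<kappa> *s (a \<bullet> (b \<bullet> y) - \<mu> *s (c \<bullet> (d \<bullet> y))) = 0"
        using rel[OF _ \<kappa>(3)] \<kappa>(1) by (simp add: scale_right_diff_distrib \<mu>_def)
      then show ?thesis using True \<kappa>(1) by (simp add: opr_def)
    qed (simp add: opr_def)
  qed
  note T1 = tri_wedge[OF mem(1,2) orth(1)] and T2 = tri_wedge[OF mem(3,4) orth(2)]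
  show thesis
  proof
    have eq: "(\<lambda>x. (1 / 2) *s ((\<lambda>x. 2 *s wedge A a b x) + (\<lambda>x. \<mu> *s (2 *s wedge A c d x))) x)
        = wedge A a b + (\<lambda>x. \<mu> *s wedge A c d x)"
      "(\<lambda>x. (1 / 2) *s ((\<lambda>x. 2 *s wedge A a b x) - (\<lambda>x. \<mu> *s (2 *s wedge A c d x))) x)
        = wedge A a b - (\<lambda>x. \<mu> *s wedge A c d x)"
      by (simp_all add: fun_eq_iff scale_right_distrib scale_right_diff_distrib mult.commute)
    show "wedge A a b + (\<lambda>x. \<mu> *s wedge A c d x) \<in> Ann A B C"
      using tri_scale[OF tri_add[OF T1 tri_scale[OF T2, of \<mu>]], of "1 / 2"]
      unfolding eq opB by (auto simp: Ann_def zero_fun_def)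
    show "wedge A a b - (\<lambda>x. \<mu> *s wedge A c d x) \<in> Ann A C B"
      using tri_scale[OF tri_diff[OF T1 tri_scale[OF T2, of \<mu>]], of "1 / 2"]
      unfolding eq opC by (auto simp: Ann_iff zero_fun_def)
  qed
qed

lemma complement_pair:
  assumes "card E = 4" "a \<in> E" "b \<in> E" "a \<noteq> b"
  obtains c d where "E = {a, b, c, d}" "c \<notin> {a, b}" "d \<notin> {a, b}" "c \<noteq> d"
proof -
  have "card (E - {a, b}) = 2"
    using assms by (simp add: card_Diff_subset)
  then obtain c d where "E - {a, b} = {c, d}" "c \<noteq> d"
    by (auto simp: card_2_iff)
  then show thesis
    using that[of c d] assms(2,3) by blast
qed

lemma Ann_sum: "so A = {p + q |p q. p \<in> Ann A B C \<and> q \<in> Ann A C B}"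
proof (rule antisym)
  interpret S: quaternionic_triple scale g m A C B n by (rule quaternionic_triple_swap)
  obtain E where E: "ortho E" "span E = A" "card E = n"
    using ortho_basis[of A] by blast
  let ?S = "{p + q |p q. p \<in> Ann A B C \<and> q \<in> Ann A C B}"
  have card: "card E = 4" using E(3) n by simp
  have "wedge A a b \<in> ?S" if ab: "a \<in> E" "b \<in> E" "a \<noteq> b" for a b
  proof -
    from complement_pair[OF card ab] obtain c d where cd: "E = {a, b, c, d}"
      by blast
    then have "{a, b, c, d} \<subseteq> A" "ortho {a, b, c, d}" "card {a, b, c, d} = 4"
      using E n span_base by auto
    then obtain \<mu> where \<mu>: "wedge A a b + (\<lambda>x. \<mu> *s wedge A c d x) \<in> Ann A B C" (is "?p \<in> _")
      "wedge A a b - (\<lambda>x. \<mu> *s wedge A c d x) \<in> Ann A C B" (is "?q \<in> _")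
      using wedge_Ann by metis
    \<comment> \<open>The rotations in the orthogonal plane cancel, so every coordinate rotation is
      half the sum of its two chiral combinations.\<close>
    have "wedge A a b = (\<lambda>x. (1/2) *s ?p x) + (\<lambda>x. (1/2) *s ?q x)"
      using scale_left_distrib[of "1/2" "1/2"]
      by (simp add: fun_eq_iff scale_right_distrib scale_right_diff_distrib)
    then show ?thesis
      using fn.subspace_scale[OF Ann_subspace \<mu>(1), of "1/2"]
        fn.subspace_scale[OF S.Ann_subspace \<mu>(2), of "1/2"] by blast
  qed
  then have "fn.span {wedge A b c |b c. b \<in> E \<and> c \<in> E \<and> b \<noteq> c} \<subseteq> ?S"
    by (intro fn.span_minimal fn.subspace_sums Ann_subspace S.Ann_subspace) blast
  then show "so A \<subseteq> ?S"
    using so_span_wedge[OF E(1)] unfolding E(2) by simp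
  show "?S \<subseteq> so A"
    using Ann_so S.Ann_so fn.subspace_add[OF so_subspace[OF sub(1)]] by blast
qed

text \<open>A common member commutes with both ideals, hence with all of \<open>so A\<close>.
  Commuting with the rotations that kill \<open>e\<close> forces it to kill \<open>e\<close>, and
  \<open>Ann_eval\<close> applies.\<close>

lemma Ann_Int: "Ann A B C \<inter> Ann A C B = {0}"
proof -
  interpret S: quaternionic_triple scale g m A C B n by (rule quaternionic_triple_swap)
  have "p = 0" if p: "p \<in> Ann A B C" "p \<in> Ann A C B" for p
  proof -
    have pso: "p \<in> so A" using p Ann_so by blast
    have comm: "p (h x) = h (p x)" if "h \<in> so A" for h x
    proof -
      obtain h1 h2 where h: "h = h1 + h2" "h1 \<in> Ann A B C" "h2 \<in> Ann A C B"
        using \<open>h \<in> so A\<close> Ann_sum by blast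
      have "lbracket (so_lie scale g A) p h2 x = 0" "lbracket (so_lie scale g A) p h1 x = 0"
        using Ann_commute[OF p(1) h(3)] S.Ann_commute[OF p(2) h(2)] by simp_all
      then have eq: "p (h1 x) = h1 (p x)" "p (h2 x) = h2 (p x)"
        by (simp_all add: lbracket_so_lie)
      have so: "h1 \<in> so A" "h2 \<in> so A"
        using h Ann_so S.Ann_so by auto
      show ?thesis
      proof (cases "x \<in> A")
        case True
        then show ?thesis
          using so_mem[OF so(1)] so_mem[OF so(2)] by (simp add: h(1) so_add[OF pso] eq)
      next
        case False
        then show ?thesis
          using so_outside[OF so(1)] so_outside[OF so(2)] so_outside[OF pso]
          by (simp add: h(1) so_zero[OF pso] so_zero[OF so(1)] so_zero[OF so(2)])
      qed
    qed
    obtain E where E: "ortho E" "span E = A" "card E = n"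
      using ortho_basis[of A] by blast
    have EA: "x \<in> A" "g x x \<noteq> 0" if "x \<in> E" for x
      using that E span_base by (auto simp: ortho_def)
    have card: "card E = 4" using E(3) n by simp
    then obtain e where e: "e \<in> E"
      by fastforce
    have "p e = 0"
    proof (rule ortho_eq_0[OF E(1)])
      show "p e \<in> span E"
        using so_mem[OF pso] EA e E by simp
      fix c assume c: "c \<in> E"
      show "g c (p e) = 0"
      proof (cases "c = e")
        case True
        then show ?thesis using so_self[OF pso] EA e by simp
      next
        case False
        then have "e \<noteq> c" by simp
        from complement_pair[OF card e c this] obtain b d where b: "E = {e, c, b, d}" "b \<notin> {e, c}"
          by blast
        have bE: "b \<in> E" using b by blast
        have orth: "g c e = 0" "g b e = 0" "g b c = 0"
          using E(1) b c e bE False unfolding ortho_def by blast+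
        \<comment> \<open>This rotation kills \<open>e\<close> and commutes with \<open>p\<close>,
          so it also kills \<open>p e\<close>. Pairing the result with \<open>b\<close> isolates the
          coordinate \<open>g c (p e)\<close>.\<close>
        have "wedge A b c e = 0"
          using orth by (simp add: wedge_def)
        moreover have "wedge A b c \<in> so A"
          using EA bE c by (intro wedge_so sub)
        ultimately have "wedge A b c (p e) = 0"
          using comm[of "wedge A b c" e] so_zero[OF pso] by simp
        moreover have "p e \<in> A"
          using so_mem[OF pso] EA e by simp
        ultimately have "g b (g c (p e) *s b - g b (p e) *s c) = 0"
          by (simp add: wedge_def g_right)
        then show ?thesis
          using orth EA[OF bE] by (simp add: g_right)
      qed
    qed
    then show ?thesis
      using Ann_eval[OF p(1) EA[OF e]] by simp
  qed
  then show ?thesis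
    using fn.subspace_0[OF Ann_subspace] fn.subspace_0[OF S.Ann_subspace] by blast
qed

lemma Ann_direct: "direct_sum2 (Ann A B C) (Ann A C B) (so A)"
  using Ann_sum Ann_Int by (simp add: direct_sum2_def)

lemma lie_split_Ann: "lie_split (so_lie scale g A) (Ann A B C) (Ann A C B)"
proof -
  interpret S: quaternionic_triple scale g m A C B n by (rule quaternionic_triple_swap)
  show ?thesis
    by (intro lie_split.intro lie_split_axioms.intro so_lie_algebra sub Ann_ideal S.Ann_ideal Ann_direct)
qed

text \<open>Of a chiral combination containing \<open>wedge A e x\<close>, only that rotation moves
  \<open>e\<close>, and it sends \<open>e\<close> to a multiple of \<open>x\<close>.\<close>

lemma Ann_onto:
  assumes E: "ortho (insert e E)" "e \<notin> E" "A = span (insert e E)" and "w \<in> span E"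
  shows "\<exists>h\<in>Ann A C B. h e = w"
proof -
  interpret S: quaternionic_triple scale g m A C B n by (rule quaternionic_triple_swap)
  have card: "card (insert e E) = 4"
    using ortho_card[OF E(1)] spaces[of A] n unfolding E(3) by simp
  have ee: "g e e \<noteq> 0" "e \<in> A"
    using E by (auto simp: ortho_def span_base)
  have "fn.subspace (Ann A C B)" by (rule S.Ann_subspace)
  then have "subspace {w. \<exists>h\<in>Ann A C B. h e = w}"
    unfolding subspace_def fn.subspace_def by (auto simp: zero_fun_def plus_fun_def)
  moreover have "x \<in> {w. \<exists>h\<in>Ann A C B. h e = w}" if x: "x \<in> E" for x
  proof -
    have xe: "e \<in> insert e E" "x \<in> insert e E" "e \<noteq> x" using x E(2) by auto
    from complement_pair[OF card this]
    obtain c d where cd: "insert e E = {e, x, c, d}" "c \<notin> {e, x}" "d \<notin> {e, x}" "c \<noteq> d" .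
    have orth: "g x e = 0" "g c e = 0" "g d e = 0"
    proof -
      have *: "g y e = 0" if "y \<in> {e, x, c, d}" "y \<noteq> e" for y
        using E(1) that unfolding ortho_def cd(1) by blast
      show "g x e = 0" "g c e = 0" "g d e = 0"
        using *[of x] *[of c] *[of d] cd(2,3) xe(3) by auto
    qed
    have "insert e E \<subseteq> A"
      using E(3) span_superset[of "insert e E"] by simp
    from wedge_Ann[OF E(1)[unfolded cd(1)] card[unfolded cd(1)] this[unfolded cd(1)]]
    obtain \<mu> where "wedge A e x + (\<lambda>y. \<mu> *s wedge A c d y) \<in> Ann A B C"
      and \<mu>: "wedge A e x - (\<lambda>y. \<mu> *s wedge A c d y) \<in> Ann A C B" .
    \<comment> \<open>The factor normalises the value of \<open>wedge A e x\<close> at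
      \<open>e\<close>, which is \<open>x\<close> scaled by \<open>- g e e\<close>.\<close>
    let ?h = "\<lambda>y. (- 1 / g e e) *s (wedge A e x - (\<lambda>y. \<mu> *s wedge A c d y)) y"
    have "?h \<in> Ann A C B"
      by (rule fn.subspace_scale[OF S.Ann_subspace \<mu>])
    moreover have "?h e = x"
      using orth ee by (simp add: wedge_def)
    ultimately show ?thesis
      by (intro CollectI bexI[of _ ?h])
  qed
  ultimately have "span E \<subseteq> {w. \<exists>h\<in>Ann A C B. h e = w}"
    by (intro span_minimal subsetI)
  then show ?thesis using assms(4) by blast
qed

text \<open>The stabiliser of \<open>e\<close> sits diagonally in the two chiral ideals. Since a
  member of an ideal is determined by its value at \<open>e\<close>, and every vector orthogonal to
  \<open>e\<close> is such a value, projection of the stabiliser to one ideal is bijective.\<close>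

lemma Ann_iso:
  assumes E: "ortho (insert e E)" "e \<notin> E" "A = span (insert e E)"
  shows "lie_iso (\<lambda>f. component (Ann A B C) (Ann A C B) (ext A e f))
    (so_lie scale g (span E)) ((so_lie scale g A)\<lparr>lcarrier := Ann A B C\<rparr>)"
proof -
  interpret S: quaternionic_triple scale g m A C B n by (rule quaternionic_triple_swap)
  interpret X: lie_split "so_lie scale g A" "Ann A B C" "Ann A C B" by (rule lie_split_Ann)
  let ?c = "component (Ann A B C) (Ann A C B)"
  let ?W = "span E"
  have ee: "g e e \<noteq> 0" "e \<in> A"
    using E by (auto simp: ortho_def span_base)
  note ext_so' = ext_so[OF E refl] and ext_eq' = ext_eq[OF E refl] and ext_e' = ext_e[OF E refl]
  have add: "ext A e (f + h) = ext A e f + ext A e h" for f h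
    by (simp add: ext_def fun_eq_iff)
  have smult: "ext A e (\<lambda>x. c *s f x) = (\<lambda>x. c *s ext A e f x)" for c f
    by (simp add: ext_def fun_eq_iff)
  have "inj_on (\<lambda>f. ?c (ext A e f)) (so ?W)"
  proof (rule inj_onI)
    fix f h assume f: "f \<in> so ?W" and h: "h \<in> so ?W" and eq: "?c (ext A e f) = ?c (ext A e h)"
    \<comment> \<open>With equal components the difference lies in the other ideal. It also kills
      \<open>e\<close>, so it is zero.\<close>
    have "ext A e f - ext A e h = (ext A e f - ?c (ext A e f)) - (ext A e h - ?c (ext A e h))"
      using eq by simp
    also have "\<dots> \<in> Ann A C B"
      by (intro fn.subspace_diff S.Ann_subspace X.component_mem ext_so' f h)
    finally have "ext A e f - ext A e h = 0"
      using ext_e'[OF f] ext_e'[OF h] by (intro S.Ann_eval[OF _ ee(2,1)]) simp_all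
    then show "f = h"
      using ext_eq'[OF f h] by simp
  qed
  moreover have "(\<lambda>f. ?c (ext A e f)) ` so ?W = Ann A B C"
  proof (rule antisym)
    show "(\<lambda>f. ?c (ext A e f)) ` so ?W \<subseteq> Ann A B C"
      using X.component_mem(1) ext_so' by blast
    show "Ann A B C \<subseteq> (\<lambda>f. ?c (ext A e f)) ` so ?W"
    proof
      fix p assume p: "p \<in> Ann A B C"
      then have pso: "p \<in> so A" using Ann_so by blast
      have "p e \<in> ?W"
        using so_mem[OF pso ee(2)] so_self[OF pso ee(2)] W_iff[OF E refl] by blast
      \<comment> \<open>The unique partner of \<open>p\<close> in the other ideal that makes the sum
        kill \<open>e\<close>, so that the sum is an extension from the hyperplane.\<close>
      then obtain h where h: "h \<in> Ann A C B" "h e = - p e"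
        using Ann_onto[OF E] span_neg by blast
      have "p + h \<in> so A"
        using pso h(1) S.Ann_so fn.subspace_add[OF so_subspace[OF sub(1)]] by blast
      then obtain f where f: "f \<in> so ?W" "ext A e f = p + h"
        using ext_surj[OF E refl, of "p + h"] h(2) by (metis plus_fun_apply add.right_inverse)
      have "?c (ext A e f) = p"
        by (rule X.component_eq[OF p]) (simp add: f(2) h(1))
      then show "p \<in> (\<lambda>f. ?c (ext A e f)) ` so ?W"
        using f(1) by blast
    qed
  qed
  ultimately show ?thesis
    unfolding lie_iso_def bij_betw_def
    using X.component_hom X.component_smult ext_so' add smult ext_bracket[OF E refl]
    by (simp add: lsmult_so)
qed

lemma chirality:
  shows "\<forall>S\<in>{Ann A B C, Ann A C B}.
      lie_ideal S (so_lie scale g A) \<and>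
      lie_simple ((so_lie scale g A)\<lparr>lcarrier := S\<rparr>) \<and>
      lie_dim ((so_lie scale g A)\<lparr>lcarrier := S\<rparr>) = 3" (is ?thesis1)
    and "\<exists>W \<phi> \<psi>. subspace W \<and> W \<subseteq> A \<and> dim W = 3 \<and> nondegenerate_on g W \<and>
      lie_iso \<phi> (so_lie scale g W) ((so_lie scale g A)\<lparr>lcarrier := Ann A B C\<rparr>) \<and>
      lie_iso \<psi> (so_lie scale g W) ((so_lie scale g A)\<lparr>lcarrier := Ann A C B\<rparr>)" (is ?thesis2)
proof -
  interpret S: quaternionic_triple scale g m A C B n by (rule quaternionic_triple_swap)
  interpret X: lie_split "so_lie scale g A" "Ann A B C" "Ann A C B" by (rule lie_split_Ann)
  interpret Y: lie_split "so_lie scale g A" "Ann A C B" "Ann A B C" by (rule S.lie_split_Ann)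
  obtain E0 where E0: "ortho E0" "span E0 = A" "card E0 = n"
    using ortho_basis[of A] by blast
  then obtain e where "e \<in> E0" using n by fastforce
  \<comment> \<open>One hyperplane, orthogonal to \<open>e\<close>, serves both chiralities, because
    interchanging \<open>B\<close> and \<open>C\<close> does not affect \<open>A\<close>.\<close>
  define E where "E = E0 - {e}"
  have "insert e E = E0" using \<open>e \<in> E0\<close> by (auto simp: E_def)
  then have E: "ortho (insert e E)" "e \<notin> E" "A = span (insert e E)"
    using E0 by (auto simp: E_def)
  have oE: "ortho E" using E(1) ortho_subset by blast
  have cardE: "card E = 3"
    using \<open>e \<in> E0\<close> E0(1,3) n by (simp add: E_def ortho_def)
  note iso = Ann_iso[OF E] S.Ann_iso[OF E]
  have W: "lie_algebra (so_lie scale g (span E))"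
    by (rule so_lie_algebra) simp
  have "lie_dim (so_lie scale g (span E)) = 3"
    using so_dim[OF oE] cardE by simp
  then have "lie_dim ((so_lie scale g A)\<lparr>lcarrier := Ann A B C\<rparr>) = 3"
    "lie_dim ((so_lie scale g A)\<lparr>lcarrier := Ann A C B\<rparr>) = 3"
    using lie_iso_dim[OF W X.lie_algebra_P iso(1)] lie_iso_dim[OF W Y.lie_algebra_P iso(2)] by simp_all
  then show ?thesis1
    using lie_iso_simple[OF W X.lie_algebra_P iso(1) so3_simple[OF oE cardE]]
      lie_iso_simple[OF W Y.lie_algebra_P iso(2) so3_simple[OF oE cardE]] Ann_ideal S.Ann_ideal by simp
  have "dim (span E) = 3"
    using ortho_card[OF oE] cardE by simp
  then show ?thesis2
    using iso ortho_nondegenerate[OF oE] subAW(3)[OF E refl] subspace_span by blast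
qed

text \<open>Subtracting a triple \<open>(p, q', 0)\<close> leaves zero in the first slot, so
  \<open>r\<close> has the other chirality as well and lies in the trivial intersection.\<close>

lemma tri_chirality:
  assumes "(p, q, r) \<in> tri A B C" "p \<in> Ann A C B" "r \<in> Ann C B A"
  shows "r = 0"
proof -
  interpret R: quaternionic_triple scale g m C A B n
    by (rule quaternionic_triple.quaternionic_triple_rotate[OF quaternionic_triple_rotate])
  obtain q' where "(p, q', 0) \<in> tri A B C"
    using assms(2) by (auto simp: Ann_iff)
  from tri_diff[OF assms(1) this] have "(0, q - q', r) \<in> tri A B C"
    by simp
  then have "r \<in> Ann C A B"
    using tri_rotate unfolding Ann_def by blast
  then show ?thesis
    using R.Ann_Int assms(3) by blast
qed

end

section \<open>Isomorphisms out of the triality algebra\<close>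

context sym_form
begin

lemma so_line:
  assumes W: "subspace W" and dim: "lie_dim (so_lie scale g W) = 1" and J: "J \<in> so W" "J \<noteq> 0"
  shows "lie_iso (\<lambda>a. lsmult (so_lie scale g W) a J) lie_line (so_lie scale g W)"
    and "so W = range (\<lambda>a x. a *s J x)"
    and "lie_abelian (so_lie scale g W)"
proof -
  interpret L: lie_algebra "so_lie scale g W" by (rule so_lie_algebra[OF W])
  obtain B where B: "B \<subseteq> so W" "fn.independent B" "so W \<subseteq> fn.span B" "card B = 1"
    using fn.basis_exists[of "so W"] dim unfolding lie_dim_def lsmult_so by auto
  from B(4) obtain b where "B = {b}"
    by (rule card_1_singletonE)
  then have b: "so W \<subseteq> range (\<lambda>a x. a *s b x)"
    using B(3) by (simp add: fn.span_singleton)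
  show range: "so W = range (\<lambda>a x. a *s J x)"
  proof (rule antisym)
    show "range (\<lambda>a x. a *s J x) \<subseteq> so W"
      using fn.subspace_scale[OF so_subspace[OF W] J(1)] by blast
    obtain c where c: "J = (\<lambda>x. c *s b x)" using J b by blast
    then have "c \<noteq> 0" using J(2) by (auto simp: zero_fun_def)
    show "so W \<subseteq> range (\<lambda>a x. a *s J x)"
    proof
      fix f assume "f \<in> so W"
      then obtain d where "f = (\<lambda>x. d *s b x)" using b by blast
      then have "f = (\<lambda>x. (d / c) *s J x)"
        using \<open>c \<noteq> 0\<close> by (simp add: c)
      then show "f \<in> range (\<lambda>a x. a *s J x)" by blast
    qed
  qed
  have zero: "lbracket (so_lie scale g W) (\<lambda>x. a *s J x) (\<lambda>x. b *s J x) = 0" for a b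
    using L.smult_left[OF J(1) fn.subspace_scale[OF so_subspace[OF W] J(1), of b], of a]
      L.smult_right[OF J(1,1), of b] L.alternating[OF J(1)]
    by (simp add: lsmult_so fun_eq_iff)
  show "lie_abelian (so_lie scale g W)"
    unfolding lie_abelian_def range using zero by blast
  have "inj (\<lambda>a x. a *s J x)"
  proof (rule injI)
    fix a b assume eq: "(\<lambda>x. a *s J x) = (\<lambda>x. b *s J x)"
    obtain x where "J x \<noteq> 0" using J(2) by (auto simp: fun_eq_iff)
    with fun_cong[OF eq, of x] show "a = b" by simp
  qed
  then show "lie_iso (\<lambda>a. lsmult (so_lie scale g W) a J) lie_line (so_lie scale g W)"
    unfolding lie_iso_def bij_betw_def lsmult_so range
    by (simp add: lie_line_def zero scale_left_distrib fun_eq_iff)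
qed

end

context composition_triple
begin

lemma so_dim_n:
  assumes "S \<in> {A, B, C}"
  shows "lie_dim (so_lie scale g S) = n * (n - 1) div 2"
proof -
  obtain E where "ortho E" "span E = S" "card E = n"
    using ortho_basis[OF assms] .
  then show ?thesis
    using so_dim by metis
qed

text \<open>Combining the two given triples realises the third coefficient \<open>- (a + b)\<close>.
  Any other coefficient would leave a nonzero triple concentrated in one slot.\<close>

lemma tri_plane:
  assumes J: "(J1, 0, - J3) \<in> tri A B C" "(0, J2, - J3) \<in> tri A B C" "J3 \<noteq> 0"
  shows "((\<lambda>x. a *s J1 x), (\<lambda>x. b *s J2 x), (\<lambda>x. c *s J3 x)) \<in> tri A B C \<longleftrightarrow> a + b + c = 0"
proof -
  have sum: "((\<lambda>x. a *s J1 x), (\<lambda>x. b *s J2 x), (\<lambda>x. - (a + b) *s J3 x)) \<in> tri A B C"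
  proof -
    have "(\<lambda>x. a *s J1 x) + (\<lambda>x. b *s 0 x) = (\<lambda>x. a *s J1 x)"
      "(\<lambda>x. a *s 0 x) + (\<lambda>x. b *s J2 x) = (\<lambda>x. b *s J2 x)"
      "(\<lambda>x. a *s (- J3) x) + (\<lambda>x. b *s (- J3) x) = (\<lambda>x. - (a + b) *s J3 x)"
      by (simp_all add: fun_eq_iff scale_left_distrib scale_left_diff_distrib)
    then show ?thesis
      using tri_add[OF tri_scale[OF J(1), of a] tri_scale[OF J(2), of b]] by (simp only:)
  qed
  show ?thesis
  proof
    assume "((\<lambda>x. a *s J1 x), (\<lambda>x. b *s J2 x), (\<lambda>x. c *s J3 x)) \<in> tri A B C"
    from tri_diff[OF this sum]
    have "(0, 0, (\<lambda>x. c *s J3 x) - (\<lambda>x. - (a + b) *s J3 x)) \<in> tri A B C"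
      by simp
    moreover have "(\<lambda>x. c *s J3 x) - (\<lambda>x. - (a + b) *s J3 x) = (\<lambda>x. (a + b + c) *s J3 x)"
      by (simp add: fun_eq_iff scale_left_distrib scale_left_diff_distrib)
    ultimately have T: "(0, 0, \<lambda>x. (a + b + c) *s J3 x) \<in> tri A B C"
      by simp
    interpret R: composition_triple scale g m C A B n
      by (rule composition_triple.trip_rotate[OF trip_rotate])
    have "(\<lambda>x. (a + b + c) *s J3 x) = 0"
      using R.tri_single[OF tri_rotate[OF tri_rotate[OF T]]] .
    moreover obtain x where "J3 x \<noteq> 0" using J(3) by (auto simp: fun_eq_iff)
    ultimately show "a + b + c = 0"
      by (metis scale_eq_0_iff zero_fun_apply)
  next
    assume "a + b + c = 0"
    then have "- (a + b) = c" by (rule minus_unique)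
    then show "((\<lambda>x. a *s J1 x), (\<lambda>x. b *s J2 x), (\<lambda>x. c *s J3 x)) \<in> tri A B C"
      using sum by simp
  qed
qed

lemma bij_first_eight:
  assumes "n = 8"
  shows "bij_betw (\<lambda>(p, q, r). p) (tri A B C) (so A)"
proof (rule bij_betwI')
  fix u v assume uv: "u \<in> tri A B C" "v \<in> tri A B C"
  obtain p q r p' q' r' where [simp]: "u = (p, q, r)" "v = (p', q', r')"
    by (metis prod_cases3)
  have "q = q' \<and> r = r'" if "p = p'"
    using tri_eight[OF assms, of "q - q'" "r - r'"] tri_diff[of p q r p' q' r'] uv that by simp
  then show "(case u of (p, q, r) \<Rightarrow> p) = (case v of (p, q, r) \<Rightarrow> p) \<longleftrightarrow> u = v"
    by auto
next
  fix u assume "u \<in> tri A B C"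
  then show "(case u of (p, q, r) \<Rightarrow> p) \<in> so A"
    using tri_so(1) by (cases u) auto
next
  fix p assume "p \<in> so A"
  then obtain q r where "(p, q, r) \<in> tri A B C" using tri_surj by blast
  then show "\<exists>u\<in>tri A B C. p = (case u of (p, q, r) \<Rightarrow> p)"
    by (intro bexI[of _ "(p, q, r)"]) auto
qed

end

context quaternionic_triple
begin

text \<open>Each slot vanishes by \<open>tri_chirality\<close>, applied to one of the three
  rotations of the triple. This is injectivity of the projection to the remaining
  chiralities.\<close>

lemma tri_chiral_zero: "tri A B C \<inter> (Ann A C B \<times> Ann B A C \<times> Ann C B A) = {0}"
proof -
  interpret R1: quaternionic_triple scale g m B C A n by (rule quaternionic_triple_rotate)
  interpret R2: quaternionic_triple scale g m C A B n by (rule R1.quaternionic_triple_rotate)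
  interpret S: quaternionic_triple scale g m A C B n by (rule quaternionic_triple_swap)
  interpret S1: quaternionic_triple scale g m B A C n by (rule quaternionic_triple_swap)
  interpret S2: quaternionic_triple scale g m C B A n by (rule S1.quaternionic_triple_rotate[THEN quaternionic_triple.quaternionic_triple_rotate])
  have "p = 0 \<and> q = 0 \<and> r = 0"
    if T: "(p, q, r) \<in> tri A B C" and "p \<in> Ann A C B" "q \<in> Ann B A C" "r \<in> Ann C B A" for p q r
    using that tri_chirality[OF T] R1.tri_chirality[OF tri_rotate[OF T]]
      R2.tri_chirality[OF tri_rotate[OF tri_rotate[OF T]]] by blast
  moreover have "0 \<in> Ann A C B" "0 \<in> Ann B A C" "0 \<in> Ann C B A"
    using fn.subspace_0 S.Ann_subspace S1.Ann_subspace S2.Ann_subspace by blast+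
  ultimately show ?thesis
    using tri_zero by (auto simp: zero_prod_def)
qed

lemma tri_chiral_bij:
  "bij_betw (\<lambda>(p, q, r). (component (Ann A B C) (Ann A C B) p, component (Ann B C A) (Ann B A C) q,
      component (Ann C A B) (Ann C B A) r)) (tri A B C) (Ann A B C \<times> Ann B C A \<times> Ann C A B)"
  (is "bij_betw ?f _ _")
proof (rule bij_betwI')
  interpret R1: quaternionic_triple scale g m B C A n by (rule quaternionic_triple_rotate)
  interpret R2: quaternionic_triple scale g m C A B n by (rule R1.quaternionic_triple_rotate)
  interpret S: quaternionic_triple scale g m A C B n by (rule quaternionic_triple_swap)
  interpret S1: quaternionic_triple scale g m B A C n by (rule quaternionic_triple_swap)
  interpret S2: quaternionic_triple scale g m C B A n by (rule S1.quaternionic_triple_rotate[THEN quaternionic_triple.quaternionic_triple_rotate])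
  interpret X: lie_split "so_lie scale g A" "Ann A B C" "Ann A C B" by (rule lie_split_Ann)
  interpret X1: lie_split "so_lie scale g B" "Ann B C A" "Ann B A C" by (rule R1.lie_split_Ann)
  interpret X2: lie_split "so_lie scale g C" "Ann C A B" "Ann C B A" by (rule R2.lie_split_Ann)
  {
    fix u v assume uv: "u \<in> tri A B C" "v \<in> tri A B C"
    obtain p q r p' q' r' where [simp]: "u = (p, q, r)" "v = (p', q', r')"
      by (metis prod_cases3)
    note T = uv[simplified]
    have "u = v" if "?f u = ?f v"
    proof -
      have *: "x - y \<in> M" if "x - component P M x \<in> M" "y - component P M y \<in> M"
        "component P M x = component P M y" "fn.subspace M" for x y P M
        using fn.subspace_diff[OF that(4,1,2)] that(3) by simp
      have "p - p' \<in> Ann A C B"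
        by (rule *[OF X.component_mem(2)[OF tri_so(1)[OF T(1)]] X.component_mem(2)[OF tri_so(1)[OF T(2)]]
              _ S.Ann_subspace]) (use that in simp)
      moreover have "q - q' \<in> Ann B A C"
        by (rule *[OF X1.component_mem(2)[OF tri_so(2)[OF T(1)]] X1.component_mem(2)[OF tri_so(2)[OF T(2)]]
              _ S1.Ann_subspace]) (use that in simp)
      moreover have "r - r' \<in> Ann C B A"
        by (rule *[OF X2.component_mem(2)[OF tri_so(3)[OF T(1)]] X2.component_mem(2)[OF tri_so(3)[OF T(2)]]
              _ S2.Ann_subspace]) (use that in simp)
      ultimately have "(p - p', q - q', r - r') \<in> {0}"
        using tri_diff[OF T] tri_chiral_zero by blast
      then show ?thesis by (simp add: zero_prod_def)
    qed
    then show "?f u = ?f v \<longleftrightarrow> u = v" by blast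
  }
  {
    fix u assume u: "u \<in> tri A B C"
    then show "?f u \<in> Ann A B C \<times> Ann B C A \<times> Ann C A B"
      using tri_so X.component_mem(1) X1.component_mem(1) X2.component_mem(1) by (cases u) auto
  }
  {
    fix w assume "w \<in> Ann A B C \<times> Ann B C A \<times> Ann C A B"
    then obtain a b c where w: "w = (a, b, c)" and abc: "a \<in> Ann A B C" "b \<in> Ann B C A" "c \<in> Ann C A B"
      by auto
    \<comment> \<open>A preimage is the sum of three triples with one zero slot each. Every one
      carries a single prescribed entry, and its other nonzero slot has the chirality that the
      projection forgets.\<close>
    obtain r where r: "(a, 0, r) \<in> tri A B C"
      using abc(1) by (auto simp: Ann_def)
    obtain p where p: "(p, b, 0) \<in> tri A B C"
      using abc(2) unfolding Ann_iff by (blast dest: tri_swap)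
    obtain q where q: "(0, q, c) \<in> tri A B C"
      using abc(3) tri_rotate unfolding Ann_def by blast
    have M: "p \<in> Ann A C B" "q \<in> Ann B A C" "r \<in> Ann C B A"
      using p q r tri_swap tri_rotate unfolding Ann_def by blast+
    have "(a + p, b + q, c + r) \<in> tri A B C"
      using tri_add[OF tri_add[OF r p] q] by (simp add: add.commute)
    moreover have "?f (a + p, b + q, c + r) = w"
      using M by (simp add: w X.component_eq[OF abc(1)] X1.component_eq[OF abc(2)] X2.component_eq[OF abc(3)])
    ultimately show "\<exists>u\<in>tri A B C. w = ?f u" by metis
  }
qed

end

section \<open>Trialities as composition triples\<close>

context triality
begin

sublocale sym_form scale g
  by (intro sym_form.intro sym_form_axioms.intro vector_space_axioms g_linear g_sym)

lemma decompose:
  obtains x y z where "x \<in> V 1" "y \<in> V 2" "z \<in> V 3" "v = x + y + z"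
  using V_direct[of v] by auto

text \<open>A vector of \<open>V i\<close> orthogonal to \<open>V i\<close> is orthogonal to the
  other summands anyway, hence to the whole space.\<close>

lemma V_nondegenerate:
  assumes i: "i \<in> {1, 2, 3}"
  shows "nondegenerate_on g (V i)"
  unfolding nondegenerate_on_def
proof (intro ballI impI)
  fix x assume x: "x \<in> V i" "\<forall>y\<in>V i. g x y = 0"
  have V0: "g x y = 0" if "y \<in> V j" "j \<in> {1, 2, 3}" for y j
    using x V_orth[OF i that(2) _ x(1) that(1)] that by (cases "i = j") auto
  have "g x v = 0" for v
  proof -
    obtain a b c where "a \<in> V 1" "b \<in> V 2" "c \<in> V 3" "v = a + b + c" by (rule decompose)
    then show ?thesis
      using V0[of a 1] V0[of b 2] V0[of c 3] by (simp add: g_simps)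
  qed
  then show "x = 0"
    using g_nondeg by (simp add: nondegenerate_on_def)
qed

lemma ortho_UNIV:
  obtains E where "ortho E" "span E = UNIV"
proof -
  obtain B1 B2 B3 where B: "finite B1" "finite B2" "finite B3" "span B1 = V 1" "span B2 = V 2" "span B3 = V 3"
    using V_finite[of 1] V_finite[of 2] V_finite[of 3] by auto
  have "span (B1 \<union> B2 \<union> B3) = UNIV"
  proof -
    have "v \<in> span (B1 \<union> B2 \<union> B3)" for v
    proof -
      obtain x y z where v: "x \<in> V 1" "y \<in> V 2" "z \<in> V 3" "v = x + y + z" by (rule decompose)
      then have "x \<in> span (B1 \<union> B2 \<union> B3)" "y \<in> span (B1 \<union> B2 \<union> B3)" "z \<in> span (B1 \<union> B2 \<union> B3)"
        unfolding B(4-6)[symmetric] by (auto intro: set_mp[OF span_mono])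
      then show ?thesis unfolding v by (intro span_add)
    qed
    then show ?thesis by blast
  qed
  then show thesis
    using ortho_extend[of UNIV "B1 \<union> B2 \<union> B3" "{}"] B g_nondeg that
    by (auto simp: ortho_def)
qed

text \<open>This justifies the definite description: expansion in an orthogonal basis of the whole
  space represents the functional \<open>\<tau> x y\<close>, and nondegeneracy makes the
  representing vector unique.\<close>

lemma tri_prod: "g (tri_prod g \<tau> x y) z = \<tau> x y z"
proof -
  interpret t: Vector_Spaces.linear scale "(*)" "\<tau> x y" by (rule \<tau>_linear)
  obtain E where E: "ortho E" "span E = UNIV" by (rule ortho_UNIV)
  define w where "w = (\<Sum>b\<in>E. scale (\<tau> x y b / g b b) b)"
  have w: "\<tau> x y z = g w z" for z
  proof -
    have "\<tau> x y z = \<tau> x y (\<Sum>b\<in>E. scale (g b z / g b b) b)"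
      using ortho_expand[OF E(1)] E(2) by simp
    also have "\<dots> = g w z"
      by (simp add: t.sum t.scale w_def g_simps mult.commute)
    finally show ?thesis .
  qed
  have "tri_prod g \<tau> x y = w"
    unfolding tri_prod_def
  proof (rule the_equality)
    show "\<forall>z. \<tau> x y z = g w z" using w by simp
    fix w' assume "\<forall>z. \<tau> x y z = g w' z"
    then have "g w' z = g w z" for z using w by simp
    then show "w' = w"
      by (intro nondegenerate_eqI[OF g_nondeg]) auto
  qed
  then show ?thesis using w by simp
qed

lemma eq_by_form: "(\<And>z. g x z = g y z) \<Longrightarrow> x = y"
  by (rule nondegenerate_eqI[OF g_nondeg]) auto

sublocale prod_form scale g "tri_prod g \<tau>"
proof
  interpret t: Vector_Spaces.linear scale "(*)" "\<tau> x y" for x y by (rule \<tau>_linear)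
  fix x y z c
  show "tri_prod g \<tau> x y = tri_prod g \<tau> y x"
    by (rule eq_by_form) (simp only: tri_prod, rule \<tau>_sym12)
  show "tri_prod g \<tau> x (y + z) = tri_prod g \<tau> x y + tri_prod g \<tau> x z"
    by (rule eq_by_form) (simp add: tri_prod g_simps \<tau>_sym23[of x "y + z"] \<tau>_sym23[of x y] \<tau>_sym23[of x z] t.add)
  show "tri_prod g \<tau> x (scale c y) = scale c (tri_prod g \<tau> x y)"
    by (rule eq_by_form) (simp add: tri_prod g_simps \<tau>_sym23[of x "scale c y"] \<tau>_sym23[of x y] t.scale)
  show "g (tri_prod g \<tau> x y) z = g x (tri_prod g \<tau> y z)"
    unfolding tri_prod g_sym[of x] by (metis \<tau>_sym12 \<tau>_sym23)
qed

text \<open>Pairing the product with a vector of \<open>V i\<close> or \<open>V j\<close> repeats an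
  index in \<open>\<tau>\<close> and gives zero, so nondegeneracy on these summands leaves only the
  component in \<open>V k\<close>.\<close>

lemma prod_mem:
  assumes ijk: "{i, j, k} = {1, 2, 3}" and x: "x \<in> V i" and y: "y \<in> V j"
  shows "tri_prod g \<tau> x y \<in> V k"
proof -
  have mem: "i \<in> {1, 2, 3}" "j \<in> {1, 2, 3}" "k \<in> {1, 2, 3}"
    using ijk by blast+
  have ne: "i \<noteq> j" "j \<noteq> k" "i \<noteq> k"
    using ijk card_3_iff[of "{1, 2, 3 :: nat}"] by (auto simp: card_insert_if dest!: arg_cong[where f = card] split: if_splits)
  let ?w = "tri_prod g \<tau> x y"
  obtain f where f: "\<And>l. l \<in> {1, 2, 3} \<Longrightarrow> f l \<in> V l" "?w = f i + f j + f k"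
  proof -
    obtain a b c where abc: "a \<in> V 1" "b \<in> V 2" "c \<in> V 3" "?w = a + b + c" by (rule decompose)
    let ?f = "\<lambda>l. if l = 1 then a else if l = 2 then b else c"
    have "(\<Sum>l\<in>{i, j, k}. ?f l) = a + b + c"
      unfolding ijk by (simp add: add.assoc)
    then have "?w = ?f i + ?f j + ?f k"
      using ne by (simp add: abc(4) add.assoc)
    moreover have "?f l \<in> V l" if "l \<in> {1, 2, 3}" for l
      using that abc by auto
    ultimately show thesis
      by (intro that[of ?f])
  qed
  have "f l = 0" if l: "l \<in> {i, j}" for l
  proof -
    have lm: "l \<in> {1, 2, 3}" using l mem by blast
    have "g (f l) z = 0" if z: "z \<in> V l" for z
    proof -
      have "\<tau> x y z = 0"
        using l z \<tau>_vanish[OF mem(1,2) lm _ x y z] by blast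
      then have "g (f i) z + g (f j) z + g (f k) z = 0"
        using f(2) by (metis tri_prod g_left(1))
      moreover have o: "g (f l') z = 0" if "l' \<in> {1, 2, 3}" "l' \<noteq> l" for l'
        using V_orth[OF that(1) lm that(2) f(1)[OF that(1)] z] .
      have "g (f i) z = 0 \<or> l = i" "g (f j) z = 0 \<or> l = j" "g (f k) z = 0"
        using o[OF mem(1)] o[OF mem(2)] o[OF mem(3)] l ne(2,3) by blast+
      ultimately show ?thesis
        using ne(1) l by (elim insertE emptyE) simp_all
    qed
    then show ?thesis
      using V_nondegenerate[OF lm] f(1)[OF lm] by (simp add: nondegenerate_on_def)
  qed
  then have "?w = f k" using f(2) by simp
  then show ?thesis using f(1) mem(3) by simp
qed

lemma prod_sq:
  assumes i: "i \<in> {1, 2, 3}" and j: "j \<in> {1, 2, 3}" "j \<noteq> i" and "x \<in> V i" "y \<in> V j"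
  shows "tri_prod g \<tau> x (tri_prod g \<tau> x y) = scale (g x x) y"
proof -
  \<comment> \<open>The third index, as the indices sum to 6. The requirement on
    \<open>V i + V k\<close> is used with zero part in \<open>V k\<close>.\<close>
  define k where "k = 6 - i - j"
  have k: "k \<in> {1, 2, 3}" "j \<noteq> k" "i \<noteq> k"
    using i j by (auto simp: k_def)
  have "x \<in> {u + w |u w. u \<in> V i \<and> w \<in> V k}"
    using assms(4) subspace_0[OF V_subspace[OF k(1)]] by force
  then show ?thesis
    using prod_prod[OF i j(1) k(1) _ k(2,3) assms(5)] j(2) by blast
qed

lemma composition_triple: "n > 0 \<Longrightarrow> composition_triple scale g (tri_prod g \<tau>) (V 1) (V 2) (V 3) n"
proof (intro composition_triple.intro composition_triple_axioms.intro)
  show "prod_form scale g (tri_prod g \<tau>)" by (rule prod_form_axioms)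
  show "subspace S \<and> (\<exists>T. finite T \<and> span T = S) \<and> nondegenerate_on g S \<and> dim S = n"
    if "S \<in> {V 1, V 2, V 3}" for S
  proof -
    from that obtain i where i: "i \<in> {1, 2, 3}" and S: "S = V i" by blast
    show ?thesis
      unfolding S by (intro conjI V_subspace[OF i] V_finite[OF i] V_nondegenerate[OF i] V_dim[OF i])
  qed
  show "x \<in> V 1 \<Longrightarrow> y \<in> V 2 \<Longrightarrow> tri_prod g \<tau> x y \<in> V 3"
    "x \<in> V 1 \<Longrightarrow> y \<in> V 3 \<Longrightarrow> tri_prod g \<tau> x y \<in> V 2"
    "x \<in> V 2 \<Longrightarrow> y \<in> V 3 \<Longrightarrow> tri_prod g \<tau> x y \<in> V 1" for x y
    by (rule prod_mem, blast, assumption, assumption)+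
  show "x \<in> V 1 \<Longrightarrow> y \<in> V 2 \<union> V 3 \<Longrightarrow> tri_prod g \<tau> x (tri_prod g \<tau> x y) = scale (g x x) y" for x y
    using prod_sq[of 1 2 x y] prod_sq[of 1 3 x y] by auto
  show "x \<in> V 2 \<Longrightarrow> y \<in> V 1 \<union> V 3 \<Longrightarrow> tri_prod g \<tau> x (tri_prod g \<tau> x y) = scale (g x x) y" for x y
    using prod_sq[of 2 1 x y] prod_sq[of 2 3 x y] by auto
  show "x \<in> V 3 \<Longrightarrow> y \<in> V 1 \<union> V 2 \<Longrightarrow> tri_prod g \<tau> x (tri_prod g \<tau> x y) = scale (g x x) y" for x y
    using prod_sq[of 3 1 x y] prod_sq[of 3 2 x y] by auto
qed

lemma carrier_triality: "lcarrier (triality_lie scale g V \<tau>) = tri (V 1) (V 2) (V 3)"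
  by (simp add: triality_lie_def tri_def tri_prod)

lemma lsmult_triality: "lsmult (triality_lie scale g V \<tau>) c (p, q, r)
    = ((\<lambda>x. scale c (p x)), (\<lambda>x. scale c (q x)), (\<lambda>x. scale c (r x)))"
  by (simp add: triality_lie_def lie_sum3_def so_lie_def)

lemma lbracket_triality: "lbracket (triality_lie scale g V \<tau>) (p, q, r) (p', q', r')
    = (lbracket (so_lie scale g (V 1)) p p', lbracket (so_lie scale g (V 2)) q q',
       lbracket (so_lie scale g (V 3)) r r')"
  by (simp add: triality_lie_def lie_sum3_def)

end

context triality
begin

lemma triality_one:
  assumes "n = 1"
  shows "lcarrier (triality_lie scale g V \<tau>) = {0}"
proof -
  interpret T: composition_triple scale g "tri_prod g \<tau>" "V 1" "V 2" "V 3" n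
    using assms by (intro composition_triple) simp
  show ?thesis
    unfolding carrier_triality using T.tri_one[OF assms] T.tri_zero
    by (auto simp: zero_prod_def simp del: One_nat_def)
qed

lemma triality_two:
  assumes n: "n = 2"
  shows "\<forall>r\<in>{1, 2, 3}. lie_dim (so_lie scale g (V r)) = 1"
    and "\<exists>J :: nat \<Rightarrow> 'v \<Rightarrow> 'v.
           (\<forall>r\<in>{1, 2, 3}. lie_iso (\<lambda>a. lsmult (so_lie scale g (V r)) a (J r))
              lie_line (so_lie scale g (V r))) \<and>
           lie_iso
             (\<lambda>(a, b, c). (lsmult (so_lie scale g (V 1)) a (J 1),
                           lsmult (so_lie scale g (V 2)) b (J 2),
                           lsmult (so_lie scale g (V 3)) c (J 3)))
             lie_plane (triality_lie scale g V \<tau>)" (is "\<exists>J. ?lines J \<and> ?plane J")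
    and "lie_abelian (triality_lie scale g V \<tau>)"
    and "lie_dim (triality_lie scale g V \<tau>) = 2"
proof -
  interpret T: composition_triple scale g "tri_prod g \<tau>" "V 1" "V 2" "V 3" n
    using n by (intro composition_triple) simp
  show dim1: "\<forall>r\<in>{1, 2, 3}. lie_dim (so_lie scale g (V r)) = 1"
    using T.so_dim_n n by simp
  obtain J1 J2 J3 where ne: "J1 \<noteq> 0" "J2 \<noteq> 0" "J3 \<noteq> 0"
    and T1: "(J1, 0, - J3) \<in> tri (V 1) (V 2) (V 3)" and T2: "(0, J2, - J3) \<in> tri (V 1) (V 2) (V 3)"
    using T.tri_two[OF n] by blast
  define J :: "nat \<Rightarrow> 'v \<Rightarrow> 'v" where "J r = (if r = 1 then J1 else if r = 2 then J2 else J3)" for r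
  have J: "J 1 = J1" "J 2 = J2" "J 3 = J3"
    by (simp_all add: J_def)
  have "J3 \<in> so (V 3)"
    using fn.subspace_neg[OF so_subspace[OF T.sub(3)] T.tri_so(3)[OF T1]] by simp
  then have Jso: "J r \<in> so (V r)" "J r \<noteq> 0" if "r \<in> {1, 2, 3}" for r
    using that ne T.tri_so[OF T1] T.tri_so[OF T2] by (auto simp: J_def)
  have line: "lie_iso (\<lambda>a. lsmult (so_lie scale g (V r)) a (J r)) lie_line (so_lie scale g (V r))"
    "so (V r) = range (\<lambda>a x. scale a (J r x))"
    "lie_abelian (so_lie scale g (V r))" if r: "r \<in> {1, 2, 3}" for r
    using so_line[OF V_subspace[OF r] _ Jso[OF r]] dim1 r by blast+
  have inj: "(\<lambda>x. scale a (J r x)) = (\<lambda>x. scale b (J r x)) \<longleftrightarrow> a = b" if r: "r \<in> {1, 2, 3}" for r a b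
  proof -
    obtain x where "J r x \<noteq> 0" using Jso(2)[OF r] by (auto simp: fun_eq_iff)
    then show ?thesis by (metis scale_cancel_right)
  qed
  let ?\<phi> = "\<lambda>(a, b, c). (\<lambda>x. scale a (J 1 x), \<lambda>x. scale b (J 2 x), \<lambda>x. scale c (J 3 x))"
  have plane_iff: "?\<phi> (a, b, c) \<in> tri (V 1) (V 2) (V 3) \<longleftrightarrow> a + b + c = 0" for a b c
    using T.tri_plane[OF T1 T2 ne(3)] unfolding J by simp
  have in_so: "(\<lambda>x. scale a (J r x)) \<in> so (V r)" if "r \<in> {1, 2, 3}" for r a
    using line(2)[OF that] by blast
  have zero: "lbracket (so_lie scale g (V r)) f h = 0" if "r \<in> {1, 2, 3}" "f \<in> so (V r)" "h \<in> so (V r)"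
    for r f h
    using line(3)[OF that(1)] that(2,3) by (simp add: lie_abelian_def)
  have tri_zero: "lbracket (triality_lie scale g V \<tau>) u v = 0"
    if u: "u \<in> tri (V 1) (V 2) (V 3)" and v: "v \<in> tri (V 1) (V 2) (V 3)" for u v
  proof -
    obtain p q r p' q' r' where uv: "u = (p, q, r)" "v = (p', q', r')"
      by (metis prod_cases3)
    note su = T.tri_so[OF u[unfolded uv]] and sv = T.tri_so[OF v[unfolded uv]]
    show ?thesis
      using zero[of 1, OF _ su(1) sv(1)] zero[of 2, OF _ su(2) sv(2)] zero[of 3, OF _ su(3) sv(3)]
      by (simp add: uv lbracket_triality zero_prod_def del: One_nat_def)
  qed
  show "lie_abelian (triality_lie scale g V \<tau>)"
    using tri_zero by (simp add: lie_abelian_def carrier_triality del: One_nat_def)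
  have bij: "bij_betw ?\<phi> (lcarrier lie_plane) (tri (V 1) (V 2) (V 3))"
  proof (rule bij_betwI')
    fix u v :: "'f \<times> 'f \<times> 'f"
    show "?\<phi> u = ?\<phi> v \<longleftrightarrow> u = v"
      using inj[of 1] inj[of 2] inj[of 3] by (cases u, cases v) (simp del: One_nat_def)
    assume "u \<in> lcarrier lie_plane"
    then show "?\<phi> u \<in> tri (V 1) (V 2) (V 3)"
      using plane_iff by (cases u) (simp add: lie_plane_def del: One_nat_def)
  next
    fix w assume w: "w \<in> tri (V 1) (V 2) (V 3)"
    obtain p q r where pqr: "w = (p, q, r)" by (rule prod_cases3)
    have "p \<in> so (V 1)" "q \<in> so (V 2)" "r \<in> so (V 3)"
      using T.tri_so w pqr by blast+
    then obtain a b c where "p = (\<lambda>x. scale a (J 1 x))" "q = (\<lambda>x. scale b (J 2 x))"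
      "r = (\<lambda>x. scale c (J 3 x))"
      using line(2)[of 1] line(2)[of 2] line(2)[of 3] by blast
    then have "w = ?\<phi> (a, b, c)" by (simp add: pqr)
    moreover from this have "(a, b, c) \<in> lcarrier lie_plane"
      using w plane_iff[of a b c] by (simp only: lie_plane_def) simp
    ultimately show "\<exists>u\<in>lcarrier lie_plane. w = ?\<phi> u" by blast
  qed
  have plane: "lie_iso ?\<phi> lie_plane (triality_lie scale g V \<tau>)"
    unfolding lie_iso_def carrier_triality
  proof (intro conjI ballI allI bij)
    fix u v :: "'f \<times> 'f \<times> 'f" and k
    assume u: "u \<in> lcarrier lie_plane" and v: "v \<in> lcarrier lie_plane"
    show "?\<phi> (u + v) = ?\<phi> u + ?\<phi> v"
      by (cases u, cases v) (simp add: fun_eq_iff scale_left_distrib)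
    have "lbracket lie_plane u v = (0 :: 'f \<times> 'f \<times> 'f)"
      by (cases u, cases v) (simp add: lie_plane_def lie_sum3_def lie_line_def zero_prod_def)
    moreover have "lbracket (triality_lie scale g V \<tau>) (?\<phi> u) (?\<phi> v) = 0"
      using u v bij by (intro tri_zero) (auto simp: bij_betw_def)
    ultimately show "?\<phi> (lbracket lie_plane u v) = lbracket (triality_lie scale g V \<tau>) (?\<phi> u) (?\<phi> v)"
      by (simp add: zero_prod_def zero_fun_def)
  next
    fix k and u :: "'f \<times> 'f \<times> 'f"
    show "?\<phi> (lsmult lie_plane k u) = lsmult (triality_lie scale g V \<tau>) k (?\<phi> u)"
      by (cases u) (simp add: lsmult_triality lie_plane_def lie_sum3_def lie_line_def del: One_nat_def)
  qed
  show "\<exists>J. ?lines J \<and> ?plane J"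
    by (rule exI[of _ J], intro conjI ballI line(1)) (use plane in \<open>simp_all only: lsmult_so\<close>)
  show "lie_dim (triality_lie scale g V \<tau>) = 2"
    using lie_iso_dim[OF lie_algebra_plane lie_algebra_triality plane] lie_dim_plane[where 'f = 'f] by simp
qed

text \<open>The indices are cyclic: members of \<open>P r\<close> extend to triples with zero in the
  slot after \<open>r\<close>, those of \<open>M r\<close> with zero in the slot before
  \<open>r\<close>. Hence a triple with a zero slot has one entry in some \<open>P\<close> and the
  other in some \<open>M\<close>.\<close>

lemma triality_four:
  assumes n: "n = 4"
  defines "P \<equiv> \<lambda>r :: nat. if r = 1 then Ann (V 1) (V 2) (V 3) else if r = 2 then Ann (V 2) (V 3) (V 1)
      else Ann (V 3) (V 1) (V 2)"
    and "M \<equiv> \<lambda>r :: nat. if r = 1 then Ann (V 1) (V 3) (V 2) else if r = 2 then Ann (V 2) (V 1) (V 3)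
      else Ann (V 3) (V 2) (V 1)"
  shows "\<forall>r\<in>{1, 2, 3}.
              direct_sum2 (P r) (M r) (lcarrier (so_lie scale g (V r))) \<and>
              (\<forall>S\<in>{P r, M r}.
                 lie_ideal S (so_lie scale g (V r)) \<and>
                 lie_simple ((so_lie scale g (V r))\<lparr>lcarrier := S\<rparr>) \<and>
                 lie_dim ((so_lie scale g (V r))\<lparr>lcarrier := S\<rparr>) = 3) \<and>
              (\<exists>W \<phi> \<psi>. subspace W \<and> W \<subseteq> V r \<and>
                 dim W = 3 \<and> nondegenerate_on g W \<and>
                 lie_iso \<phi> (so_lie scale g W) ((so_lie scale g (V r))\<lparr>lcarrier := P r\<rparr>) \<and>
                 lie_iso \<psi> (so_lie scale g W) ((so_lie scale g (V r))\<lparr>lcarrier := M r\<rparr>))"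
    and "lcarrier (triality_lie scale g V \<tau>) \<inter> (M 1 \<times> M 2 \<times> M 3) = {0}"
    and "lie_iso
             (\<lambda>(p, q, r). (component (P 1) (M 1) p, component (P 2) (M 2) q, component (P 3) (M 3) r))
             (triality_lie scale g V \<tau>)
             (lie_sum3 ((so_lie scale g (V 1))\<lparr>lcarrier := P 1\<rparr>)
                       ((so_lie scale g (V 2))\<lparr>lcarrier := P 2\<rparr>)
                       ((so_lie scale g (V 3))\<lparr>lcarrier := P 3\<rparr>))" (is ?iso)
    and "lie_dim (triality_lie scale g V \<tau>) = 9"
proof -
  interpret T: quaternionic_triple scale g "tri_prod g \<tau>" "V 1" "V 2" "V 3" n
    using n composition_triple by (auto simp: quaternionic_triple_def quaternionic_triple_axioms_def simp del: One_nat_def)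
  interpret R1: quaternionic_triple scale g "tri_prod g \<tau>" "V 2" "V 3" "V 1" n by (rule T.quaternionic_triple_rotate)
  interpret R2: quaternionic_triple scale g "tri_prod g \<tau>" "V 3" "V 1" "V 2" n by (rule R1.quaternionic_triple_rotate)
  interpret X1: lie_split "so_lie scale g (V 1)" "P 1" "M 1"
    unfolding P_def M_def by simp (rule T.lie_split_Ann[unfolded One_nat_def])
  interpret X2: lie_split "so_lie scale g (V 2)" "P 2" "M 2"
    unfolding P_def M_def by simp (rule R1.lie_split_Ann[unfolded One_nat_def])
  interpret X3: lie_split "so_lie scale g (V 3)" "P 3" "M 3"
    unfolding P_def M_def by simp (rule R2.lie_split_Ann[unfolded One_nat_def])
  have PM: "P 1 = Ann (V 1) (V 2) (V 3)" "P 2 = Ann (V 2) (V 3) (V 1)" "P 3 = Ann (V 3) (V 1) (V 2)"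
    "M 1 = Ann (V 1) (V 3) (V 2)" "M 2 = Ann (V 2) (V 1) (V 3)" "M 3 = Ann (V 3) (V 2) (V 1)"
    by (simp_all add: P_def M_def)
  let ?Q = "\<lambda>r. direct_sum2 (P r) (M r) (lcarrier (so_lie scale g (V r))) \<and>
              (\<forall>S\<in>{P r, M r}.
                 lie_ideal S (so_lie scale g (V r)) \<and>
                 lie_simple ((so_lie scale g (V r))\<lparr>lcarrier := S\<rparr>) \<and>
                 lie_dim ((so_lie scale g (V r))\<lparr>lcarrier := S\<rparr>) = 3) \<and>
              (\<exists>W \<phi> \<psi>. subspace W \<and> W \<subseteq> V r \<and>
                 dim W = 3 \<and> nondegenerate_on g W \<and>
                 lie_iso \<phi> (so_lie scale g W) ((so_lie scale g (V r))\<lparr>lcarrier := P r\<rparr>) \<and>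
                 lie_iso \<psi> (so_lie scale g W) ((so_lie scale g (V r))\<lparr>lcarrier := M r\<rparr>))"
  have "?Q 1"
    unfolding PM by (intro conjI T.Ann_direct T.chirality)
  moreover have "?Q 2"
    unfolding PM by (intro conjI R1.Ann_direct R1.chirality)
  moreover have "?Q 3"
    unfolding PM by (intro conjI R2.Ann_direct R2.chirality)
  ultimately show Q: "\<forall>r\<in>{1, 2, 3}. ?Q r"
    by (simp only: ball_simps simp_thms)
  show "lcarrier (triality_lie scale g V \<tau>) \<inter> (M 1 \<times> M 2 \<times> M 3) = {0}"
    unfolding PM carrier_triality by (rule T.tri_chiral_zero)
  have add: "lcarrier (lie_sum3 ((so_lie scale g (V 1))\<lparr>lcarrier := P 1\<rparr>)
        ((so_lie scale g (V 2))\<lparr>lcarrier := P 2\<rparr>) ((so_lie scale g (V 3))\<lparr>lcarrier := P 3\<rparr>)) = P 1 \<times> P 2 \<times> P 3"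
    by (simp add: lie_sum3_def)
  show iso: ?iso
    unfolding lie_iso_def carrier_triality add
  proof (intro conjI ballI allI)
    show "bij_betw (\<lambda>(p, q, r). (component (P 1) (M 1) p, component (P 2) (M 2) q, component (P 3) (M 3) r))
        (tri (V 1) (V 2) (V 3)) (P 1 \<times> P 2 \<times> P 3)"
      unfolding PM by (rule T.tri_chiral_bij)
  next
    fix u v assume u: "u \<in> tri (V 1) (V 2) (V 3)" and v: "v \<in> tri (V 1) (V 2) (V 3)"
    obtain p q r p' q' r' where uv: "u = (p, q, r)" "v = (p', q', r')"
      by (metis prod_cases3)
    note su = T.tri_so[OF u[unfolded uv]] and sv = T.tri_so[OF v[unfolded uv]]
    let ?f = "\<lambda>(p, q, r). (component (P 1) (M 1) p, component (P 2) (M 2) q, component (P 3) (M 3) r)"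
    show "?f (u + v) = ?f u + ?f v"
      unfolding uv using X1.component_hom(1)[OF su(1) sv(1)] X2.component_hom(1)[OF su(2) sv(2)]
        X3.component_hom(1)[OF su(3) sv(3)] by (simp del: One_nat_def)
    show "?f (lbracket (triality_lie scale g V \<tau>) u v) =
      lbracket (lie_sum3 ((so_lie scale g (V 1))\<lparr>lcarrier := P 1\<rparr>) ((so_lie scale g (V 2))\<lparr>lcarrier := P 2\<rparr>)
        ((so_lie scale g (V 3))\<lparr>lcarrier := P 3\<rparr>)) (?f u) (?f v)"
      unfolding uv using X1.component_hom(2)[OF su(1) sv(1)] X2.component_hom(2)[OF su(2) sv(2)]
        X3.component_hom(2)[OF su(3) sv(3)] by (simp add: lbracket_triality lie_sum3_def del: One_nat_def)
  next
    fix c u assume u: "u \<in> tri (V 1) (V 2) (V 3)"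
    obtain p q r where uv: "u = (p, q, r)" by (rule prod_cases3)
    note su = T.tri_so[OF u[unfolded uv]]
    let ?f = "\<lambda>(p, q, r). (component (P 1) (M 1) p, component (P 2) (M 2) q, component (P 3) (M 3) r)"
    show "?f (lsmult (triality_lie scale g V \<tau>) c u) =
      lsmult (lie_sum3 ((so_lie scale g (V 1))\<lparr>lcarrier := P 1\<rparr>) ((so_lie scale g (V 2))\<lparr>lcarrier := P 2\<rparr>)
        ((so_lie scale g (V 3))\<lparr>lcarrier := P 3\<rparr>)) c (?f u)"
      unfolding uv using X1.component_smult[OF su(1), of c] X2.component_smult[OF su(2), of c]
        X3.component_smult[OF su(3), of c] by (simp add: lsmult_triality lie_sum3_def lsmult_so del: One_nat_def)
  qed
  have "lie_dim ((so_lie scale g (V r))\<lparr>lcarrier := P r\<rparr>) = 3" if "r \<in> {1, 2, 3}" for r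
    using Q that by blast
  then show "lie_dim (triality_lie scale g V \<tau>) = 9"
    using lie_iso_dim[OF lie_algebra_triality _ iso] lie_sum3_dim[OF X1.lie_algebra_P X2.lie_algebra_P X3.lie_algebra_P]
      lie_algebra_sum3[OF X1.lie_algebra_P X2.lie_algebra_P X3.lie_algebra_P] by (simp del: One_nat_def)
qed

lemma triality_eight:
  assumes n: "n = 8"
  shows "lie_iso (\<lambda>(p, q, r). p) (triality_lie scale g V \<tau>) (so_lie scale g (V 1))" (is ?iso1)
    and "lie_iso (\<lambda>(p, q, r). q) (triality_lie scale g V \<tau>) (so_lie scale g (V 2))" (is ?iso2)
    and "lie_iso (\<lambda>(p, q, r). r) (triality_lie scale g V \<tau>) (so_lie scale g (V 3))" (is ?iso3)
    and "lie_dim (triality_lie scale g V \<tau>) = 28"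
proof -
  interpret T: composition_triple scale g "tri_prod g \<tau>" "V 1" "V 2" "V 3" n
    using n by (intro composition_triple) simp
  interpret R1: composition_triple scale g "tri_prod g \<tau>" "V 2" "V 3" "V 1" n by (rule T.trip_rotate)
  interpret R2: composition_triple scale g "tri_prod g \<tau>" "V 3" "V 1" "V 2" n by (rule R1.trip_rotate)
  \<comment> \<open>The projections to the second and third slot become first projections after
    cyclic shifts.\<close>
  have rot: "bij_betw (\<lambda>(p, q, r). (q, r, p)) (tri A B C) (tri B C A)" for A B C
    by (rule bij_betw_byWitness[where f' = "\<lambda>(q, r, p). (p, q, r)"]) (auto dest: tri_rotate)
  have eq: "(\<lambda>(p, q, r). p) \<circ> (\<lambda>(p, q, r). (q, r, p)) = (\<lambda>(p, q, r). q)"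
    "(\<lambda>(p, q, r). q) \<circ> (\<lambda>(p, q, r). (q, r, p)) = (\<lambda>(p, q, r). r)"
    by (auto simp: fun_eq_iff)
  have bij1: "bij_betw (\<lambda>(p, q, r). p) (tri (V 1) (V 2) (V 3)) (so (V 1))"
    by (rule T.bij_first_eight[OF n])
  have bij2: "bij_betw (\<lambda>(p, q, r). q) (tri (V 1) (V 2) (V 3)) (so (V 2))"
    using bij_betw_trans[OF rot R1.bij_first_eight[OF n]] unfolding eq .
  have bij3: "bij_betw (\<lambda>(p, q, r). r) (tri (V 1) (V 2) (V 3)) (so (V 3))"
    using bij_betw_trans[OF rot bij_betw_trans[OF rot R2.bij_first_eight[OF n]]]
    unfolding eq o_assoc[symmetric] comp_assoc .
  show iso: ?iso1 and ?iso2 and ?iso3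
    unfolding lie_iso_def carrier_triality
    using bij1 bij2 bij3 by (auto simp: lsmult_triality lbracket_triality lsmult_so simp del: One_nat_def)
  show "lie_dim (triality_lie scale g V \<tau>) = 28"
    using lie_iso_dim[OF lie_algebra_triality _ iso] lie_algebra_so[of 1] T.so_dim_n[of "V 1"] n
    by (simp del: One_nat_def)
qed

end

theorem theorem1:
  fixes scale :: "'f::field_char_0 \<Rightarrow> 'v::ab_group_add \<Rightarrow> 'v"
    and g :: "'v \<Rightarrow> 'v \<Rightarrow> 'f"
    and V :: "nat \<Rightarrow> 'v set"
    and \<tau> :: "'v \<Rightarrow> 'v \<Rightarrow> 'v \<Rightarrow> 'f"
    and n :: nat
  assumes "triality scale g V \<tau> n"
    and "n \<in> {1, 2, 4, 8}"
  shows
    "(n = 1 \<longrightarrow> lcarrier (triality_lie scale g V \<tau>) = {0}) \<and>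
     (n = 2 \<longrightarrow>
        (\<forall>r\<in>{1, 2, 3}. lie_dim (so_lie scale g (V r)) = 1) \<and>
        (\<exists>J :: nat \<Rightarrow> 'v \<Rightarrow> 'v.
           (\<forall>r\<in>{1, 2, 3}. lie_iso (\<lambda>a. lsmult (so_lie scale g (V r)) a (J r))
              lie_line (so_lie scale g (V r))) \<and>
           lie_iso
             (\<lambda>(a, b, c). (lsmult (so_lie scale g (V 1)) a (J 1),
                           lsmult (so_lie scale g (V 2)) b (J 2),
                           lsmult (so_lie scale g (V 3)) c (J 3)))
             lie_plane (triality_lie scale g V \<tau>)) \<and>
        lie_abelian (triality_lie scale g V \<tau>) \<and>
        lie_dim (triality_lie scale g V \<tau>) = 2) \<and>
     (n = 4 \<longrightarrow>
        (\<exists>P M :: nat \<Rightarrow> ('v \<Rightarrow> 'v) set.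
           (\<forall>r\<in>{1, 2, 3}.
              direct_sum2 (P r) (M r) (lcarrier (so_lie scale g (V r))) \<and>
              (\<forall>S\<in>{P r, M r}.
                 lie_ideal S (so_lie scale g (V r)) \<and>
                 lie_simple ((so_lie scale g (V r))\<lparr>lcarrier := S\<rparr>) \<and>
                 lie_dim ((so_lie scale g (V r))\<lparr>lcarrier := S\<rparr>) = 3) \<and>
              (\<exists>W \<phi> \<psi>. module.subspace scale W \<and> W \<subseteq> V r \<and>
                 vector_space.dim scale W = 3 \<and> nondegenerate_on g W \<and>
                 lie_iso \<phi> (so_lie scale g W) ((so_lie scale g (V r))\<lparr>lcarrier := P r\<rparr>) \<and>
                 lie_iso \<psi> (so_lie scale g W) ((so_lie scale g (V r))\<lparr>lcarrier := M r\<rparr>))) \<and>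
           lcarrier (triality_lie scale g V \<tau>) \<inter> (M 1 \<times> M 2 \<times> M 3) = {0} \<and>
           lie_iso
             (\<lambda>(p, q, r). (component (P 1) (M 1) p, component (P 2) (M 2) q, component (P 3) (M 3) r))
             (triality_lie scale g V \<tau>)
             (lie_sum3 ((so_lie scale g (V 1))\<lparr>lcarrier := P 1\<rparr>)
                       ((so_lie scale g (V 2))\<lparr>lcarrier := P 2\<rparr>)
                       ((so_lie scale g (V 3))\<lparr>lcarrier := P 3\<rparr>))) \<and>
        lie_dim (triality_lie scale g V \<tau>) = 9) \<and>
     (n = 8 \<longrightarrow>
        lie_iso (\<lambda>(p, q, r). p) (triality_lie scale g V \<tau>) (so_lie scale g (V 1)) \<and>
        lie_iso (\<lambda>(p, q, r). q) (triality_lie scale g V \<tau>) (so_lie scale g (V 2)) \<and>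
        lie_iso (\<lambda>(p, q, r). r) (triality_lie scale g V \<tau>) (so_lie scale g (V 3)) \<and>
        lie_dim (triality_lie scale g V \<tau>) = 28)"
proof -
  interpret triality scale g V \<tau> n by fact
  show ?thesis
  proof (intro conjI impI)
    assume n: "n = 4"
    show "\<exists>P M. (\<forall>r\<in>{1, 2, 3}.
              direct_sum2 (P r) (M r) (lcarrier (so_lie scale g (V r))) \<and>
              (\<forall>S\<in>{P r, M r}.
                 lie_ideal S (so_lie scale g (V r)) \<and>
                 lie_simple ((so_lie scale g (V r))\<lparr>lcarrier := S\<rparr>) \<and>
                 lie_dim ((so_lie scale g (V r))\<lparr>lcarrier := S\<rparr>) = 3) \<and>
              (\<exists>W \<phi> \<psi>. module.subspace scale W \<and> W \<subseteq> V r \<and>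
                 vector_space.dim scale W = 3 \<and> nondegenerate_on g W \<and>
                 lie_iso \<phi> (so_lie scale g W) ((so_lie scale g (V r))\<lparr>lcarrier := P r\<rparr>) \<and>
                 lie_iso \<psi> (so_lie scale g W) ((so_lie scale g (V r))\<lparr>lcarrier := M r\<rparr>))) \<and>
           lcarrier (triality_lie scale g V \<tau>) \<inter> (M 1 \<times> M 2 \<times> M 3) = {0} \<and>
           lie_iso
             (\<lambda>(p, q, r). (component (P 1) (M 1) p, component (P 2) (M 2) q, component (P 3) (M 3) r))
             (triality_lie scale g V \<tau>)
             (lie_sum3 ((so_lie scale g (V 1))\<lparr>lcarrier := P 1\<rparr>)
                       ((so_lie scale g (V 2))\<lparr>lcarrier := P 2\<rparr>)
                       ((so_lie scale g (V 3))\<lparr>lcarrier := P 3\<rparr>))"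
      by (intro exI conjI) (rule triality_four(1-3)[OF n])+
  qed (fact triality_one triality_two triality_four(4) triality_eight)+
qed

end
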